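(* Let $\mathcal D_1$ be a sub-exponential probability distribution supported on the positive reals, with mean $\mu_{\mathcal D_1}$, and let $\mathcal D_2$ be a sub-exponential probability distribution on $\mathbb R$ with mean $v_{\mathcal D_2}$. Let $\mu_1,\mu_2,\dots$ be i.i.d. with law $\mathcal D_1$ and $v_1,v_2,\dots$ i.i.d. with law $\mathcal D_2$, all independent, and set $\lambda_n=v_n+i\mu_n$ (assumed almost surely pairwise distinct). For each $N\ge 1$ let $$c_n=\prod_{\ell=1}^N(\lambda_n-\overline{\lambda_\ell})\prod_{\ell=1,\,\ell\ne n}^N\frac1{\lambda_n-\lambda_\ell},\qquad n=1,\dots,N,$$ and let $\psi_{N,III}(x,t)$ be the reflectionless $N$-soliton solution of the focusing NLS equation with scattering data $\{\lambda_n,c_n\}_{n=1}^N$. Let $\mathfrak K\subset\mathbb R^2$ be compact. Then for all $(X,T)\in\mathfrak K$ there exist $N_0>0$, a constant $C=C(N_0,X,T)>0$ and $\varepsilon>0$ such that for all $N>N_0$ $$\mathbb E\left[\left|\frac{2}{N\mu_{\mathcal D_1}}\,\psi_{N,III}\!\left(\frac{2X}{N\mu_{\mathcal D_1}},\frac{4T}{N^2\mu_{\mathcal D_1}^2}\right)-\Psi_{III}(X,T)\right|\right]\le C N^{-\varepsilon},$$ where the expectation is with respect to the product measure of $\{\mu_n,v_n\}_{n=1}^N$. Furthermore, for all $N>0$, $|\psi_{N,III}(0,0)|=2\sum_{j=1}^N\mu_j$, so that $\psi_{N,III}$ is an extremal solution.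
   Context: A random variable $\mathfrak X$ is sub-exponential if there is $K>0$ with $\mathbb P(|\mathfrak X|>t)\le 2e^{-t/K}$ for all $t\ge 0$. Focusing NLS: $i\partial_t\psi=-\tfrac12\partial_x^2\psi-|\psi|^2\psi$, $(x,t)\in\mathbb R^2$. $N$-soliton solution. Given distinct $\lambda_1,\dots,\lambda_N$ in the open upper half-plane and nonzero $c_1,\dots,c_N\in\mathbb C$, put $\theta(z;x,t)=zx+z^2t$. Let $M(z)=M(z;x,t)$ be the unique $2\times2$ meromorphic matrix function on $\mathbb C$ with $M(z)=I+O(z^{-1})$ as $z\to\infty$, whose only singularities are simple poles at $\lambda_n,\overline{\lambda_n}$ with $$\operatorname{Res}_{\lambda_n}M=\lim_{z\to\lambda_n}M(z)\begin{pmatrix}0&0\\c_ne^{2i\theta(\lambda_n;x,t)}&0\end{pmatrix},\quad \operatorname{Res}_{\overline{\lambda_n}}M=\lim_{z\to\overline{\lambda_n}}M(z)\begin{pmatrix}0&-\overline{c_n}e^{-2i\theta(\overline{\lambda_n};x,t)}\\0&0\end{pmatrix}.$$ Then $\psi_N(x,t):=2i\lim_{z\to\infty}zM_{12}(z;x,t)$ is the reflectionless $N$-soliton solution with scattering data $\{\lambda_n,c_n\}_{n=1}^N$. Every $N$-soliton solution satisfies $|\psi_N(x,t)|\le 2\sum_n\Im\lambda_n$ for all $x,t$; it is called extremal if this bound is attained at some point. The limit $\Psi_{III}$ (Bilman–Ling–Miller). For $(X,T)\in\mathbb R^2$ let $R(Z)=R(Z;X,T)$ be the unique (known to exist) $2\times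 2$ matrix function, analytic for $|Z|\ne1$, with continuous boundary values $R_+$ (from inside) and $R_-$ (from outside) on $|Z|=1$ satisfying $$R_+(Z)=R_-(Z)\,e^{-i(XZ+TZ^2+2Z^{-1})\sigma_3}\begin{pmatrix}\frac1{\sqrt2}&\frac1{\sqrt2}\\-\frac1{\sqrt2}&\frac1{\sqrt2}\end{pmatrix}e^{i(XZ+TZ^2+2Z^{-1})\sigma_3},\quad |Z|=1,$$ and $R(Z)=I+O(Z^{-1})$ as $Z\to\infty$, where $\sigma_3=\mathrm{diag}(1,-1)$. Then $\Psi_{III}(X,T):=2i\lim_{Z\to\infty}Z\,R_{12}(Z;X,T)$. *)

theory Defs
  imports "HOL-Complex_Analysis.Complex_Analysis" "HOL-Probability.Probability"
begin

unbundle no fps_syntax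

definition mat2 :: "complex \<Rightarrow> complex \<Rightarrow> complex \<Rightarrow> complex \<Rightarrow> complex^2^2" where
  "mat2 a b c d = vector [vector [a, b], vector [c, d]]"

definition mat_holomorphic_on :: "(complex \<Rightarrow> complex^2^2) \<Rightarrow> complex set \<Rightarrow> bool" where
  "mat_holomorphic_on M S \<longleftrightarrow> (\<forall>i j. (\<lambda>z. M z $ i $ j) holomorphic_on S)"

definition mat_residue :: "(complex \<Rightarrow> complex^2^2) \<Rightarrow> complex \<Rightarrow> complex^2^2" where
  "mat_residue M p = (\<chi> i j. residue (\<lambda>z. M z $ i $ j) p)"

text \<open>Some entries may be analytic at a simple pole of a matrix function, but not all of them:
  \<open>(z - p) M(z)\<close> has a nonzero limit.\<close>

definition mat_simple_pole :: "(complex \<Rightarrow> complex^2^2) \<Rightarrow> complex \<Rightarrow> bool" where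
  "mat_simple_pole M p \<longleftrightarrow> (\<exists>A. A \<noteq> 0 \<and> ((\<lambda>z. mat (z - p) ** M z) \<longlongrightarrow> A) (at p))"

definition normalized_at_infinity :: "(complex \<Rightarrow> complex^2^2) \<Rightarrow> bool" where
  "normalized_at_infinity M \<longleftrightarrow> (\<lambda>z. norm (M z - mat 1)) \<in> O[at_infinity](\<lambda>z. 1 / norm z)"


definition theta :: "complex \<Rightarrow> real \<Rightarrow> real \<Rightarrow> complex" where
  "theta z x t = z * of_real x + z^2 * of_real t"

definition scattering_data :: "nat \<Rightarrow> (nat \<Rightarrow> complex) \<Rightarrow> (nat \<Rightarrow> complex) \<Rightarrow> bool" where
  "scattering_data N lam c \<longleftrightarrow>
     inj_on lam {1..N} \<and> (\<forall>n\<in>{1..N}. Im (lam n) > 0 \<and> c n \<noteq> 0)"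

definition soliton_rhp ::
  "nat \<Rightarrow> (nat \<Rightarrow> complex) \<Rightarrow> (nat \<Rightarrow> complex) \<Rightarrow> real \<Rightarrow> real \<Rightarrow> (complex \<Rightarrow> complex^2^2) \<Rightarrow> bool" where
  "soliton_rhp N lam c x t M \<longleftrightarrow>
     mat_holomorphic_on M (- (lam ` {1..N} \<union> (\<lambda>n. cnj (lam n)) ` {1..N})) \<and>
     normalized_at_infinity M \<and>
     (\<forall>n\<in>{1..N}.
        mat_simple_pole M (lam n) \<and>
        ((\<lambda>z. M z ** mat2 0 0 (c n * exp (2 * \<i> * theta (lam n) x t)) 0)
            \<longlongrightarrow> mat_residue M (lam n)) (at (lam n)) \<and>
        mat_simple_pole M (cnj (lam n)) \<and>
        ((\<lambda>z. M z ** mat2 0 (- cnj (c n) * exp (- 2 * \<i> * theta (cnj (lam n)) x t)) 0 0)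
            \<longlongrightarrow> mat_residue M (cnj (lam n))) (at (cnj (lam n))))"

text \<open>A HOL function \<open>M\<close> also has (irrelevant) values at the poles, so it is \<open>\<psi>\<^sub>N\<close>, and not
  \<open>M\<close> itself, that is singled out by the Riemann-Hilbert problem. The value for inadmissible
  data (a null event for the random data below) is a constant, so that \<open>\<psi>\<^sub>N\<close> stays measurable
  as a function of the data.\<close>

definition nsoliton ::
  "nat \<Rightarrow> (nat \<Rightarrow> complex) \<Rightarrow> (nat \<Rightarrow> complex) \<Rightarrow> real \<Rightarrow> real \<Rightarrow> complex" where
  "nsoliton N lam c x t =
     (if scattering_data N lam c
      then THE p. \<exists>M. soliton_rhp N lam c x t M \<and>
                    ((\<lambda>z. 2 * \<i> * (z * M z $ 1 $ 2)) \<longlongrightarrow> p) at_infinity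
      else 0)"

definition extremal_soliton :: "nat \<Rightarrow> (nat \<Rightarrow> complex) \<Rightarrow> (nat \<Rightarrow> complex) \<Rightarrow> bool" where
  "extremal_soliton N lam c \<longleftrightarrow> scattering_data N lam c \<and>
     (\<exists>x t. norm (nsoliton N lam c x t) = 2 * (\<Sum>n\<in>{1..N}. Im (lam n)))"

definition coeff_III :: "nat \<Rightarrow> (nat \<Rightarrow> complex) \<Rightarrow> nat \<Rightarrow> complex" where
  "coeff_III N lam n =
     (\<Prod>l\<in>{1..N}. lam n - cnj (lam l)) * (\<Prod>l\<in>{1..N} - {n}. 1 / (lam n - lam l))"

definition psi_NIII :: "nat \<Rightarrow> (nat \<Rightarrow> complex) \<Rightarrow> real \<Rightarrow> real \<Rightarrow> complex" where
  "psi_NIII N lam x t = nsoliton N lam (coeff_III N lam) x t"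


definition exp_sigma3 :: "complex \<Rightarrow> complex^2^2" where
  "exp_sigma3 a = mat2 (exp a) 0 0 (exp (- a))"

definition phase_III :: "real \<Rightarrow> real \<Rightarrow> complex \<Rightarrow> complex" where
  "phase_III X T Z = of_real X * Z + of_real T * Z^2 + 2 * inverse Z"

definition Q_III :: "complex^2^2" where
  "Q_III = mat2 (of_real (1 / sqrt 2)) (of_real (1 / sqrt 2))
                (of_real (- 1 / sqrt 2)) (of_real (1 / sqrt 2))"

definition rhp_III :: "real \<Rightarrow> real \<Rightarrow> (complex \<Rightarrow> complex^2^2) \<Rightarrow> bool" where
  "rhp_III X T R \<longleftrightarrow>
     mat_holomorphic_on R {Z. norm Z \<noteq> 1} \<and>
     normalized_at_infinity R \<and>
     (\<exists>Rp Rm. continuous_on (sphere 0 1) Rp \<and> continuous_on (sphere 0 1) Rm \<and>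
        (\<forall>Z\<in>sphere 0 1.
           (R \<longlongrightarrow> Rp Z) (at Z within ball 0 1) \<and>
           (R \<longlongrightarrow> Rm Z) (at Z within - cball 0 1) \<and>
           Rp Z = Rm Z ** exp_sigma3 (- \<i> * phase_III X T Z) ** Q_III
                       ** exp_sigma3 (\<i> * phase_III X T Z)))"

definition Psi_III :: "real \<Rightarrow> real \<Rightarrow> complex" where
  "Psi_III X T =
     (THE p. \<exists>R. rhp_III X T R \<and> ((\<lambda>Z. 2 * \<i> * (Z * R Z $ 1 $ 2)) \<longlongrightarrow> p) at_infinity)"


definition sub_exponential :: "'a measure \<Rightarrow> ('a \<Rightarrow> real) \<Rightarrow> bool" where
  "sub_exponential M X \<longleftrightarrow> X \<in> borel_measurable M \<and>
     (\<exists>K>0. \<forall>t\<ge>0. measure M {\<omega> \<in> space M. \<bar>X \<omega>\<bar> > t} \<le> 2 * exp (- t / K))"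

abbreviation sub_exponential_law :: "real measure \<Rightarrow> bool" where
  "sub_exponential_law D \<equiv> sub_exponential D (\<lambda>x. x)"

end

theory Submission
  imports Defs "HOL-Real_Asymp.Real_Asymp"
begin

text \<open>With \<open>B(z) = \<Prod> (z - cnj \<lambda>\<^sub>l) / (z - \<lambda>\<^sub>l)\<close> and \<open>E = exp (\<i> \<theta>)\<close>, the coefficients \<open>c\<^sub>n\<close> are the residues of
  \<open>B\<close>, and the residue conditions say that, for the columns \<open>m\<^sub>1, m\<^sub>2\<close> of \<open>M\<close>, both
  \<open>m\<^sub>1 / E - B E m\<^sub>2\<close> and \<open>E m\<^sub>2 + m\<^sub>1 / (B E)\<close> are entire. The limiting problem has the same form with
  \<open>exp (4 \<i> / Z)\<close> in place of \<open>B\<close>. Soliton matrices are products of Darboux factors that are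
  contractions in one half plane, so \<open>m\<^sub>1\<close> is bounded by \<open>max 1 \<bar>B\<bar>\<close> uniformly in \<open>N\<close>; Montel's theorem
  then solves the limiting problem. Multiplying one solution by the inverse of another gives a
  function analytic off the unit circle whose jump is linear in the difference of the two \<open>B\<close>,
  which yields uniqueness and the stability estimate without any small-norm theory. For random
  data the difference of the \<open>B\<close> is controlled by \<open>\<bar>\<Sum> \<mu>\<^sub>l / N - \<mu>\<bar> + \<Sum> \<bar>\<lambda>\<^sub>l\<bar>\<^sup>2 / N\<^sup>2\<close>, whose mean
  is \<open>O(1 / sqrt N)\<close> because second moments are finite.\<close>

unbundle no fps_syntax

section \<open>Maximum principle on the circle\<close>

text \<open>Residues at \<open>N\<close> random points cannot be compared directly with a jump on a
  circle. Two functions \<open>B\<close> can be subtracted on \<open>|z| = 1\<close>, once the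
  rescaled poles lie well inside, and this is why both problems are first brought to the same normal
  form. Since \<open>nsoliton\<close> and \<open>Psi_III\<close> are definite descriptions, each
  needs an actual solution and uniqueness of its \<open>1/z\<close> coefficient before anything can
  be estimated. The spectral scale \<open>k = N mu / 2\<close> is forced by the limit: to leading
  order \<open>B\<close> is the exponential of \<open>2 i / z\<close> times the sum of the rescaled
  imaginary parts, and this must be \<open>4 i / z\<close>, so the sum has to tend to 2. The
  obstacle in the expectation is that stability needs small rescaled data, while the law allows
  large data. There the extremal bound takes over: it grows at most linearly in the quantity that
  measures the distance of \<open>B\<close> from its limit. One linear estimate thus holds for all
  admissible data, and second moments are enough. The rate \<open>1/2\<close> is that of the
  fluctuation of the empirical mean.\<close>

definition star :: "(complex \<Rightarrow> complex) \<Rightarrow> complex \<Rightarrow> complex" where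
  "star f z = cnj (f (cnj z))"

lemma star_star [simp]: "star (star f) = f"
  by (simp add: star_def fun_eq_iff)

lemma holomorphic_on_star:
  assumes "f holomorphic_on cnj ` A" "open A"
  shows "star f holomorphic_on A"
  using holomorphic_on_compose_cnj_cnj[OF assms] by (simp add: star_def[abs_def] o_def)

lemma holomorphic_on_star_UNIV: "f holomorphic_on UNIV \<Longrightarrow> star f holomorphic_on UNIV"
  by (rule holomorphic_on_star) (auto simp: holomorphic_on_subset)

lemma continuous_on_star:
  assumes "continuous_on (cnj ` A) f"
  shows "continuous_on A (star f)"
  unfolding star_def[abs_def]
  by (intro continuous_intros continuous_on_compose2[OF assms]) auto

lemma cnj_image_ball0: "cnj ` ball 0 r = ball 0 r" and cnj_image_cball0: "cnj ` cball 0 r = cball 0 r"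
  by (auto simp: in_image_cnj_iff)

lemma Re_le_of_unit_circle:
  assumes "f holomorphic_on ball 0 1" "continuous_on (cball 0 1) f"
    and "\<And>z. norm z = 1 \<Longrightarrow> Re (f z) \<le> b"
  shows "Re (f 0) \<le> b"
  by (rule maximum_real_frontier[of f "cball 0 1"]) (use assms in auto)

text \<open>A contour-free substitute for the mean value property: on the unit circle
  \<open>k (cnj z)\<close> is the conjugate of the holomorphic function \<open>star k\<close>, so the real part of
  \<open>star k - h\<close> and the imaginary part of \<open>star k + h\<close> obey the maximum principle.\<close>

lemma circle_gap:
  assumes k: "k holomorphic_on ball 0 1" "continuous_on (cball 0 1) k"
    and h: "h holomorphic_on ball 0 1" "continuous_on (cball 0 1) h" "h 0 = 0"
    and gap: "\<And>z. norm z = 1 \<Longrightarrow> norm (k (cnj z) - h z) \<le> e"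
  shows "norm (k 0) \<le> 2 * e"
proof -
  have s: "star k holomorphic_on ball 0 1" "continuous_on (cball 0 1) (star k)"
    using k by (auto intro!: holomorphic_on_star continuous_on_star
        simp: cnj_image_ball0 cnj_image_cball0)
  have re: "Re (star k z - h z) \<le> e" "Re (h z - star k z) \<le> e"
    "Re (\<i> * (star k z + h z)) \<le> e" "Re (- \<i> * (star k z + h z)) \<le> e" if "norm z = 1" for z
    using gap[OF that] abs_Re_le_cmod[of "k (cnj z) - h z"] abs_Im_le_cmod[of "k (cnj z) - h z"]
    by (auto simp: star_def)
  have "Re (star k 0 - h 0) \<le> e"
    by (rule Re_le_of_unit_circle) (use re s h in \<open>auto intro!: holomorphic_intros continuous_intros\<close>)
  moreover have "Re (h 0 - star k 0) \<le> e"
    by (rule Re_le_of_unit_circle) (use re s h in \<open>auto intro!: holomorphic_intros continuous_intros\<close>)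
  moreover have "Re (\<i> * (star k 0 + h 0)) \<le> e"
    by (rule Re_le_of_unit_circle[of "\<lambda>z. \<i> * (star k z + h z)"])
      (use re s h in \<open>auto intro!: holomorphic_intros continuous_intros\<close>)
  moreover have "Re (- \<i> * (star k 0 + h 0)) \<le> e"
    by (rule Re_le_of_unit_circle[of "\<lambda>z. - \<i> * (star k z + h z)"])
      (use re s h in \<open>auto intro!: holomorphic_intros continuous_intros\<close>)
  ultimately have "\<bar>Re (k 0)\<bar> \<le> e" "\<bar>Im (k 0)\<bar> \<le> e"
    using h(3) by (auto simp: star_def)
  \<comment> \<open>Real and imaginary part are estimated separately, which costs the factor 2; the
    mean value property would give \<open>e\<close>.\<close>
  with cmod_le[of "k 0"] show ?thesis by linarith
qed

lemma tendsto_at_infinity_inverse: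
  fixes f :: "complex \<Rightarrow> complex"
  assumes "((\<lambda>w. f (inverse w)) \<longlongrightarrow> l) (at 0)"
  shows "(f \<longlongrightarrow> l) at_infinity"
  using assms by (simp add: lim_at_infinity_0 o_def)

text \<open>This stands in for the contour integral of \<open>p - h\<close> over the unit circle, to
  which \<open>h\<close> contributes nothing and \<open>p\<close> contributes
  \<open>2 pi i l\<close>. Inversion turns \<open>p\<close> into a function \<open>k\<close> on the
  disc with \<open>k 0 = l\<close>. On the circle \<open>1 / cnj z = z\<close>, so
  \<open>k (cnj z) = z * p z\<close>, which is compared with \<open>z * h z\<close>, a function
  vanishing at 0.\<close>

lemma outer_inner_gap:
  assumes p: "p holomorphic_on {z. norm z > 1}" "continuous_on {z. norm z \<ge> 1} p"
    and lim: "((\<lambda>z. z * p z) \<longlongrightarrow> l) at_infinity"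
    and h: "h holomorphic_on ball 0 1" "continuous_on (cball 0 1) h"
    and gap: "\<And>z. norm z = 1 \<Longrightarrow> norm (p z - h z) \<le> e"
  shows "norm l \<le> 2 * e"
proof -
  define k where "k w = (if w = 0 then l else p (inverse w) / w)" for w
  have inv: "norm (inverse w) \<ge> 1" if "norm w \<le> 1" "w \<noteq> 0" for w :: complex
    using that by (simp add: norm_inverse one_le_inverse)
  have lim0: "((\<lambda>w. p (inverse w) / w) \<longlongrightarrow> l) (at 0)"
    using lim unfolding lim_at_infinity_0 by (simp add: o_def field_simps)
  have "(k \<longlongrightarrow> l) (at 0)"
    using lim0 by (rule Lim_transform_eventually) (auto simp: k_def eventually_at intro!: exI[of _ 1])
  then have k0: "isCont k 0" by (simp add: isCont_def k_def)
  have kc: "continuous (at w within cball 0 1) k" if "w \<in> cball 0 1" for w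
  proof (cases "w = 0")
    case True
    then show ?thesis using k0 by (simp add: continuous_at_imp_continuous_at_within)
  next
    case False
    have "continuous_on (cball 0 1 - {0}) (\<lambda>w. p (inverse w) / w)"
      by (intro continuous_intros continuous_on_compose2[OF p(2)]) (auto intro!: inv)
    then have "continuous_on (cball 0 1 - {0}) k"
      by (rule continuous_on_eq) (auto simp: k_def)
    then have "continuous (at w within cball 0 1 - {0}) k"
      using False that by (auto simp: continuous_on_eq_continuous_within)
    moreover have "at w within cball 0 1 - {0} = at w within cball 0 1"
      by (rule at_within_nhd[of _ "- {0}"]) (use False in auto)
    ultimately show ?thesis by (simp add: continuous_within)
  qed
  then have kc': "continuous_on (cball 0 1) k"
    by (simp add: continuous_on_eq_continuous_within)
  have "k holomorphic_on ball 0 1 - {0}"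
  proof (rule holomorphic_transform)
    show "(\<lambda>w. p (inverse w) / w) holomorphic_on ball 0 1 - {0}"
    proof (intro holomorphic_intros holomorphic_on_compose_gen[OF _ p(1), unfolded o_def])
      show "inverse ` (ball 0 1 - {0}) \<subseteq> {z::complex. 1 < norm z}"
        by (auto simp: norm_inverse one_less_inverse)
    qed auto
  qed (auto simp: k_def)
  then have kh: "k holomorphic_on ball 0 1"
    using no_isolated_singularity[of "ball 0 1" k "{0}"] continuous_on_subset[OF kc' ball_subset_cball]
    by simp
  have "norm (k 0) \<le> 2 * e"
  proof (rule circle_gap[OF kh kc'])
    show "(\<lambda>z. z * h z) holomorphic_on ball 0 1" "continuous_on (cball 0 1) (\<lambda>z. z * h z)"
      using h by (auto intro!: holomorphic_intros continuous_intros)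
    fix z :: complex assume z: "norm z = 1"
    then have "z * cnj z = 1" by (simp add: complex_norm_square [symmetric])
    then have "inverse (cnj z) = z" "cnj z \<noteq> 0"
      by (auto simp: inverse_unique mult.commute)
    moreover have "p z / cnj z - z * h z = z * (p z - h z)"
      using \<open>z * cnj z = 1\<close> by (simp add: divide_inverse algebra_simps \<open>inverse (cnj z) = z\<close>)
    ultimately show "norm (k (cnj z) - z * h z) \<le> e"
      using gap[OF z] z by (simp add: k_def norm_mult)
  qed simp
  then show ?thesis by (simp add: k_def)
qed

lemma continuous_eq_off_finite:
  fixes f g :: "complex \<Rightarrow> complex"
  assumes "continuous_on UNIV f" "continuous_on UNIV g" "finite F" "\<And>z. z \<notin> F \<Longrightarrow> f z = g z"
  shows "f z = g z"
proof -
  have "closed {z. f z = g z}"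
    using closed_Collect_eq[OF assms(1,2)] .
  then have "closure (- F) \<subseteq> {z. f z = g z}"
    by (intro closure_minimal) (use assms(4) in auto)
  moreover have "closure (- F) = UNIV"
    using assms(3) by (simp add: closure_complement empty_interior_finite)
  ultimately show ?thesis by auto
qed

text \<open>Riemann's criterion removes the points one at a time. It survives at each remaining
  point \<open>q\<close> because it only concerns \<open>z\<close> near \<open>q\<close>, where the
  extension agrees with \<open>f\<close>.\<close>

lemma entire_extension:
  assumes "finite F" "f holomorphic_on - F" "\<And>p. p \<in> F \<Longrightarrow> ((\<lambda>z. (z - p) * f z) \<longlongrightarrow> 0) (at p)"
  obtains g where "g holomorphic_on UNIV" "\<And>z. z \<notin> F \<Longrightarrow> g z = f z"
proof -
  have "\<exists>g. g holomorphic_on UNIV \<and> (\<forall>z. z \<notin> F \<longrightarrow> g z = f z)"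
    using assms
  proof (induction F arbitrary: f rule: finite_induct)
    case empty
    then show ?case by auto
  next
    case (insert p F)
    have o: "open (- F)" using insert.hyps by (simp add: finite_imp_closed open_Compl)
    have "f holomorphic_on (- F) - {p}" using insert.prems(1) by (rule holomorphic_on_subset) auto
    moreover have "p \<in> interior (- F)" using o insert.hyps by (simp add: interior_open)
    ultimately obtain g where g: "g holomorphic_on - F" "\<And>z. z \<in> - F - {p} \<Longrightarrow> g z = f z"
      using holomorphic_on_extend_lim[of f "- F" p] insert.prems(2)[of p] by auto
    have "((\<lambda>z. (z - q) * g z) \<longlongrightarrow> 0) (at q)" if "q \<in> F" for q
    proof (rule Lim_transform_eventually)
      show "((\<lambda>z. (z - q) * f z) \<longlongrightarrow> 0) (at q)" using insert.prems(2) that by auto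
      have "\<forall>\<^sub>F z in at q. z \<notin> insert p F - {q}"
      proof (rule eventually_mono[OF eventually_at_in_open'])
        show "open (- (insert p F - {q}))"
          using insert.hyps by (intro open_Compl finite_imp_closed) simp
      qed auto
      then show "\<forall>\<^sub>F z in at q. (z - q) * f z = (z - q) * g z"
        using eventually_neq_at_within[of q q UNIV]
        by eventually_elim (use g(2) in auto)
    qed
    from insert.IH[OF g(1) this] obtain h where
      "h holomorphic_on UNIV" "\<forall>z. z \<notin> F \<longrightarrow> h z = g z" by auto
    then show ?case using g(2) by (intro exI[of _ h]) auto
  qed
  then show ?thesis using that by blast
qed

section \<open>Darboux steps\<close>

definition wedge :: "complex \<times> complex \<Rightarrow> complex \<times> complex \<Rightarrow> complex" where
  "wedge w v = fst w * snd v - snd w * fst v"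

text \<open>Antilinear, and orthogonal to \<open>v\<close> for the Hermitian product. It encodes the
  symmetry between the two columns of a soliton matrix.\<close>

definition perp :: "complex \<times> complex \<Rightarrow> complex \<times> complex" where
  "perp v = (- cnj (snd v), cnj (fst v))"

text \<open>Multiplication by the Blaschke factor \<open>b(z) = (z - cnj l) / (z - l)\<close> on the line spanned
  by \<open>perp w\<close>, and the identity on the line spanned by \<open>w\<close>.\<close>

definition darboux :: "complex \<Rightarrow> complex \<times> complex \<Rightarrow> complex \<Rightarrow> complex \<times> complex \<Rightarrow> complex \<times> complex" where
  "darboux l w z v =
     (fst v + (l - cnj l) / (z - l) * (wedge w v / of_real ((norm w)\<^sup>2)) * fst (perp w),
      snd v + (l - cnj l) / (z - l) * (wedge w v / of_real ((norm w)\<^sup>2)) * snd (perp w))"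

text \<open>A factor \<open>darboux l w\<close> creates a pole at \<open>l\<close> with residue
  proportional to \<open>wedge w v\<close>. With \<open>w\<close> the dressed vector
  \<open>(1 / E, - E)\<close> at the new pole, this residue vanishes for that vector, which
  therefore stays entire through all steps. This is how the residue conditions are built in.\<close>

primrec dress :: "(complex \<Rightarrow> complex) \<Rightarrow> (nat \<Rightarrow> complex) \<Rightarrow> nat \<Rightarrow> complex \<Rightarrow> complex \<times> complex \<Rightarrow> complex \<times> complex" where
  "dress E lam 0 = (\<lambda>z v. v)"
| "dress E lam (Suc k) = (\<lambda>z v. darboux (lam (Suc k))
      (dress E lam k (lam (Suc k)) (inverse (E (lam (Suc k))), - E (lam (Suc k)))) z (dress E lam k z v))"

definition dvec :: "(complex \<Rightarrow> complex) \<Rightarrow> (nat \<Rightarrow> complex) \<Rightarrow> nat \<Rightarrow> complex \<times> complex" where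
  "dvec E lam k = dress E lam k (lam (Suc k)) (inverse (E (lam (Suc k))), - E (lam (Suc k)))"

lemma dress_Suc: "dress E lam (Suc k) z v = darboux (lam (Suc k)) (dvec E lam k) z (dress E lam k z v)"
  by (simp add: dvec_def)

declare dress.simps(2) [simp del]

definition blaschke :: "(nat \<Rightarrow> complex) \<Rightarrow> nat \<Rightarrow> complex \<Rightarrow> complex" where
  "blaschke lam N z = (\<Prod>l\<in>{1..N}. (z - cnj (lam l)) / (z - lam l))"

lemma blaschke_0 [simp]: "blaschke lam 0 z = 1"
  and blaschke_Suc: "blaschke lam (Suc k) z =
    (z - cnj (lam (Suc k))) / (z - lam (Suc k)) * blaschke lam k z"
  by (simp_all add: blaschke_def)

lemma norm_sq_prod': "(norm w)\<^sup>2 = (norm (fst w))\<^sup>2 + (norm (snd w))\<^sup>2"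
  for w :: "complex \<times> complex"
  by (cases w) (simp add: norm_prod_def)

lemma norm_sq_prod: "of_real ((norm w)\<^sup>2) = fst w * cnj (fst w) + snd w * cnj (snd w)"
  for w :: "complex \<times> complex"
  by (simp only: norm_sq_prod' of_real_add complex_norm_square)

lemma darboux_linear:
  "darboux l w z (a * v1 + b * v1', a * v2 + b * v2') =
    (a * fst (darboux l w z (v1, v2)) + b * fst (darboux l w z (v1', v2')),
     a * snd (darboux l w z (v1, v2)) + b * snd (darboux l w z (v1', v2')))"
  by (simp add: darboux_def wedge_def algebra_simps add_divide_distrib diff_divide_distrib)

definition herm :: "complex \<times> complex \<Rightarrow> complex \<times> complex \<Rightarrow> complex" where
  "herm v v' = fst v * cnj (fst v') + snd v * cnj (snd v')"

lemma darboux_conv: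
  "darboux l (w1, w2) z (v1, v2) =
    (let c = (l - cnj l) / (z - l); e = (w1 * v2 - w2 * v1) / (w1 * cnj w1 + w2 * cnj w2)
     in (v1 - c * e * cnj w2, v2 + c * e * cnj w1))"
  unfolding darboux_def norm_sq_prod by (simp add: wedge_def perp_def Let_def)

lemma pair_nz:
  fixes w1 w2 :: complex
  assumes "(w1, w2) \<noteq> 0"
  shows "w1 * cnj w1 + w2 * cnj w2 \<noteq> 0"
proof -
  have "w1 * cnj w1 + w2 * cnj w2 = of_real ((norm (w1, w2))\<^sup>2)"
    unfolding norm_sq_prod by simp
  with assms show ?thesis by (metis norm_eq_zero of_real_eq_0_iff power_eq_0_iff)
qed

text \<open>Denominators are cleared to make the claim polynomial. The corrections with weights
  \<open>c\<close>, \<open>d\<close> and \<open>c * d\<close> are all multiples of the same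
  \<open>e * e' * n\<close>. The identity serves twice: for the pairing at conjugate points, where
  \<open>c + d + c * d = 0\<close>, and for the norm, where \<open>d = cnj c\<close>.\<close>

lemma darboux_product_identity:
  fixes v1 v2 w1 w2 a1 a2 b1 b2 c d e e' n :: complex
  assumes "e * n = w1 * v2 - w2 * v1" "e' * n = a1 * b2 - a2 * b1" "n = w1 * a1 + w2 * a2"
  shows "(v1 - c * e * a2) * (b1 - d * e' * w2) + (v2 + c * e * a1) * (b2 + d * e' * w1) =
    v1 * b1 + v2 * b2 + (c + d + c * d) * (e * e' * n)"
  using assms by algebra

text \<open>Only components along \<open>perp w\<close> change, by the factors \<open>b(z)\<close>
  and \<open>b(cnj z)\<close>, and \<open>b(z) * cnj (b(cnj z)) = 1\<close>; this is
  \<open>cd\<close> below.\<close>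

lemma darboux_herm:
  assumes "w \<noteq> 0" "z \<noteq> l" "z \<noteq> cnj l"
  shows "herm (darboux l w z v) (darboux l w (cnj z) v') = herm v v'"
proof -
  have l: "z - l \<noteq> 0" "z - cnj l \<noteq> 0" using assms by auto
  obtain w1 w2 where w: "w = (w1, w2)" by (cases w)
  obtain v1 v2 where v: "v = (v1, v2)" by (cases v)
  obtain v1' v2' where v': "v' = (v1', v2')" by (cases v')
  define n where "n = w1 * cnj w1 + w2 * cnj w2"
  have n: "n \<noteq> 0" using pair_nz assms(1) by (simp add: n_def w)
  have "cnj n = n" by (simp add: n_def)
  define c d e e' where "c = (l - cnj l) / (z - l)" and "d = (cnj l - l) / (z - cnj l)"
    and "e = (w1 * v2 - w2 * v1) / n" and "e' = (cnj w1 * cnj v2' - cnj w2 * cnj v1') / n"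
  have cd: "c + d + c * d = 0"
    unfolding c_def d_def using l by (simp add: divide_simps) (simp add: algebra_simps)
  have 1: "darboux l w z v = (v1 - c * e * cnj w2, v2 + c * e * cnj w1)"
    by (simp add: w v darboux_conv c_def e_def n_def)
  have 2: "cnj (fst (darboux l w (cnj z) v')) = cnj v1' - d * e' * w2"
    "cnj (snd (darboux l w (cnj z) v')) = cnj v2' + d * e' * w1"
    unfolding w v' d_def e'_def darboux_conv Let_def n_def by simp_all
  show ?thesis
    using darboux_product_identity[of e n w1 v2 w2 v1 e' "cnj w1" "cnj v2'" "cnj w2" "cnj v1'" c d, OF _ _ n_def] n
    unfolding herm_def 1 2 fst_conv snd_conv unfolding cd v v' by (simp add: e_def e'_def)
qed

text \<open>\<open>perp\<close> exchanges the fixed line of the Darboux factor with the line that is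
  multiplied by \<open>b\<close>. Antilinearity turns \<open>b(cnj z)\<close> into
  \<open>1 / b(z)\<close>, so the overall factor \<open>b(z)\<close> is right on both lines.\<close>

lemma darboux_perp:
  assumes "w \<noteq> 0" "z \<noteq> l" "z \<noteq> cnj l"
  shows "darboux l w z (perp v) =
    ((z - cnj l) / (z - l) * fst (perp (darboux l w (cnj z) v)),
     (z - cnj l) / (z - l) * snd (perp (darboux l w (cnj z) v)))"
proof -
  have l: "z - l \<noteq> 0" "z - cnj l \<noteq> 0" using assms by auto
  obtain w1 w2 where w: "w = (w1, w2)" by (cases w)
  obtain v1 v2 where v: "v = (v1, v2)" by (cases v)
  define n where "n = w1 * cnj w1 + w2 * cnj w2"
  have n: "n \<noteq> 0" using pair_nz assms(1) by (simp add: n_def w)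
  define c d b e1 e where "c = (l - cnj l) / (z - l)" and "d = (cnj l - l) / (z - cnj l)"
    and "b = (z - cnj l) / (z - l)"
    and "e1 = (w1 * cnj v1 + w2 * cnj v2) / n" and "e = (cnj w1 * cnj v2 - cnj w2 * cnj v1) / n"
  have b: "b = 1 + c" unfolding b_def c_def using l by (simp add: divide_simps)
  have bd: "b * d = - c"
    unfolding b_def c_def d_def using l by (simp add: divide_simps)
  have e: "e1 * n = w1 * cnj v1 + w2 * cnj v2" "e * n = cnj w1 * cnj v2 - cnj w2 * cnj v1"
    using n by (simp_all add: e1_def e_def)
  \<comment> \<open>The expansion \<open>perp v = e1 perp w - e w\<close> in the orthogonal basis,
    multiplied by \<open>n\<close> so that it becomes polynomial.\<close>
  have "n * (e1 * cnj w2 - (cnj v2 - e * w1)) = 0" "n * (e1 * cnj w1 - (cnj v1 + e * w2)) = 0"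
    using e n_def by algebra+
  then have e1: "e1 * cnj w2 = cnj v2 - e * w1" "e1 * cnj w1 = cnj v1 + e * w2"
    using n by auto
  have 1: "darboux l w z (perp v) = (- cnj v2 - c * e1 * cnj w2, cnj v1 + c * e1 * cnj w1)"
    by (simp add: w v perp_def darboux_conv c_def e1_def n_def)
  have 2: "fst (perp (darboux l w (cnj z) v)) = - (cnj v2 + d * e * w1)"
    "snd (perp (darboux l w (cnj z) v)) = cnj v1 - d * e * w2"
    unfolding w v perp_def d_def e_def darboux_conv Let_def n_def by simp_all
  show ?thesis
    unfolding 1 2 b_def[symmetric] prod.inject using b bd e1 by (intro conjI; algebra)
qed

text \<open>Pythagoras: the lines of \<open>w\<close> and \<open>perp w\<close> are orthogonal,
  \<open>|wedge w v| / |w|\<close> is the length of the component along \<open>perp w\<close>, and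
  only this component is scaled, by \<open>b(z)\<close>.\<close>

lemma darboux_norm:
  assumes "w \<noteq> 0" "z \<noteq> l"
  shows "(norm (darboux l w z v))\<^sup>2 =
    (norm v)\<^sup>2 + ((norm ((z - cnj l) / (z - l)))\<^sup>2 - 1) * ((norm (wedge w v))\<^sup>2 / (norm w)\<^sup>2)"
proof -
  have l: "z - l \<noteq> 0" using assms by auto
  obtain w1 w2 where w: "w = (w1, w2)" by (cases w)
  obtain v1 v2 where v: "v = (v1, v2)" by (cases v)
  define n where "n = w1 * cnj w1 + w2 * cnj w2"
  have n: "n \<noteq> 0" using pair_nz assms(1) by (simp add: n_def w)
  have nw: "n = of_real ((norm w)\<^sup>2)" unfolding norm_sq_prod by (simp add: w n_def)
  have cn: "cnj n = n" by (simp add: n_def)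
  define c b h e where "c = (l - cnj l) / (z - l)" and "b = (z - cnj l) / (z - l)"
    and "h = w1 * v2 - w2 * v1" and "e = h / n"
  have b: "b = 1 + c" unfolding b_def c_def using l by (simp add: divide_simps)
  have e: "e * n = h" "cnj e * n = cnj h" using n by (simp_all add: e_def cn)
  have 1: "darboux l w z v = (v1 - c * e * cnj w2, v2 + c * e * cnj w1)"
    by (simp add: w v darboux_conv c_def e_def n_def h_def)
  have "of_real ((norm (darboux l w z v))\<^sup>2) =
      v1 * cnj v1 + v2 * cnj v2 + (c + cnj c + c * cnj c) * (e * cnj e * n)"
    unfolding norm_sq_prod 1 fst_conv snd_conv
    using darboux_product_identity[of e n w1 v2 w2 v1 "cnj e" "cnj w1" "cnj v2" "cnj w2" "cnj v1" c "cnj c"]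
    e n_def by (simp add: h_def)
  also have "\<dots> = of_real ((norm v)\<^sup>2) + (b * cnj b - 1) * (h * cnj h / n)"
  proof -
    have "e * cnj e * n = h * cnj h / n" using n by (simp add: e_def cn)
    then show ?thesis unfolding norm_sq_prod by (simp add: b v algebra_simps)
  qed
  also have "\<dots> = of_real ((norm v)\<^sup>2 + ((norm b)\<^sup>2 - 1) * ((norm h)\<^sup>2 / (norm w)\<^sup>2))"
    by (simp only: of_real_add of_real_mult of_real_divide of_real_diff complex_norm_square nw of_real_1)
  finally show ?thesis
    unfolding of_real_eq_iff by (simp add: b_def h_def w v wedge_def)
qed

text \<open>Lagrange's identity, in which \<open>herm v w\<close> supplies the missing
  square.\<close>

lemma wedge_le: "(norm (wedge w v))\<^sup>2 \<le> (norm w)\<^sup>2 * (norm v)\<^sup>2"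
proof -
  have "of_real ((norm (wedge w v))\<^sup>2 + (norm (herm v w))\<^sup>2) = (of_real ((norm w)\<^sup>2 * (norm v)\<^sup>2) :: complex)"
    unfolding of_real_mult norm_sq_prod of_real_add complex_norm_square
    by (simp add: wedge_def herm_def algebra_simps)
  then have "(norm (wedge w v))\<^sup>2 + (norm (herm v w))\<^sup>2 = (norm w)\<^sup>2 * (norm v)\<^sup>2"
    unfolding of_real_eq_iff .
  then show ?thesis by (smt (verit) zero_le_power2)
qed

lemma darboux_norm_le:
  assumes "w \<noteq> 0" "z \<noteq> l"
  shows "norm (darboux l w z v) \<le> max 1 (norm ((z - cnj l) / (z - l))) * norm v"
proof -
  define b where "b = norm ((z - cnj l) / (z - l))"
  define t where "t = (norm (wedge w v))\<^sup>2 / (norm w)\<^sup>2"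
  have t: "0 \<le> t" "t \<le> (norm v)\<^sup>2"
    using wedge_le[of w v] assms(1) by (auto simp: t_def divide_simps mult.commute)
  have "(norm v)\<^sup>2 + (b\<^sup>2 - 1) * t \<le> (max 1 b * norm v)\<^sup>2"
  proof (cases "b \<le> 1")
    case True
    then have "b\<^sup>2 \<le> 1" by (simp add: b_def power_le_one)
    then have "(b\<^sup>2 - 1) * t \<le> 0" using t by (simp add: mult_nonpos_nonneg)
    then show ?thesis using True by (simp add: max_def)
  next
    case False
    then have "b\<^sup>2 \<ge> 1" by simp
    then have "(b\<^sup>2 - 1) * t \<le> (b\<^sup>2 - 1) * (norm v)\<^sup>2" using t by (intro mult_left_mono) auto
    then show ?thesis using False by (simp add: max_def power_mult_distrib algebra_simps)
  qed
  then have "(norm (darboux l w z v))\<^sup>2 \<le> (max 1 b * norm v)\<^sup>2"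
    using darboux_norm[OF assms, of v] by (simp add: b_def t_def)
  then show ?thesis unfolding b_def by (rule power2_le_imp_le) simp
qed

lemma darboux_scale:
  assumes "r \<noteq> 0"
  shows "darboux (of_real r * l) w (of_real r * z) v = darboux l w z v"
proof -
  have "(of_real r * l - cnj (of_real r * l)) / (of_real r * z - of_real r * l) = (l - cnj l) / (z - l)"
    using assms by (simp flip: right_diff_distrib)
  then show ?thesis by (simp add: darboux_def)
qed

text \<open>Poles and spectral variable enter a Darboux factor only through a quotient of degree 0,
  so a real dilation is absorbed by the phase. This later trades the shrinking space-time point for
  the fixed \<open>(X, T)\<close>.\<close>

lemma dress_scale:
  assumes "r \<noteq> 0"
  shows "dress E (\<lambda>n. of_real r * lam n) k (of_real r * z) v = dress (\<lambda>z. E (of_real r * z)) lam k z v"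
  by (induction k arbitrary: z v) (simp_all add: dress_Suc dvec_def darboux_scale assms)

lemma dvec_scale:
  assumes "r \<noteq> 0"
  shows "dvec E (\<lambda>n. of_real r * lam n) k = dvec (\<lambda>z. E (of_real r * z)) lam k"
  by (simp add: dvec_def dress_scale assms)

lemma dress_linear:
  "dress E lam k z (a * v1 + b * v1', a * v2 + b * v2') =
    (a * fst (dress E lam k z (v1, v2)) + b * fst (dress E lam k z (v1', v2')),
     a * snd (dress E lam k z (v1, v2)) + b * snd (dress E lam k z (v1', v2')))"
  by (induction k) (simp_all add: dress_Suc darboux_linear)

section \<open>Iterated Darboux transformation\<close>

text \<open>The phase is kept abstract so that the original and the rescaled problem are instances
  of the same construction. \<open>E_star\<close> says that \<open>E\<close> is unimodular on the
  real line.\<close>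

locale soliton =
  fixes E :: "complex \<Rightarrow> complex" and lam :: "nat \<Rightarrow> complex" and N :: nat
  assumes E_hol: "E holomorphic_on UNIV"
    and E_star: "\<And>z. star E z * E z = 1"
    and inj: "inj_on lam {1..N}"
    and Im_pos: "\<And>n. n \<in> {1..N} \<Longrightarrow> Im (lam n) > 0"
begin

lemma E_nz [simp]: "E z \<noteq> 0"
  using E_star[of z] by auto

lemma star_E: "star E z = inverse (E z)"
  using E_star[of z] by (simp add: field_simps)

definition poles :: "nat \<Rightarrow> complex set" where
  "poles k = lam ` {1..k}"

lemma finite_poles [simp]: "finite (poles k)" "finite (cnj ` poles k)"
  by (auto simp: poles_def)

lemma poles_Suc: "poles (Suc k) = insert (lam (Suc k)) (poles k)"
  by (simp add: poles_def atLeastAtMostSuc_conv)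

lemma lam_Suc_notin: "Suc k \<le> N \<Longrightarrow> lam (Suc k) \<notin> poles k"
  using inj_on_image_mem_iff[OF inj, of "Suc k" "{1..k}"] by (simp add: poles_def)

lemma lam_notin_cnj: "n \<in> {1..N} \<Longrightarrow> k \<le> N \<Longrightarrow> lam n \<notin> cnj ` poles k"
proof
  assume n: "n \<in> {1..N}" "k \<le> N" and "lam n \<in> cnj ` poles k"
  then obtain m where "m \<in> {1..k}" "lam n = cnj (lam m)" by (auto simp: poles_def)
  then show False using Im_pos[of n] Im_pos[of m] n by auto
qed

lemma dress_herm:
  assumes "\<And>j. j < k \<Longrightarrow> dvec E lam j \<noteq> 0" "z \<notin> poles k" "z \<notin> cnj ` poles k"
  shows "herm (dress E lam k z v) (dress E lam k (cnj z) v') = herm v v'"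
  using assms
proof (induction k)
  case (Suc k)
  then have "z \<noteq> lam (Suc k)" "z \<noteq> cnj (lam (Suc k))" "dvec E lam k \<noteq> 0"
    by (auto simp: poles_Suc)
  then show ?case
    using Suc by (simp add: dress_Suc darboux_herm poles_Suc)
qed simp

lemma dress_holomorphic:
  "(\<lambda>z. fst (dress E lam k z v)) holomorphic_on - poles k"
  "(\<lambda>z. snd (dress E lam k z v)) holomorphic_on - poles k"
proof (induction k)
  case (Suc k)
  have sub: "- poles (Suc k) \<subseteq> - poles k" by (auto simp: poles_Suc)
  note h = Suc[THEN holomorphic_on_subset[OF _ sub]]
  { case 1
    show ?case unfolding dress_Suc darboux_def wedge_def fst_conv snd_conv
      by (intro holomorphic_intros h) (auto simp: poles_Suc)
  next
    case 2
    show ?case unfolding dress_Suc darboux_def wedge_def fst_conv snd_conv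
      by (intro holomorphic_intros h) (auto simp: poles_Suc) }
qed auto

text \<open>The two claims need each other. The identity with value 2 excludes common zeros of
  \<open>f\<close> and \<open>g\<close>, hence makes the next Darboux vector nonzero; nonzero
  vectors in turn make the pairing invariant, which carries the identity to the next stage. The
  value is \<open>1 + 1\<close>, from the pair \<open>(1 / E, - E)\<close>.\<close>

lemma dress_extension:
  assumes "k \<le> N"
  shows "(\<forall>j<k. dvec E lam j \<noteq> 0) \<and>
    (\<exists>f g. f holomorphic_on UNIV \<and> g holomorphic_on UNIV \<and>
      (\<forall>z. z \<notin> poles k \<longrightarrow> dress E lam k z (inverse (E z), - E z) = (f z, g z)) \<and>
      (\<forall>z. f z * star f z + g z * star g z = 2))"
  using assms
proof (induction k)
  case 0
  have "inverse (E z) * star (\<lambda>z. inverse (E z)) z + (- E z) * star (\<lambda>z. - E z) z = 2" for z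
    using star_E[of z] by (simp add: star_def field_simps)
  then show ?case
    using E_hol by (intro conjI exI[of _ "\<lambda>z. inverse (E z)"] exI[of _ "\<lambda>z. - E z"])
      (auto intro!: holomorphic_intros)
next
  case (Suc k)
  then obtain f g where nz: "\<And>j. j < k \<Longrightarrow> dvec E lam j \<noteq> 0"
    and fg: "f holomorphic_on UNIV" "g holomorphic_on UNIV"
      "\<And>z. z \<notin> poles k \<Longrightarrow> dress E lam k z (inverse (E z), - E z) = (f z, g z)"
      "\<And>z. f z * star f z + g z * star g z = 2"
    by auto
  define l w where "l = lam (Suc k)" and "w = dvec E lam k"
  have w: "w = (f l, g l)"
    using fg(3)[OF lam_Suc_notin[OF Suc.prems]] by (simp add: w_def l_def dvec_def)
  \<comment> \<open>At a common zero of \<open>f\<close> and \<open>g\<close> the left side of the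
    identity would be 0.\<close>
  have "w \<noteq> 0" using fg(4)[of l] by (auto simp: w zero_prod_def)
  with nz have nz': "\<And>j. j < Suc k \<Longrightarrow> dvec E lam j \<noteq> 0" by (auto simp: less_Suc_eq w_def)
  define h where "h z = wedge w (f z, g z)" for z
  have h: "h holomorphic_on UNIV" unfolding h_def wedge_def by (auto intro!: holomorphic_intros fg)
  have hl: "h l = 0" by (simp add: h_def w wedge_def)
  \<comment> \<open>\<open>w\<close> is the value of \<open>(f, g)\<close> at \<open>l\<close>, so
    \<open>h\<close> vanishes there and the pole of the new factor is only a divided
    difference.\<close>
  define q where "q z = (if z = l then deriv h l else (h z - h l) / (z - l))" for z
  have q: "q holomorphic_on UNIV" unfolding q_def by (rule pole_lemma_open[OF h]) simp
  define c where "c = (l - cnj l) / of_real ((norm w)\<^sup>2)"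
  define f' g' where "f' z = f z + c * q z * fst (perp w)"
    and "g' z = g z + c * q z * snd (perp w)" for z
  have hol: "f' holomorphic_on UNIV" "g' holomorphic_on UNIV"
    unfolding f'_def g'_def by (auto intro!: holomorphic_intros fg q)
  have eq: "dress E lam (Suc k) z (inverse (E z), - E z) = (f' z, g' z)" if "z \<notin> poles (Suc k)" for z
    using that fg(3)[of z] unfolding dress_Suc darboux_def f'_def g'_def q_def c_def
    by (auto simp: poles_Suc hl hl[unfolded h_def] l_def[symmetric] w_def[symmetric] h_def mult.commute)
  \<comment> \<open>Away from the poles and their conjugates the invariance of \<open>herm\<close>
    brings back the undressed vector; continuity fills in the finitely many exceptions.\<close>
  have id: "f' z * star f' z + g' z * star g' z = 2" for z
  proof (rule continuous_eq_off_finite[where f = "\<lambda>z. f' z * star f' z + g' z * star g' z"])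
    show "continuous_on UNIV (\<lambda>z. f' z * star f' z + g' z * star g' z)"
      using hol by (intro continuous_intros holomorphic_on_imp_continuous_on holomorphic_on_star_UNIV)
    show "finite (poles (Suc k) \<union> cnj ` poles (Suc k))" by simp
    fix z assume z: "z \<notin> poles (Suc k) \<union> cnj ` poles (Suc k)"
    then have z': "cnj z \<notin> poles (Suc k)" by (auto simp: in_image_cnj_iff)
    have "f' z * star f' z + g' z * star g' z = herm (f' z, g' z) (f' (cnj z), g' (cnj z))"
      by (simp add: herm_def star_def)
    also have "\<dots> = herm (inverse (E z), - E z) (inverse (E (cnj z)), - E (cnj z))"
      using dress_herm[OF nz', of "Suc k" z "(inverse (E z), - E z)" "(inverse (E (cnj z)), - E (cnj z))"]
        z z' by (simp add: eq)
    also have "\<dots> = 2" using star_E[of z] by (simp add: herm_def star_def)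
    finally show "f' z * star f' z + g' z * star g' z = 2" .
  qed simp
  show ?case using hol eq id nz' by blast
qed

lemma dvec_nz: "j < N \<Longrightarrow> dvec E lam j \<noteq> 0"
  using dress_extension[of N] by auto

definition al :: "complex \<Rightarrow> complex" where "al z = fst (dress E lam N z (1, 0))"
definition be :: "complex \<Rightarrow> complex" where "be z = snd (dress E lam N z (1, 0))"
definition P :: "complex set" where "P = poles N \<union> cnj ` poles N"
abbreviation B :: "complex \<Rightarrow> complex" where "B \<equiv> blaschke lam N"

lemma finite_P [simp]: "finite P" by (simp add: P_def)

lemma cnj_P: "cnj z \<in> P \<longleftrightarrow> z \<in> P"
  by (auto simp: P_def image_iff) (metis complex_cnj_cnj)+

lemma al_be_holomorphic: "al holomorphic_on - poles N" "be holomorphic_on - poles N"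
  using dress_holomorphic[of N "(1, 0)"] by (simp_all add: al_def[abs_def] be_def[abs_def])

lemma open_compl_poles [simp]: "open (- poles N)" "open (- cnj ` poles N)" "open (- P)"
  by (simp_all add: open_Compl finite_imp_closed)

lemma star_holomorphic:
  assumes "f holomorphic_on - poles N"
  shows "star f holomorphic_on - cnj ` poles N"
proof (rule holomorphic_on_star)
  have "cnj ` (- cnj ` poles N) = - poles N"
    by (auto simp: in_image_cnj_iff)
  with assms show "f holomorphic_on cnj ` (- cnj ` poles N)" by simp
qed simp

lemma al_be_unit: "z \<notin> P \<Longrightarrow> al z * star al z + be z * star be z = 1"
  using dress_herm[of N z "(1, 0)" "(1, 0)"] dvec_nz
  by (simp add: herm_def al_def be_def star_def P_def)

text \<open>For \<open>v = (1, 0)\<close> this says that the dressed second basis vector is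
  \<open>B\<close> times the reflected \<open>perp\<close> of the dressed first one. Dividing by
  \<open>B\<close> gives the second column of the soliton matrix, whose poles are the conjugates
  only.\<close>

lemma dress_perp:
  assumes "k \<le> N" "z \<notin> poles k" "z \<notin> cnj ` poles k"
  shows "dress E lam k z (perp v) =
    (blaschke lam k z * fst (perp (dress E lam k (cnj z) v)),
     blaschke lam k z * snd (perp (dress E lam k (cnj z) v)))"
  using assms
proof (induction k)
  case (Suc k)
  then have z: "z \<noteq> lam (Suc k)" "z \<noteq> cnj (lam (Suc k))" "dvec E lam k \<noteq> 0"
    using dvec_nz[of k] by (auto simp: poles_Suc)
  define u where "u = dress E lam k (cnj z) v"
  have "dress E lam (Suc k) z (perp v) = darboux (lam (Suc k)) (dvec E lam k) z
     (blaschke lam k z * fst (perp u) + 0 * 0, blaschke lam k z * snd (perp u) + 0 * 0)"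
    using Suc by (simp add: dress_Suc poles_Suc u_def)
  also have "\<dots> = (blaschke lam k z * fst (darboux (lam (Suc k)) (dvec E lam k) z (perp u)),
      blaschke lam k z * snd (darboux (lam (Suc k)) (dvec E lam k) z (perp u)))"
    unfolding darboux_linear by simp
  finally show ?case
    using darboux_perp[OF z(3,1,2), of u] by (simp add: blaschke_Suc u_def dress_Suc)
qed (simp add: perp_def)

lemma blaschke_nz: "z \<notin> P \<Longrightarrow> B z \<noteq> 0"
  by (auto simp: blaschke_def P_def poles_def)

text \<open>This is the dressed vector \<open>(1 / E, - E)\<close> expanded in the two columns. It
  is the first of the two entire combinations; the second one is \<open>(- star g, star f)\<close>,
  so reflection provides it without further work.\<close>

lemma entire_pair:
  obtains f g where "f holomorphic_on UNIV" "g holomorphic_on UNIV"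
    "\<And>z. f z * star f z + g z * star g z = 2"
    "\<And>z. z \<notin> P \<Longrightarrow> f z = al z / E z + B z * E z * star be z"
    "\<And>z. z \<notin> P \<Longrightarrow> g z = be z / E z - B z * E z * star al z"
proof -
  obtain f g where fg: "f holomorphic_on UNIV" "g holomorphic_on UNIV"
      "\<And>z. z \<notin> poles N \<Longrightarrow> dress E lam N z (inverse (E z), - E z) = (f z, g z)"
      "\<And>z. f z * star f z + g z * star g z = 2"
    using dress_extension[of N] by auto
  have "f z = al z / E z + B z * E z * star be z \<and> g z = be z / E z - B z * E z * star al z"
    if z: "z \<notin> P" for z
  proof -
    have "(f z, g z) = dress E lam N z (inverse (E z) * 1 + (- E z) * 0, inverse (E z) * 0 + (- E z) * 1)"
      using fg(3)[of z] z by (simp add: P_def)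
    also have "\<dots> = (inverse (E z) * al z - E z * fst (dress E lam N z (perp (1, 0))),
        inverse (E z) * be z - E z * snd (dress E lam N z (perp (1, 0))))"
      unfolding dress_linear by (simp add: al_def be_def perp_def)
    finally show ?thesis
      using dress_perp[of N z "(1, 0)"] z
      by (simp add: P_def perp_def star_def al_def be_def field_simps)
  qed
  with fg that show ?thesis by blast
qed

lemma factor_le_1: "n \<in> {1..N} \<Longrightarrow> Im z \<le> 0 \<Longrightarrow> norm ((z - cnj (lam n)) / (z - lam n)) \<le> 1"
  and factor_ge_1: "n \<in> {1..N} \<Longrightarrow> Im z \<ge> 0 \<Longrightarrow> z \<noteq> lam n \<Longrightarrow> norm ((z - cnj (lam n)) / (z - lam n)) \<ge> 1"
proof -
  have *: "(norm (z - lam n))\<^sup>2 = (norm (z - cnj (lam n)))\<^sup>2 - 4 * Im z * Im (lam n)"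
    unfolding cmod_power2 by (simp add: power2_eq_square algebra_simps)
  { assume n: "n \<in> {1..N}" "Im z \<le> 0"
    then have "Im z * Im (lam n) \<le> 0" using Im_pos[of n] by (simp add: mult_nonpos_nonneg)
    with * have "(norm (z - cnj (lam n)))\<^sup>2 \<le> (norm (z - lam n))\<^sup>2" by linarith
    then have "norm (z - cnj (lam n)) \<le> norm (z - lam n)" by (rule power2_le_imp_le) simp
    then show "norm ((z - cnj (lam n)) / (z - lam n)) \<le> 1"
      by (auto simp: norm_divide divide_le_eq_1) }
  { assume n: "n \<in> {1..N}" "Im z \<ge> 0" "z \<noteq> lam n"
    then have "Im z * Im (lam n) \<ge> 0" using Im_pos[of n] by simp
    with * have "(norm (z - cnj (lam n)))\<^sup>2 \<ge> (norm (z - lam n))\<^sup>2" by linarith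
    then have "norm (z - cnj (lam n)) \<ge> norm (z - lam n)" by (rule power2_le_imp_le) simp
    then show "norm ((z - cnj (lam n)) / (z - lam n)) \<ge> 1"
      using n by (simp add: norm_divide) }
qed

text \<open>No bound on the vectors \<open>dvec\<close> enters, so the
  estimate is uniform in the number of solitons and in the space and time variables.\<close>

lemma dress_norm_le:
  assumes "k \<le> N" "z \<notin> poles k"
  shows "norm (dress E lam k z v) \<le> max 1 (norm (blaschke lam k z)) * norm v"
\<comment> \<open>In each closed half plane all Blaschke factors lie on the same side of 1 in
  modulus, so the bounds \<open>max 1 |b|\<close> of the single steps multiply to
  \<open>max 1 |B|\<close>.\<close>
proof (cases "Im z \<le> 0")
  case True
  have "norm (dress E lam k z v) \<le> norm v"
    using assms
  proof (induction k)
    case (Suc k)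
    let ?b = "(z - cnj (lam (Suc k))) / (z - lam (Suc k))"
    have "norm (dress E lam (Suc k) z v) \<le> max 1 (norm ?b) * norm (dress E lam k z v)"
      unfolding dress_Suc
      by (rule darboux_norm_le) (use Suc.prems dvec_nz[of k] in \<open>auto simp: poles_Suc\<close>)
    also have "max 1 (norm ?b) = 1" using factor_le_1[of "Suc k" z] Suc.prems True by simp
    finally show ?case using Suc by (simp add: poles_Suc)
  qed simp
  also have "norm v \<le> max 1 (norm (blaschke lam k z)) * norm v"
    by (simp add: mult_le_cancel_right1 not_less)
  finally show ?thesis .
next
  case False
  have "norm (dress E lam k z v) \<le> norm (blaschke lam k z) * norm v \<and> norm (blaschke lam k z) \<ge> 1"
    using assms
  proof (induction k)
    case (Suc k)
    let ?b = "(z - cnj (lam (Suc k))) / (z - lam (Suc k))"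
    have b: "norm ?b \<ge> 1"
      by (rule factor_ge_1) (use Suc.prems False in \<open>auto simp: poles_Suc\<close>)
    have "norm (dress E lam (Suc k) z v) \<le> max 1 (norm ?b) * norm (dress E lam k z v)"
      unfolding dress_Suc
      by (rule darboux_norm_le) (use Suc.prems dvec_nz[of k] in \<open>auto simp: poles_Suc\<close>)
    also have "\<dots> = norm ?b * norm (dress E lam k z v)" using b by simp
    also have "\<dots> \<le> norm ?b * (norm (blaschke lam k z) * norm v)"
      using Suc by (intro mult_left_mono) (auto simp: poles_Suc)
    finally have "norm (dress E lam (Suc k) z v) \<le> norm (blaschke lam (Suc k) z) * norm v"
      unfolding blaschke_Suc norm_mult by (simp add: mult.assoc)
    moreover have "1 * 1 \<le> norm ?b * norm (blaschke lam k z)"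
      using Suc b by (intro mult_mono) (auto simp: poles_Suc)
    ultimately show ?case unfolding blaschke_Suc norm_mult by simp
  qed simp
  then show ?thesis by (simp add: max_def)
qed

lemma al_be_norm_le:
  assumes "z \<notin> poles N"
  shows "norm (al z) \<le> max 1 (norm (B z))" "norm (be z) \<le> max 1 (norm (B z))"
proof -
  have "norm (1 :: complex, 0 :: complex) = 1" by (simp add: norm_prod_def)
  then show "norm (al z) \<le> max 1 (norm (B z))" "norm (be z) \<le> max 1 (norm (B z))"
    using dress_norm_le[OF order_refl assms, of "(1, 0)"]
      norm_fst_le[of "al z" "be z"] norm_snd_le[of "be z" "al z"]
    by (auto simp: al_def be_def)
qed

end

section \<open>Limits under reflection and at infinity\<close>

lemma tendsto_star:
  assumes "(h \<longlongrightarrow> L) (at (cnj p))"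
  shows "(star h \<longlongrightarrow> cnj L) (at p)"
proof -
  have "filterlim cnj (at (cnj p)) (at p)"
    unfolding filterlim_at by (auto intro!: tendsto_intros simp: eventually_at_filter)
  from tendsto_cnj[OF filterlim_compose[OF assms this]] show ?thesis
    by (simp add: star_def[abs_def])
qed

lemma tendsto_star_infinity:
  assumes "(h \<longlongrightarrow> L) at_infinity"
  shows "(star h \<longlongrightarrow> cnj L) at_infinity"
proof -
  have "filterlim cnj at_infinity at_infinity"
    by (rule filterlim_norm_at_top_imp_at_infinity) (simp add: filterlim_at_infinity_conv_norm_at_top filterlim_norm_at_top)
  from tendsto_cnj[OF filterlim_compose[OF assms this]] show ?thesis
    by (simp add: star_def[abs_def])
qed

lemma eventually_notin_finite_at_infinity:
  fixes F :: "complex set"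
  assumes "finite F"
  shows "\<forall>\<^sub>F z in at_infinity. z \<notin> F"
proof -
  obtain b where "\<And>z. z \<in> F \<Longrightarrow> norm z \<le> b"
    using finite_imp_bounded[OF assms] by (auto simp: bounded_iff)
  then show ?thesis
    unfolding eventually_at_infinity by (intro exI[of _ "b + 1"]) force
qed

lemma eventually_nonzero_at_infinity: "\<forall>\<^sub>F z in at_infinity. z \<noteq> (0 :: complex)"
  using eventually_notin_finite_at_infinity[of "{0}"] by simp

lemma eventually_notin_finite_at:
  fixes F :: "complex set"
  assumes "finite F"
  shows "\<forall>\<^sub>F z in at p. z \<notin> F"
proof -
  have "\<forall>\<^sub>F z in at p. z \<in> - (F - {p}) - {p}"
  proof (rule eventually_at_in_open)
    show "open (- (F - {p}))" using assms by (intro open_Compl finite_imp_closed) simp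
  qed simp
  then show ?thesis by eventually_elim auto
qed

lemma tendsto_self_divide_diff: "((\<lambda>z. z / (z - l)) \<longlongrightarrow> 1) at_infinity" for l :: complex
proof (rule tendsto_at_infinity_inverse)
  have "((\<lambda>w. 1 / (1 - l * w)) \<longlongrightarrow> 1 / (1 - l * 0)) (at 0)"
    by (intro tendsto_intros) auto
  then have "((\<lambda>w. 1 / (1 - l * w)) \<longlongrightarrow> 1) (at 0)" by simp
  then show "((\<lambda>w. inverse w / (inverse w - l)) \<longlongrightarrow> 1) (at 0)"
    by (rule Lim_transform_eventually) (auto simp: eventually_at_filter field_simps)
qed

lemma tendsto_of_scaled:
  fixes h :: "complex \<Rightarrow> complex"
  assumes "((\<lambda>z. z * (h z - c)) \<longlongrightarrow> L) at_infinity"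
  shows "(h \<longlongrightarrow> c) at_infinity"
proof -
  have "((\<lambda>z. c + inverse z * (z * (h z - c))) \<longlongrightarrow> c + 0 * L) at_infinity"
    by (intro tendsto_intros assms tendsto_inverse_0)
  then have "((\<lambda>z. c + inverse z * (z * (h z - c))) \<longlongrightarrow> c) at_infinity" by simp
  then show ?thesis
  proof (rule Lim_transform_eventually)
    show "\<forall>\<^sub>F z in at_infinity. c + inverse z * (z * (h z - c)) = h z"
      using eventually_nonzero_at_infinity by eventually_elim (simp add: field_simps)
  qed
qed

lemma tendsto_mat:
  fixes F :: "'a \<Rightarrow> complex^'n^'m"
  assumes "\<And>i j. ((\<lambda>z. F z $ i $ j) \<longlongrightarrow> L $ i $ j) net"
  shows "(F \<longlongrightarrow> L) net"
  by (intro vec_tendstoI assms)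

lemma tendsto_mat_entry:
  fixes F :: "'a \<Rightarrow> complex^'n^'m"
  assumes "(F \<longlongrightarrow> L) net"
  shows "((\<lambda>z. F z $ i $ j) \<longlongrightarrow> L $ i $ j) net"
  by (intro tendsto_vec_nth assms)

lemma norm_mat_le_sum: "norm A \<le> (\<Sum>i\<in>UNIV. \<Sum>j\<in>UNIV. norm (A $ i $ j))"
  for A :: "complex^'n^'m"
proof -
  have "norm A \<le> (\<Sum>i\<in>UNIV. norm (A $ i))"
    unfolding norm_vec_def by (rule L2_set_le_sum) simp
  also have "\<dots> \<le> (\<Sum>i\<in>UNIV. \<Sum>j\<in>UNIV. norm (A $ i $ j))"
    by (rule sum_mono) (unfold norm_vec_def, rule L2_set_le_sum, simp)
  finally show ?thesis .
qed

lemma normalized_at_infinityI: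
  assumes "\<And>i j. \<exists>L. ((\<lambda>z. z * (M z $ i $ j - mat 1 $ i $ j)) \<longlongrightarrow> L) at_infinity"
  shows "normalized_at_infinity M"
proof -
  have e: "(\<lambda>z. norm (M z $ i $ j - mat 1 $ i $ j)) \<in> O[at_infinity](\<lambda>z. 1 / norm z)" for i j
  proof -
    obtain L where L: "((\<lambda>z. z * (M z $ i $ j - mat 1 $ i $ j)) \<longlongrightarrow> L) at_infinity"
      using assms by blast
    then have "\<forall>\<^sub>F z in at_infinity. norm (z * (M z $ i $ j - mat 1 $ i $ j)) < norm L + 1"
      by (intro order_tendstoD(2)[OF tendsto_norm]) auto
    then have "\<forall>\<^sub>F z in at_infinity. norm (norm (M z $ i $ j - mat 1 $ i $ j)) \<le> (norm L + 1) * norm (1 / norm z)"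
      using eventually_nonzero_at_infinity
      by eventually_elim (simp add: norm_mult pos_le_divide_eq mult.commute)
    then show ?thesis by (rule bigoI)
  qed
  have "(\<lambda>z. norm (M z - mat 1)) \<in> O[at_infinity](\<lambda>z. \<Sum>i\<in>UNIV. \<Sum>j\<in>UNIV. norm (M z $ i $ j - mat 1 $ i $ j))"
  proof (rule bigoI[where c = 1], intro always_eventually allI)
    fix z show "norm (norm (M z - mat 1)) \<le> 1 * norm (\<Sum>i\<in>UNIV. \<Sum>j\<in>UNIV. norm (M z $ i $ j - mat 1 $ i $ j))"
      using norm_mat_le_sum[of "M z - mat 1"] by simp
  qed
  also have "(\<lambda>z. \<Sum>i\<in>UNIV. \<Sum>j\<in>UNIV. norm (M z $ i $ j - mat 1 $ i $ j)) \<in> O[at_infinity](\<lambda>z. 1 / norm z)"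
    by (intro big_sum_in_bigo e)
  finally show ?thesis unfolding normalized_at_infinity_def .
qed

lemma normalized_at_infinity_entry:
  assumes "normalized_at_infinity M"
  shows "((\<lambda>z. M z $ i $ j) \<longlongrightarrow> mat 1 $ i $ j) at_infinity"
proof -
  have "((\<lambda>z::complex. 1 / norm z) \<longlongrightarrow> 0) at_infinity"
    using tendsto_norm_zero[OF tendsto_inverse_0[where 'a = complex]] by (simp add: inverse_eq_divide norm_divide)
  then have lim: "((\<lambda>z::complex. c * norm (1 / norm z)) \<longlongrightarrow> 0) at_infinity" for c
    using tendsto_mult_right_zero[of "\<lambda>z. 1 / norm z" at_infinity c] by simp
  obtain c where "\<forall>\<^sub>F z in at_infinity. norm (norm (M z - mat 1)) \<le> c * norm (1 / norm z)"
    using assms unfolding normalized_at_infinity_def by (elim landau_o.bigE)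
  from Lim_null_comparison[OF this lim] have "((\<lambda>z. norm (M z - mat 1)) \<longlongrightarrow> 0) at_infinity" .
  then have "(M \<longlongrightarrow> mat 1) at_infinity"
    by (simp add: LIM_zero_iff tendsto_norm_zero_iff)
  then show ?thesis by (rule tendsto_mat_entry)
qed

section \<open>Behaviour at infinity and uniqueness of the first row\<close>

context soliton
begin

definition coef :: "nat \<Rightarrow> complex \<times> complex \<Rightarrow> complex" where
  "coef j v = (lam (Suc j) - cnj (lam (Suc j))) * (wedge (dvec E lam j) v / of_real ((norm (dvec E lam j))\<^sup>2))"

text \<open>Each stage tends to \<open>v\<close> at infinity, so to order \<open>1/z\<close> every
  factor acts on \<open>v\<close> itself and the contributions add up.\<close>

lemma dress_asymp:
  "((\<lambda>z. z * (fst (dress E lam k z v) - fst v)) \<longlongrightarrow> (\<Sum>j<k. coef j v * fst (perp (dvec E lam j)))) at_infinity"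
  "((\<lambda>z. z * (snd (dress E lam k z v) - snd v)) \<longlongrightarrow> (\<Sum>j<k. coef j v * snd (perp (dvec E lam j)))) at_infinity"
proof (induction k)
  case (Suc k)
  define l w where "l = lam (Suc k)" and "w = dvec E lam k"
  define n where "n = complex_of_real ((norm w)\<^sup>2)"
  note t = tendsto_of_scaled[OF Suc(1)] tendsto_of_scaled[OF Suc(2)]
  have w: "((\<lambda>z. wedge w (dress E lam k z v)) \<longlongrightarrow> wedge w v) at_infinity"
    unfolding wedge_def by (intro tendsto_intros t)
  have h: "((\<lambda>z. (l - cnj l) * (z / (z - l)) * (wedge w (dress E lam k z v) * inverse n))
      \<longlongrightarrow> (l - cnj l) * 1 * (wedge w v * inverse n)) at_infinity"
    by (intro tendsto_intros w tendsto_self_divide_diff)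
  { case 1
    have "((\<lambda>z. z * (fst (dress E lam k z v) - fst v)
        + (l - cnj l) * (z / (z - l)) * (wedge w (dress E lam k z v) * inverse n) * fst (perp w))
      \<longlongrightarrow> (\<Sum>j<k. coef j v * fst (perp (dvec E lam j))) + (l - cnj l) * 1 * (wedge w v * inverse n) * fst (perp w)) at_infinity"
      by (intro tendsto_intros Suc h)
    then show ?case
      by (simp add: dress_Suc darboux_def l_def w_def n_def coef_def divide_inverse algebra_simps)
  next
    case 2
    have "((\<lambda>z. z * (snd (dress E lam k z v) - snd v)
        + (l - cnj l) * (z / (z - l)) * (wedge w (dress E lam k z v) * inverse n) * snd (perp w))
      \<longlongrightarrow> (\<Sum>j<k. coef j v * snd (perp (dvec E lam j))) + (l - cnj l) * 1 * (wedge w v * inverse n) * snd (perp w)) at_infinity"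
      by (intro tendsto_intros Suc h)
    then show ?case
      by (simp add: dress_Suc darboux_def l_def w_def n_def coef_def divide_inverse algebra_simps) }
qed auto

text \<open>The soliton amplitude is \<open>2\<close> times the modulus of this number. Its explicit
  form later yields the extremal bound, the scaling law and measurability in the data.\<close>

definition be_coef :: complex where
  "be_coef = (\<Sum>j<N. (lam (Suc j) - cnj (lam (Suc j))) *
     (- snd (dvec E lam j) * cnj (fst (dvec E lam j)) / of_real ((norm (dvec E lam j))\<^sup>2)))"

lemma be_asymp: "((\<lambda>z. z * be z) \<longlongrightarrow> be_coef) at_infinity"
proof -
  have "be_coef = (\<Sum>j<N. coef j (1, 0) * snd (perp (dvec E lam j)))"
    unfolding be_coef_def coef_def wedge_def perp_def by (simp add: mult.assoc)
  then show ?thesis using dress_asymp(2)[of N "(1, 0)"] by (simp add: be_def)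
qed

lemma al_asymp: "\<exists>L. ((\<lambda>z. z * (al z - 1)) \<longlongrightarrow> L) at_infinity"
  using dress_asymp(1)[of N "(1, 0)"] by (auto simp: al_def)

lemma al_lim: "(al \<longlongrightarrow> 1) at_infinity"
  using al_asymp tendsto_of_scaled by blast

lemma be_lim: "(be \<longlongrightarrow> 0) at_infinity"
  using be_asymp tendsto_of_scaled[of be 0] by simp

text \<open>Step \<open>j\<close> contributes \<open>2 Im(lam) * (a b / (a^2 + b^2))\<close> with
  \<open>a\<close>, \<open>b\<close> the moduli of the components of its vector, and
  \<open>2 a b\<close> is at most \<open>a^2 + b^2\<close>. Equality means \<open>a = b\<close>,
  which is what happens at the extremal point.\<close>

lemma norm_be_coef_le: "norm be_coef \<le> (\<Sum>j\<in>{1..N}. Im (lam j))"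
proof -
  have "norm be_coef \<le> (\<Sum>j<N. Im (lam (Suc j)))"
    unfolding be_coef_def
  proof (rule sum_norm_le)
    fix j assume j: "j \<in> {..<N}"
    define a b where "a = norm (fst (dvec E lam j))" and "b = norm (snd (dvec E lam j))"
    have nz: "a\<^sup>2 + b\<^sup>2 > 0"
      using dvec_nz[of j] j unfolding a_def b_def norm_sq_prod'[symmetric] by simp
    have "lam (Suc j) - cnj (lam (Suc j)) = of_real (2 * Im (lam (Suc j))) * \<i>"
      by (simp add: complex_eq_iff)
    then have "norm (lam (Suc j) - cnj (lam (Suc j))) = 2 * Im (lam (Suc j))"
      using Im_pos[of "Suc j"] j by (simp add: norm_mult)
    then have "norm ((lam (Suc j) - cnj (lam (Suc j))) *
       (- snd (dvec E lam j) * cnj (fst (dvec E lam j)) / of_real ((norm (dvec E lam j))\<^sup>2)))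
       = 2 * Im (lam (Suc j)) * (b * a / (a\<^sup>2 + b\<^sup>2))"
      unfolding norm_mult norm_divide norm_of_real norm_minus_cancel complex_mod_cnj norm_sq_prod' a_def b_def
      by simp
    also have "\<dots> \<le> 2 * Im (lam (Suc j)) * (1 / 2)"
    proof (rule mult_left_mono)
      have "2 * (b * a) \<le> a\<^sup>2 + b\<^sup>2" using sum_squares_bound[of a b] by (simp add: algebra_simps)
      with nz show "b * a / (a\<^sup>2 + b\<^sup>2) \<le> 1 / 2" by (simp add: field_simps)
    qed (use Im_pos[of "Suc j"] j in auto)
    finally show "norm ((lam (Suc j) - cnj (lam (Suc j))) *
       (- snd (dvec E lam j) * cnj (fst (dvec E lam j)) / of_real ((norm (dvec E lam j))\<^sup>2)))
       \<le> Im (lam (Suc j))" by simp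
  qed
  also have "\<dots> = (\<Sum>j\<in>{1..N}. Im (lam j))"
    by (simp add: sum.atLeast1_atMost_eq)
  finally show ?thesis .
qed

lemma star_B: "star B z = inverse (B z)"
  unfolding star_def blaschke_def cnj_prod prod_inversef[symmetric] by (rule prod.cong) auto

definition c :: "nat \<Rightarrow> complex" where "c n = coeff_III N lam n"

lemma c_nz: "n \<in> {1..N} \<Longrightarrow> c n \<noteq> 0"
proof -
  assume n: "n \<in> {1..N}"
  have "lam n \<noteq> cnj (lam l)" if "l \<in> {1..N}" for l
    using lam_notin_cnj[OF n order_refl] that by (auto simp: poles_def)
  moreover have "lam n \<noteq> lam l" if "l \<in> {1..N} - {n}" for l
    using inj_onD[OF inj, of n l] n that by auto
  ultimately show ?thesis unfolding c_def coeff_III_def mult_eq_0_iff by (subst (1 2) prod_zero_iff) auto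
qed

lemma B_residue:
  assumes n: "n \<in> {1..N}"
  shows "((\<lambda>z. (z - lam n) * B z) \<longlongrightarrow> c n) (at (lam n))"
proof -
  have ne: "lam n \<noteq> lam l" if "l \<in> {1..N} - {n}" for l
    using inj_onD[OF inj, of n l] n that by auto
  have "((\<lambda>z. (\<Prod>l\<in>{1..N}. z - cnj (lam l)) * (\<Prod>l\<in>{1..N} - {n}. 1 / (z - lam l))) \<longlongrightarrow> c n) (at (lam n))"
    unfolding c_def coeff_III_def by (intro tendsto_intros) (use ne in auto)
  then show ?thesis
  proof (rule Lim_transform_eventually)
    have "(\<Prod>l\<in>{1..N}. z - cnj (lam l)) * (\<Prod>l\<in>{1..N} - {n}. 1 / (z - lam l)) = (z - lam n) * B z"
      if "z \<noteq> lam n" for z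
    proof -
      have "(\<Prod>l\<in>{1..N}. 1 / (z - lam l)) = 1 / (z - lam n) * (\<Prod>l\<in>{1..N} - {n}. 1 / (z - lam l))"
        using n by (subst prod.remove[of _ n]) auto
      moreover have "B z = (\<Prod>l\<in>{1..N}. z - cnj (lam l)) * (\<Prod>l\<in>{1..N}. 1 / (z - lam l))"
        unfolding blaschke_def by (simp add: prod.distrib[symmetric])
      ultimately show ?thesis using that by simp
    qed
    then show "\<forall>\<^sub>F z in at (lam n). (\<Prod>l\<in>{1..N}. z - cnj (lam l)) * (\<Prod>l\<in>{1..N} - {n}. 1 / (z - lam l)) = (z - lam n) * B z"
      by (auto simp: eventually_at_filter)
  qed
qed

lemma star_residue:
  assumes "((\<lambda>z. (z - p) * h z) \<longlongrightarrow> L) (at p)"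
  shows "((\<lambda>z. (z - cnj p) * star h z) \<longlongrightarrow> cnj L) (at (cnj p))"
  using tendsto_star[of "\<lambda>z. (z - p) * h z" L "cnj p"] assms by (simp add: star_def[abs_def])

lemma B_residue_cnj:
  "n \<in> {1..N} \<Longrightarrow> ((\<lambda>z. (z - cnj (lam n)) * inverse (B z)) \<longlongrightarrow> cnj (c n)) (at (cnj (lam n)))"
  using star_residue[OF B_residue] by (simp add: star_B)

lemma B_lim_0:
  assumes "n \<in> {1..N}"
  shows "((\<lambda>z. inverse (B z)) \<longlongrightarrow> 0) (at (lam n))" "(B \<longlongrightarrow> 0) (at (cnj (lam n)))"
proof -
  have *: "((\<lambda>z. inverse (B z)) \<longlongrightarrow> 0) (at (lam n))"
  proof (rule Lim_transform_eventually)
    have "((\<lambda>z. (z - lam n) * inverse ((z - lam n) * B z)) \<longlongrightarrow> (lam n - lam n) * inverse (c n)) (at (lam n))"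
      by (intro tendsto_intros B_residue c_nz assms)
    then show "((\<lambda>z. (z - lam n) * inverse ((z - lam n) * B z)) \<longlongrightarrow> 0) (at (lam n))" by simp
    show "\<forall>\<^sub>F z in at (lam n). (z - lam n) * inverse ((z - lam n) * B z) = inverse (B z)"
      by (auto simp: eventually_at_filter)
  qed
  then show "((\<lambda>z. inverse (B z)) \<longlongrightarrow> 0) (at (lam n))" .
  have "star (\<lambda>z. inverse (B z)) = B"
  proof
    fix z have "star (\<lambda>z. inverse (B z)) z = inverse (star B z)" by (simp add: star_def)
    then show "star (\<lambda>z. inverse (B z)) z = B z" by (simp add: star_B)
  qed
  then show "(B \<longlongrightarrow> 0) (at (cnj (lam n)))"
    using tendsto_star[of "\<lambda>z. inverse (B z)" 0 "cnj (lam n)"] * by simp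
qed

lemma isCont_E: "isCont E z"
  using holomorphic_on_imp_continuous_on[OF E_hol] by (simp add: continuous_on_eq_continuous_at)

lemma E_lim: "(E \<longlongrightarrow> E p) (at p)"
  using isCont_E by (simp add: isCont_def)

text \<open>The residue conditions are exactly what makes \<open>u1\<close> and \<open>u2\<close> below extend to entire functions.\<close>

lemma row_unique:
  assumes hol: "r1 holomorphic_on - P" "r2 holomorphic_on - P"
    and inf: "(r1 \<longlongrightarrow> 1) at_infinity" "((\<lambda>z. z * r2 z) \<longlongrightarrow> b) at_infinity"
    and up: "\<And>n. n \<in> {1..N} \<Longrightarrow> \<exists>A. ((\<lambda>z. (z - lam n) * r1 z) \<longlongrightarrow> A) (at (lam n)) \<and>
       ((\<lambda>z. r2 z * (c n * (E (lam n))\<^sup>2)) \<longlongrightarrow> A) (at (lam n))"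
    and lo: "\<And>n. n \<in> {1..N} \<Longrightarrow> \<exists>A. ((\<lambda>z. (z - cnj (lam n)) * r2 z) \<longlongrightarrow> A) (at (cnj (lam n))) \<and>
       ((\<lambda>z. r1 z * (- cnj (c n) * inverse ((E (cnj (lam n)))\<^sup>2))) \<longlongrightarrow> A) (at (cnj (lam n)))"
  shows "b = - cnj be_coef"
proof -
  obtain f g where fg: "f holomorphic_on UNIV" "g holomorphic_on UNIV"
    "\<And>z. f z * star f z + g z * star g z = 2"
    "\<And>z. z \<notin> P \<Longrightarrow> f z = al z / E z + B z * E z * star be z"
    "\<And>z. z \<notin> P \<Longrightarrow> g z = be z / E z - B z * E z * star al z"
    using entire_pair by blast
  define u1 u2 where "u1 z = r1 z * inverse (E z) - B z * E z * r2 z"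
    and "u2 z = E z * r2 z + inverse (B z) * inverse (E z) * r1 z" for z
  have EP: "E holomorphic_on - P" using E_hol by (rule holomorphic_on_subset) simp
  have BP: "B holomorphic_on - P" unfolding blaschke_def[abs_def]
    by (intro holomorphic_intros) (auto simp: P_def poles_def)
  have u_hol: "u1 holomorphic_on - P" "u2 holomorphic_on - P"
    unfolding u1_def u2_def by (auto intro!: holomorphic_intros hol EP BP simp: blaschke_nz)
  have res_up: "((\<lambda>z. (z - lam n) * u1 z) \<longlongrightarrow> 0) (at (lam n)) \<and> ((\<lambda>z. (z - lam n) * u2 z) \<longlongrightarrow> 0) (at (lam n))"
    if n: "n \<in> {1..N}" for n
  proof -
    obtain A where A: "((\<lambda>z. (z - lam n) * r1 z) \<longlongrightarrow> A) (at (lam n))"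
       "((\<lambda>z. r2 z * (c n * (E (lam n))\<^sup>2)) \<longlongrightarrow> A) (at (lam n))" using up[OF n] by blast
    define q where "q = c n * (E (lam n))\<^sup>2"
    have q: "q \<noteq> 0" using c_nz[OF n] by (simp add: q_def)
    have r2: "(r2 \<longlongrightarrow> A / q) (at (lam n))"
      using tendsto_divide[OF A(2) tendsto_const[of q]] q by (simp add: q_def)
    have "((\<lambda>z. (z - lam n) * r1 z * inverse (E z) - (z - lam n) * B z * (E z * r2 z))
       \<longlongrightarrow> A * inverse (E (lam n)) - c n * (E (lam n) * (A / q))) (at (lam n))"
      by (intro tendsto_intros A r2 E_lim B_residue n E_nz)
    also have "A * inverse (E (lam n)) - c n * (E (lam n) * (A / q)) = 0"
      using c_nz[OF n] by (simp add: q_def field_simps power2_eq_square)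
    finally have 1: "((\<lambda>z. (z - lam n) * u1 z) \<longlongrightarrow> 0) (at (lam n))"
      by (simp add: u1_def algebra_simps)
    have "((\<lambda>z. (z - lam n) * (E z * r2 z) + inverse (B z) * inverse (E z) * ((z - lam n) * r1 z))
       \<longlongrightarrow> (lam n - lam n) * (E (lam n) * (A / q)) + 0 * inverse (E (lam n)) * A) (at (lam n))"
      by (intro tendsto_intros A r2 E_lim B_lim_0 n E_nz)
    with 1 show ?thesis by (simp add: u2_def algebra_simps)
  qed
  have res_lo: "((\<lambda>z. (z - cnj (lam n)) * u1 z) \<longlongrightarrow> 0) (at (cnj (lam n))) \<and> ((\<lambda>z. (z - cnj (lam n)) * u2 z) \<longlongrightarrow> 0) (at (cnj (lam n)))"
    if n: "n \<in> {1..N}" for n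
  proof -
    let ?l = "cnj (lam n)"
    obtain A where A: "((\<lambda>z. (z - ?l) * r2 z) \<longlongrightarrow> A) (at ?l)"
       "((\<lambda>z. r1 z * (- cnj (c n) * inverse ((E ?l)\<^sup>2))) \<longlongrightarrow> A) (at ?l)" using lo[OF n] by blast
    define q where "q = - cnj (c n) * inverse ((E ?l)\<^sup>2)"
    have q: "q \<noteq> 0" using c_nz[OF n] by (simp add: q_def)
    have r1: "(r1 \<longlongrightarrow> A / q) (at ?l)"
      using tendsto_divide[OF A(2) tendsto_const[of q]] q by (simp add: q_def)
    have "((\<lambda>z. E z * ((z - ?l) * r2 z) + (z - ?l) * inverse (B z) * (inverse (E z) * r1 z))
       \<longlongrightarrow> E ?l * A + cnj (c n) * (inverse (E ?l) * (A / q))) (at ?l)"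
      by (intro tendsto_intros A r1 E_lim B_residue_cnj n E_nz)
    also have "E ?l * A + cnj (c n) * (inverse (E ?l) * (A / q)) = 0"
      using c_nz[OF n] by (simp add: q_def field_simps power2_eq_square)
    finally have 1: "((\<lambda>z. (z - ?l) * u2 z) \<longlongrightarrow> 0) (at ?l)"
      by (simp add: u2_def algebra_simps)
    have "((\<lambda>z. (z - ?l) * (r1 z * inverse (E z)) - B z * E z * ((z - ?l) * r2 z))
       \<longlongrightarrow> (?l - ?l) * (A / q * inverse (E ?l)) - 0 * E ?l * A) (at ?l)"
      by (intro tendsto_intros A r1 E_lim B_lim_0 n E_nz)
    with 1 show ?thesis by (simp add: u1_def algebra_simps)
  qed
  have res: "((\<lambda>z. (z - p) * u1 z) \<longlongrightarrow> 0) (at p)" "((\<lambda>z. (z - p) * u2 z) \<longlongrightarrow> 0) (at p)" if "p \<in> P" for p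
    using that res_up res_lo by (auto simp: P_def poles_def)
  obtain k1 where k1: "k1 holomorphic_on UNIV" "\<And>z. z \<notin> P \<Longrightarrow> k1 z = u1 z"
    using entire_extension[OF finite_P u_hol(1) res(1)] by blast
  obtain k2 where k2: "k2 holomorphic_on UNIV" "\<And>z. z \<notin> P \<Longrightarrow> k2 z = u2 z"
    using entire_extension[OF finite_P u_hol(2) res(2)] by blast
  \<comment> \<open>Off the poles this is the \<open>(1,2)\<close> entry of the given row times the
    inverse of the soliton matrix, whose determinant is 1. Multiplying out gives the entry twice
    while all terms with \<open>B\<close> or its inverse cancel; hence the division by 2. In the
    form chosen here it is visibly entire.\<close>
  define H where "H z = (k1 z * star g z + k2 z * f z) / 2" for z
  have H: "H holomorphic_on UNIV"
    unfolding H_def by (intro holomorphic_intros k1 k2 fg holomorphic_on_star_UNIV) auto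
  have sg: "star g z = star be z * E z - inverse (B z) * inverse (E z) * al z" if "z \<notin> P" for z
  proof -
    have "star g z = cnj (be (cnj z) / E (cnj z) - B (cnj z) * E (cnj z) * star al (cnj z))"
      using fg(5)[of "cnj z"] that cnj_P[of z] by (simp add: star_def)
    also have "\<dots> = star be z / star E z - star B z * star E z * al z" by (simp add: star_def)
    finally show ?thesis by (simp add: star_E star_B divide_inverse)
  qed
  have Heq: "H z = r1 z * star be z + r2 z * al z" if "z \<notin> P" for z
    unfolding H_def k1(2)[OF that] k2(2)[OF that] sg[OF that] fg(4)[OF that] u1_def u2_def
    using blaschke_nz[OF that] by (simp add: field_simps)
  have r2: "(r2 \<longlongrightarrow> 0) at_infinity" using inf(2) tendsto_of_scaled[of r2 0] by simp
  have ev: "\<forall>\<^sub>F z in at_infinity. r1 z * star be z + r2 z * al z = H z"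
    using eventually_notin_finite_at_infinity[OF finite_P] by eventually_elim (simp add: Heq)
  have "((\<lambda>z. r1 z * star be z + r2 z * al z) \<longlongrightarrow> 1 * cnj 0 + 0 * 1) at_infinity"
    by (intro tendsto_intros inf r2 al_lim tendsto_star_infinity be_lim)
  with ev have "(H \<longlongrightarrow> 0) at_infinity" using Lim_transform_eventually by fastforce
  \<comment> \<open>Once \<open>H\<close> is known to vanish, the vanishing of its
    \<open>1/z\<close> coefficient is the claim.\<close>
  then have H0: "H z = 0" for z using Liouville_weak[OF H] by blast
  have bz: "((\<lambda>z. z * star be z) \<longlongrightarrow> cnj be_coef) at_infinity"
    using tendsto_star_infinity[OF be_asymp] by (simp add: star_def[abs_def])
  have "((\<lambda>z. r1 z * (z * star be z) + z * r2 z * al z) \<longlongrightarrow> 1 * cnj be_coef + b * 1) at_infinity"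
    by (intro tendsto_intros inf bz al_lim)
  moreover have "\<forall>\<^sub>F z in at_infinity. r1 z * (z * star be z) + z * r2 z * al z = 0"
    using ev
  proof eventually_elim
    case (elim z)
    have "r1 z * (z * star be z) + z * r2 z * al z = z * (r1 z * star be z + r2 z * al z)"
      by (simp add: algebra_simps)
    then show ?case by (simp add: elim H0)
  qed
  ultimately have "((\<lambda>z::complex. 0) \<longlongrightarrow> cnj be_coef + b) at_infinity"
    using Lim_transform_eventually by fastforce
  then have "cnj be_coef + b = 0"
    using tendsto_unique[OF trivial_limit_at_infinity _ tendsto_const] by blast
  then show ?thesis by (rule minus_unique[symmetric])
qed

end

section \<open>The soliton Riemann-Hilbert problem\<close>

lemma mat2_nth [simp]:
  "mat2 p q r s $ 1 $ 1 = p" "mat2 p q r s $ 1 $ 2 = q"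
  "mat2 p q r s $ 2 $ 1 = r" "mat2 p q r s $ 2 $ 2 = s"
  by (simp_all add: mat2_def)

lemma mat_1_nth [simp]:
  "(mat c :: complex^2^2) $ 1 $ 1 = c" "(mat c :: complex^2^2) $ 1 $ 2 = 0"
  "(mat c :: complex^2^2) $ 2 $ 1 = 0" "(mat c :: complex^2^2) $ 2 $ 2 = c"
  by (simp_all add: mat_def)

lemma matmul2_nth:
  fixes A A' :: "complex^2^2"
  shows "(A ** A') $ i $ j = A $ i $ 1 * A' $ 1 $ j + A $ i $ 2 * A' $ 2 $ j"
  by (simp add: matrix_matrix_mult_def sum_2)


lemma tendsto_mat2:
  fixes F :: "'a \<Rightarrow> complex^2^2" and L :: "complex^2^2"
  assumes "((\<lambda>z. F z $ 1 $ 1) \<longlongrightarrow> L $ 1 $ 1) net" "((\<lambda>z. F z $ 1 $ 2) \<longlongrightarrow> L $ 1 $ 2) net"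
    "((\<lambda>z. F z $ 2 $ 1) \<longlongrightarrow> L $ 2 $ 1) net" "((\<lambda>z. F z $ 2 $ 2) \<longlongrightarrow> L $ 2 $ 2) net"
  shows "(F \<longlongrightarrow> L) net"
proof (rule tendsto_mat)
  fix i j :: 2
  show "((\<lambda>z. F z $ i $ j) \<longlongrightarrow> L $ i $ j) net"
    using exhaust_2[of i] exhaust_2[of j] assms by auto
qed

lemma mat2_eqI:
  fixes A A' :: "complex^2^2"
  assumes "A $ 1 $ 1 = A' $ 1 $ 1" "A $ 1 $ 2 = A' $ 1 $ 2" "A $ 2 $ 1 = A' $ 2 $ 1" "A $ 2 $ 2 = A' $ 2 $ 2"
  shows "A = A'"
  using assms by (simp add: vec_eq_iff forall_2)

context soliton
begin

text \<open>The second column is \<open>perp\<close> of the first column at the conjugate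
  point.\<close>

definition sol :: "complex \<Rightarrow> complex^2^2" where
  "sol z = mat2 (al z) (- star be z) (be z) (star al z)"

lemma isCont_open:
  assumes "h holomorphic_on S" "open S" "p \<in> S"
  shows "(h \<longlongrightarrow> h p) (at p)"
  using holomorphic_on_imp_continuous_on[OF assms(1)] assms(2,3)
  by (simp add: continuous_on_eq_continuous_at isCont_def)

lemma entire_lim: "h holomorphic_on UNIV \<Longrightarrow> (h \<longlongrightarrow> h p) (at p)"
  using isCont_open[of h UNIV p] by simp

text \<open>At \<open>lam n\<close> the second column of \<open>sol\<close> is analytic, and the first one is
  \<open>E\<close> times an entire vector plus \<open>B E\<^sup>2\<close> times the second.\<close>

lemma sol_upper:
  assumes n: "n \<in> {1..N}"
  defines "p \<equiv> lam n"
  shows "(star be \<longlongrightarrow> star be p) (at p)" "(star al \<longlongrightarrow> star al p) (at p)"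
    "((\<lambda>z. (z - p) * al z) \<longlongrightarrow> - (c n * (E p)\<^sup>2 * star be p)) (at p)"
    "((\<lambda>z. (z - p) * be z) \<longlongrightarrow> c n * (E p)\<^sup>2 * star al p) (at p)"
    "star al p \<noteq> 0 \<or> star be p \<noteq> 0"
proof -
  obtain f g where fg: "f holomorphic_on UNIV" "g holomorphic_on UNIV"
    "\<And>z. f z * star f z + g z * star g z = 2"
    "\<And>z. z \<notin> P \<Longrightarrow> f z = al z / E z + B z * E z * star be z"
    "\<And>z. z \<notin> P \<Longrightarrow> g z = be z / E z - B z * E z * star al z"
    using entire_pair by blast
  have p: "p \<in> - cnj ` poles N" using lam_notin_cnj[OF n] by (simp add: p_def)
  note s = star_holomorphic[OF al_be_holomorphic(1)] star_holomorphic[OF al_be_holomorphic(2)]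
  show lim: "(star be \<longlongrightarrow> star be p) (at p)" "(star al \<longlongrightarrow> star al p) (at p)"
    using isCont_open[OF s(1) _ p] isCont_open[OF s(2) _ p] by simp_all
  have ev: "\<forall>\<^sub>F z in at p. z \<notin> P" by (rule eventually_notin_finite_at) simp
  have al: "al z = E z * f z - B z * (E z)\<^sup>2 * star be z"
    and be: "be z = E z * g z + B z * (E z)\<^sup>2 * star al z" if "z \<notin> P" for z
    unfolding fg(4,5)[OF that] by (simp_all add: field_simps power2_eq_square)
  note Bres = B_residue[OF n, folded p_def]
  have "((\<lambda>z. (z - p) * (E z * f z) - (z - p) * B z * ((E z)\<^sup>2 * star be z)) \<longlongrightarrow>
     (p - p) * (E p * f p) - c n * ((E p)\<^sup>2 * star be p)) (at p)"
    by (intro tendsto_intros lim Bres E_lim entire_lim fg)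
  then have "((\<lambda>z. (z - p) * (E z * f z) - (z - p) * B z * ((E z)\<^sup>2 * star be z)) \<longlongrightarrow>
     - (c n * (E p)\<^sup>2 * star be p)) (at p)" by (simp add: mult.assoc)
  then show "((\<lambda>z. (z - p) * al z) \<longlongrightarrow> - (c n * (E p)\<^sup>2 * star be p)) (at p)"
    by (rule Lim_transform_eventually) (use ev in \<open>eventually_elim, simp add: al algebra_simps\<close>)
  have "((\<lambda>z. (z - p) * (E z * g z) + (z - p) * B z * ((E z)\<^sup>2 * star al z)) \<longlongrightarrow>
     (p - p) * (E p * g p) + c n * ((E p)\<^sup>2 * star al p)) (at p)"
    by (intro tendsto_intros lim Bres E_lim entire_lim fg)
  then have "((\<lambda>z. (z - p) * (E z * g z) + (z - p) * B z * ((E z)\<^sup>2 * star al z)) \<longlongrightarrow>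
     c n * (E p)\<^sup>2 * star al p) (at p)" by (simp add: mult.assoc)
  then show "((\<lambda>z. (z - p) * be z) \<longlongrightarrow> c n * (E p)\<^sup>2 * star al p) (at p)"
    by (rule Lim_transform_eventually) (use ev in \<open>eventually_elim, simp add: be algebra_simps\<close>)
  \<comment> \<open>The determinant rewritten with the entire pair: the terms with \<open>B\<close>
    cancel, so the identity can be evaluated at the pole. It shows that the second column is nonzero
    there, hence that the pole of the first one is genuine.\<close>
  have "((\<lambda>z. E z * (f z * star al z + g z * star be z)) \<longlongrightarrow> E p * (f p * star al p + g p * star be p)) (at p)"
    by (intro tendsto_intros lim E_lim entire_lim fg)
  moreover have "\<forall>\<^sub>F z in at p. E z * (f z * star al z + g z * star be z) = 1"
    using ev
  proof eventually_elim
    case (elim z)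
    have "E z * (f z * star al z + g z * star be z) = al z * star al z + be z * star be z"
      unfolding fg(4,5)[OF elim] by (simp add: field_simps)
    then show ?case using al_be_unit[OF elim] by simp
  qed
  ultimately have "((\<lambda>z::complex. 1) \<longlongrightarrow> E p * (f p * star al p + g p * star be p)) (at p)"
    by (rule Lim_transform_eventually)
  then have "E p * (f p * star al p + g p * star be p) = 1"
    using tendsto_unique[OF trivial_limit_at _ tendsto_const] by blast
  then show "star al p \<noteq> 0 \<or> star be p \<noteq> 0" by auto
qed

lemma holomorphic_P: "al holomorphic_on - P" "be holomorphic_on - P"
  "star al holomorphic_on - P" "star be holomorphic_on - P"
  using al_be_holomorphic star_holomorphic[OF al_be_holomorphic(1)] star_holomorphic[OF al_be_holomorphic(2)]
  by (auto elim!: holomorphic_on_subset simp: P_def)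

lemma residue_of_lim:
  assumes "h holomorphic_on - P" "p \<in> P" "((\<lambda>z. (z - p) * h z) \<longlongrightarrow> L) (at p)"
  shows "residue h p = L"
proof (rule residue_simple')
  show "open (- (P - {p}))" by (intro open_Compl finite_imp_closed) simp
  show "h holomorphic_on - (P - {p}) - {p}"
    by (rule holomorphic_on_subset[OF assms(1)]) auto
qed (use assms in \<open>auto simp: mult.commute\<close>)

lemma residue_of_cont:
  assumes "h holomorphic_on - P" "p \<in> P" "(h \<longlongrightarrow> L) (at p)"
  shows "residue h p = 0"
proof (rule residue_of_lim[OF assms(1,2)])
  have "((\<lambda>z. (z - p) * h z) \<longlongrightarrow> (p - p) * L) (at p)" by (intro tendsto_intros assms)
  then show "((\<lambda>z. (z - p) * h z) \<longlongrightarrow> 0) (at p)" by simp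
qed

lemma lim_times_zero:
  fixes h :: "complex \<Rightarrow> complex"
  assumes "(h \<longlongrightarrow> L) (at p)"
  shows "((\<lambda>z. (z - p) * h z) \<longlongrightarrow> 0) (at p)"
proof -
  have "((\<lambda>z. (z - p) * h z) \<longlongrightarrow> (p - p) * L) (at p)" by (intro tendsto_intros assms)
  then show ?thesis by simp
qed

lemma sol_normalized: "normalized_at_infinity sol"
proof (rule normalized_at_infinityI)
  fix i j :: 2
  obtain L where L: "((\<lambda>z. z * (al z - 1)) \<longlongrightarrow> L) at_infinity" using al_asymp by blast
  have "((\<lambda>z. z * (star al z - 1)) \<longlongrightarrow> cnj L) at_infinity"
    using tendsto_star_infinity[OF L] by (simp add: star_def[abs_def])
  moreover have "((\<lambda>z. z * star be z) \<longlongrightarrow> cnj be_coef) at_infinity"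
    using tendsto_star_infinity[OF be_asymp] by (simp add: star_def[abs_def])
  from tendsto_minus[OF this] have "((\<lambda>z. z * (- star be z)) \<longlongrightarrow> - cnj be_coef) at_infinity" by simp
  ultimately show "\<exists>L. ((\<lambda>z. z * (sol z $ i $ j - mat 1 $ i $ j)) \<longlongrightarrow> L) at_infinity"
    using exhaust_2[of i] exhaust_2[of j] L be_asymp by (auto simp: sol_def)
qed

lemma sol_12_lim: "((\<lambda>z. z * sol z $ 1 $ 2) \<longlongrightarrow> - cnj be_coef) at_infinity"
  using tendsto_minus[OF tendsto_star_infinity[OF be_asymp]]
  by (simp add: star_def[abs_def] sol_def)

end

section \<open>The NLS phase and the explicit soliton amplitude\<close>

locale nls_soliton =
  fixes x t :: real and lam :: "nat \<Rightarrow> complex" and N :: nat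
  assumes inj': "inj_on lam {1..N}"
    and Im_pos': "\<And>n. n \<in> {1..N} \<Longrightarrow> Im (lam n) > 0"

definition phase_exp :: "real \<Rightarrow> real \<Rightarrow> complex \<Rightarrow> complex" where
  "phase_exp x t z = exp (\<i> * theta z x t)"

lemma star_phase_exp: "star (phase_exp x t) z * phase_exp x t z = 1"
  by (simp add: star_def phase_exp_def theta_def exp_cnj flip: exp_add)

sublocale nls_soliton \<subseteq> soliton "phase_exp x t" lam N
proof
  show "phase_exp x t holomorphic_on UNIV"
    unfolding phase_exp_def theta_def by (intro holomorphic_intros)
qed (use star_phase_exp inj' Im_pos' in auto)

context nls_soliton
begin

lemma phase_sq: "(phase_exp x t z)\<^sup>2 = exp (2 * \<i> * theta z x t)"
  "inverse ((phase_exp x t z)\<^sup>2) = exp (- 2 * \<i> * theta z x t)"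
  by (simp_all add: phase_exp_def exp_minus exp_double[symmetric] mult.assoc)

lemma scattering: "scattering_data N lam (coeff_III N lam)"
  using inj Im_pos c_nz by (simp add: scattering_data_def c_def)

lemma sol_rhp: "soliton_rhp N lam (coeff_III N lam) x t sol"
  unfolding soliton_rhp_def
proof (intro conjI ballI)
  have P: "lam ` {1..N} \<union> (\<lambda>n. cnj (lam n)) ` {1..N} = P"
    by (auto simp: P_def poles_def image_iff)
  show "mat_holomorphic_on sol (- (lam ` {1..N} \<union> (\<lambda>n. cnj (lam n)) ` {1..N}))"
    unfolding P mat_holomorphic_on_def forall_2 sol_def
    using holomorphic_P by (auto intro!: holomorphic_intros)
  show "normalized_at_infinity sol" by (rule sol_normalized)
  fix n assume n: "n \<in> {1..N}"
  define p where "p = lam n"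
  define C where "C = c n * (phase_exp x t p)\<^sup>2"
  have C: "C \<noteq> 0" using c_nz[OF n] by (simp add: C_def)
  have pP: "p \<in> P" "cnj p \<in> P" using n by (auto simp: P_def p_def poles_def)
  note u = sol_upper[OF n, folded p_def, folded C_def]
  have res: "mat_residue sol p = mat2 (- (C * star be p)) 0 (C * star al p) 0"
    unfolding mat_residue_def
    by (rule mat2_eqI; simp add: sol_def)
      (intro residue_of_lim residue_of_cont[where L = "- star be p"] residue_of_cont[where L = "star al p"]
        holomorphic_P pP u tendsto_minus holomorphic_on_minus)+
  show "mat_simple_pole sol (lam n)"
    unfolding mat_simple_pole_def p_def[symmetric]
  proof (intro exI conjI)
    show "((\<lambda>z. mat (z - p) ** sol z) \<longlongrightarrow> mat2 (- (C * star be p)) 0 (C * star al p) 0) (at p)"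
      by (rule tendsto_mat2; simp add: matmul2_nth sol_def)
        (use u lim_times_zero[OF u(1)] lim_times_zero[OF u(2)] in \<open>auto simp: tendsto_minus_cancel_left[symmetric]\<close>)
    show "mat2 (- (C * star be p)) 0 (C * star al p) 0 \<noteq> 0"
    proof
      assume "mat2 (- (C * star be p)) 0 (C * star al p) 0 = 0"
      then have "mat2 (- (C * star be p)) 0 (C * star al p) 0 $ i $ 1 = 0" for i by simp
      from this[of 1] this[of 2] show False using C u(5) by simp
    qed
  qed
  show "((\<lambda>z. sol z ** mat2 0 0 (coeff_III N lam n * exp (2 * \<i> * theta (lam n) x t)) 0) \<longlongrightarrow> mat_residue sol (lam n)) (at (lam n))"
    unfolding p_def[symmetric] res phase_sq[symmetric] c_def[symmetric] C_def[symmetric]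
    by (rule tendsto_mat2; simp add: matmul2_nth sol_def mult.commute[of _ C])
      (intro tendsto_intros u)+
  have star_at: "star be (cnj p) = cnj (be p)" for p by (simp add: star_def)
  \<comment> \<open>Everything at \<open>cnj p\<close> is the reflection of a limit already known at
    \<open>p\<close>.\<close>
  have l: "(be \<longlongrightarrow> cnj (star be p)) (at (cnj p))" "(al \<longlongrightarrow> cnj (star al p)) (at (cnj p))"
    using tendsto_star[of "star be" _ "cnj p"] tendsto_star[of "star al" _ "cnj p"] u(1,2) by simp_all
  have r: "((\<lambda>z. (z - cnj p) * star al z) \<longlongrightarrow> - (cnj C * cnj (star be p))) (at (cnj p))"
     "((\<lambda>z. (z - cnj p) * star be z) \<longlongrightarrow> cnj C * cnj (star al p)) (at (cnj p))"
    using star_residue[OF u(3)] star_residue[OF u(4)] by simp_all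
  have r': "((\<lambda>z. (z - cnj p) * (- star be z)) \<longlongrightarrow> - (cnj C * cnj (star al p))) (at (cnj p))"
    using tendsto_minus[OF r(2)] by simp
  let ?A = "mat2 0 (- (cnj C * cnj (star al p))) 0 (- (cnj C * cnj (star be p)))"
  have res': "mat_residue sol (cnj p) = ?A"
    unfolding mat_residue_def
    by (rule mat2_eqI; simp add: sol_def)
      (intro residue_of_lim residue_of_cont[OF _ _ l(1)] residue_of_cont[OF _ _ l(2)]
        holomorphic_P pP r r' holomorphic_on_minus)+
  show "mat_simple_pole sol (cnj (lam n))"
    unfolding mat_simple_pole_def p_def[symmetric]
  proof (intro exI conjI)
    show "((\<lambda>z. mat (z - cnj p) ** sol z) \<longlongrightarrow> ?A) (at (cnj p))"
      by (rule tendsto_mat2; simp only: matmul2_nth sol_def mat2_nth mat_1_nth mult_zero_left add_0_left add_0_right)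
        (use r r' lim_times_zero[OF l(1)] lim_times_zero[OF l(2)] in auto)
    show "?A \<noteq> 0"
    proof
      assume "?A = 0"
      then have "?A $ i $ 2 = 0" for i by simp
      from this[of 1] this[of 2] show False using C u(5) by simp
    qed
  qed
  have "- cnj (c n) * exp (- 2 * \<i> * theta (cnj p) x t) = - cnj C"
    using star_E[of "cnj p"] unfolding phase_sq(2)[symmetric] C_def by (simp add: star_def power_inverse)
  then show "((\<lambda>z. sol z ** mat2 0 (- cnj (coeff_III N lam n) * exp (- 2 * \<i> * theta (cnj (lam n)) x t)) 0 0)
            \<longlongrightarrow> mat_residue sol (cnj (lam n))) (at (cnj (lam n)))"
    unfolding p_def[symmetric] res' c_def[symmetric]
    by (simp only:) (rule tendsto_mat2; simp add: matmul2_nth sol_def mult.commute[of _ "cnj C"];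
      intro tendsto_intros l)
qed

lemma rhp_unique:
  fixes M :: "complex \<Rightarrow> complex^2^2"
  assumes M: "soliton_rhp N lam (coeff_III N lam) x t M"
    and b: "((\<lambda>z. z * M z $ 1 $ 2) \<longlongrightarrow> b) at_infinity"
  shows "b = - cnj be_coef"
proof (rule row_unique[of "\<lambda>z. M z $ 1 $ 1" "\<lambda>z. M z $ 1 $ 2"])
  have P: "lam ` {1..N} \<union> (\<lambda>n. cnj (lam n)) ` {1..N} = P"
    by (auto simp: P_def poles_def image_iff)
  show hol: "(\<lambda>z. M z $ 1 $ 1) holomorphic_on - P" "(\<lambda>z. M z $ 1 $ 2) holomorphic_on - P"
    using M unfolding soliton_rhp_def mat_holomorphic_on_def P by auto
  show "((\<lambda>z. M z $ 1 $ 1) \<longlongrightarrow> 1) at_infinity"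
    using M normalized_at_infinity_entry[of M 1 1] by (simp add: soliton_rhp_def)
  \<comment> \<open>Entrywise, a simple pole turns the residue into a limit of
    \<open>(z - p) M\<close>, the form in which the row argument consumes it.\<close>
  have pole: "((\<lambda>z. (z - p) * M z $ 1 $ j) \<longlongrightarrow> mat_residue M p $ 1 $ j) (at p)"
    if p: "p \<in> P" "mat_simple_pole M p" for p j
  proof -
    obtain A where "((\<lambda>z. mat (z - p) ** M z) \<longlongrightarrow> A) (at p)"
      using p(2) by (auto simp: mat_simple_pole_def)
    from tendsto_mat_entry[OF this, of 1 j] have A: "((\<lambda>z. (z - p) * M z $ 1 $ j) \<longlongrightarrow> A $ 1 $ j) (at p)"
      by (simp add: matmul2_nth)
    moreover have "residue (\<lambda>z. M z $ 1 $ j) p = A $ 1 $ j"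
      by (rule residue_of_lim[OF _ p(1) A]) (use hol exhaust_2[of j] in auto)
    ultimately show ?thesis by (simp add: mat_residue_def)
  qed
  { fix n assume n: "n \<in> {1..N}"
    have pP: "lam n \<in> P" "cnj (lam n) \<in> P" using n by (auto simp: P_def poles_def)
    have M': "mat_simple_pole M (lam n)" "mat_simple_pole M (cnj (lam n))"
      "((\<lambda>z. M z ** mat2 0 0 (c n * (phase_exp x t (lam n))\<^sup>2) 0) \<longlongrightarrow> mat_residue M (lam n)) (at (lam n))"
      "((\<lambda>z. M z ** mat2 0 (- cnj (c n) * inverse ((phase_exp x t (cnj (lam n)))\<^sup>2)) 0 0) \<longlongrightarrow> mat_residue M (cnj (lam n))) (at (cnj (lam n)))"
      using M n unfolding soliton_rhp_def phase_sq(2) unfolding phase_sq(1) c_def by auto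
    show "\<exists>A. ((\<lambda>z. (z - lam n) * M z $ 1 $ 1) \<longlongrightarrow> A) (at (lam n)) \<and>
       ((\<lambda>z. M z $ 1 $ 2 * (c n * (phase_exp x t (lam n))\<^sup>2)) \<longlongrightarrow> A) (at (lam n))"
      using pole[OF pP(1) M'(1), of 1] tendsto_mat_entry[OF M'(3), of 1 1]
      by (auto simp: matmul2_nth)
    show "\<exists>A. ((\<lambda>z. (z - cnj (lam n)) * M z $ 1 $ 2) \<longlongrightarrow> A) (at (cnj (lam n))) \<and>
       ((\<lambda>z. M z $ 1 $ 1 * (- cnj (c n) * inverse ((phase_exp x t (cnj (lam n)))\<^sup>2))) \<longlongrightarrow> A) (at (cnj (lam n)))"
      using pole[OF pP(2) M'(2), of 2] tendsto_mat_entry[OF M'(4), of 1 2]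
      by (auto simp: matmul2_nth) }
qed (rule b)

lemma psi_NIII_eq: "psi_NIII N lam x t = - 2 * \<i> * cnj be_coef"
proof -
  have "(THE p. \<exists>M. soliton_rhp N lam (coeff_III N lam) x t M \<and>
      ((\<lambda>z. 2 * \<i> * (z * M z $ 1 $ 2)) \<longlongrightarrow> p) at_infinity) = - 2 * \<i> * cnj be_coef"
  proof (rule the_equality)
    show "\<exists>M. soliton_rhp N lam (coeff_III N lam) x t M \<and>
      ((\<lambda>z. 2 * \<i> * (z * M z $ 1 $ 2)) \<longlongrightarrow> - 2 * \<i> * cnj be_coef) at_infinity"
      using tendsto_mult_left[OF sol_12_lim, of "2 * \<i>"] sol_rhp by auto
    fix p assume "\<exists>M. soliton_rhp N lam (coeff_III N lam) x t M \<and>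
      ((\<lambda>z. 2 * \<i> * (z * M z $ 1 $ 2)) \<longlongrightarrow> p) at_infinity"
    then obtain M :: "complex \<Rightarrow> complex^2^2" where M: "soliton_rhp N lam (coeff_III N lam) x t M"
      "((\<lambda>z. 2 * \<i> * (z * M z $ 1 $ 2)) \<longlongrightarrow> p) at_infinity" by blast
    from tendsto_mult_left[OF M(2), of "1 / (2 * \<i>)"]
    have "((\<lambda>z. z * M z $ 1 $ 2) \<longlongrightarrow> p / (2 * \<i>)) at_infinity" by simp
    from rhp_unique[OF M(1) this] show "p = - 2 * \<i> * cnj be_coef" by (simp add: field_simps)
  qed
  then show ?thesis by (simp add: psi_NIII_def nsoliton_def scattering)
qed

lemma norm_psi_NIII_le: "norm (psi_NIII N lam x t) \<le> 2 * (\<Sum>j\<in>{1..N}. Im (lam j))"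
  using norm_be_coef_le by (simp add: psi_NIII_eq norm_mult)

end

lemma darboux_parallel:
  assumes "w = v" shows "darboux l w z v = v"
  using assms by (simp add: darboux_def wedge_def)

text \<open>At the origin the phase is 1, so every undressed vector is \<open>(1, -1)\<close>. A
  Darboux factor fixes its own vector, hence all Darboux vectors stay equal to
  \<open>(1, -1)\<close>: each term attains equality in the amplitude bound, and all terms have the
  same argument.\<close>

lemma norm_psi_NIII_0:
  assumes "inj_on lam {1..N}" "\<And>n. n \<in> {1..N} \<Longrightarrow> Im (lam n) > 0"
  shows "norm (psi_NIII N lam 0 0) = 2 * (\<Sum>j\<in>{1..N}. Im (lam j))"
    and "extremal_soliton N lam (coeff_III N lam)"
proof -
  interpret nls_soliton 0 0 lam N using assms by unfold_locales
  have E1: "phase_exp 0 0 z = 1" for z by (simp add: phase_exp_def theta_def)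
  have dr: "dress (phase_exp 0 0) lam k z (1, -1) = (1, -1)" for k z
    by (induction k arbitrary: z) (auto simp: dress_Suc dvec_def E1 intro!: darboux_parallel)
  have dv: "dvec (phase_exp 0 0) lam k = (1, -1)" for k by (simp add: dvec_def dr E1)
  have "be_coef = (\<Sum>j<N. \<i> * of_real (Im (lam (Suc j))))"
    unfolding be_coef_def
  proof (rule sum.cong)
    fix j assume "j \<in> {..<N}"
    have "(lam (Suc j) - cnj (lam (Suc j))) = 2 * (\<i> * of_real (Im (lam (Suc j))))"
      by (simp add: complex_eq_iff)
    then show "(lam (Suc j) - cnj (lam (Suc j))) * (- snd (dvec (phase_exp 0 0) lam j) * cnj (fst (dvec (phase_exp 0 0) lam j)) /
        of_real ((norm (dvec (phase_exp 0 0) lam j))\<^sup>2)) = \<i> * of_real (Im (lam (Suc j)))"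
      unfolding norm_sq_prod dv by simp
  qed simp
  also have "\<dots> = \<i> * of_real (\<Sum>j\<in>{1..N}. Im (lam j))"
    by (simp add: sum_distrib_left sum.atLeast1_atMost_eq)
  finally have "norm (psi_NIII N lam 0 0) = 2 * \<bar>\<Sum>j\<in>{1..N}. Im (lam j)\<bar>"
    unfolding psi_NIII_eq by (simp add: norm_mult del: of_real_sum)
  also have "\<bar>\<Sum>j\<in>{1..N}. Im (lam j)\<bar> = (\<Sum>j\<in>{1..N}. Im (lam j))"
    using assms(2) by (intro abs_of_nonneg sum_nonneg) force
  finally show *: "norm (psi_NIII N lam 0 0) = 2 * (\<Sum>j\<in>{1..N}. Im (lam j))" .
  then show "extremal_soliton N lam (coeff_III N lam)"
    using scattering unfolding extremal_soliton_def psi_NIII_def by blast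
qed

section \<open>Blaschke products close to an exponential\<close>

lemma norm_exp_diff_le:
  fixes a b :: complex
  assumes "norm a \<le> A" "norm b \<le> A"
  shows "norm (exp a - exp b) \<le> exp A * norm (a - b)"
proof (rule field_differentiable_bound[of "cball 0 A" exp exp])
  fix z :: complex assume "z \<in> cball 0 A"
  then show "norm (exp z) \<le> exp A"
    using norm_exp[of z] by (simp add: order_trans) 
  show "(exp has_field_derivative exp z) (at z within cball 0 A)"
    by (intro derivative_eq_intros) auto
qed (use assms in auto)

text \<open>Write the factor as \<open>(1 - cnj l / z) / (1 - l / z)\<close>. The linear terms of
  the two logarithms combine to \<open>(l - cnj l) / z\<close>; each remainder is at most
  \<open>2 |l / z|^2\<close> because \<open>|l / z|\<close> is at most \<open>1/2\<close>.\<close>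

lemma blaschke_factor_exp:
  fixes l z :: complex
  assumes "2 * norm l \<le> norm z" "z \<noteq> 0"
  obtains \<eta> where "(z - cnj l) / (z - l) = exp \<eta>"
    "norm (\<eta> - 2 * \<i> * of_real (Im l) / z) \<le> 4 * (norm l)\<^sup>2 / (norm z)\<^sup>2"
proof -
  have L: "norm (Ln (1 - u) + u) \<le> 2 * (norm l)\<^sup>2 / (norm z)\<^sup>2" "1 - u \<noteq> 0"
    if u: "norm u = norm l / norm z" for u
  proof -
    have h: "norm u \<le> 1 / 2" using assms by (simp add: u pos_divide_le_eq)
    have "norm (Ln (1 + (- u)) - (- u)) \<le> (norm (- u))\<^sup>2 / (1 - norm (- u))"
      by (rule Ln_approx_linear) (use h in auto)
    also have "\<dots> \<le> (norm u)\<^sup>2 / (1 / 2)"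
      unfolding norm_minus_cancel by (rule divide_left_mono) (use h in auto)
    finally show "norm (Ln (1 - u) + u) \<le> 2 * (norm l)\<^sup>2 / (norm z)\<^sup>2"
      by (simp add: u power_divide mult.commute)
    show "1 - u \<noteq> 0" using h by auto
  qed
  have u: "norm (cnj l / z) = norm l / norm z" "norm (l / z) = norm l / norm z"
    by (simp_all add: norm_divide)
  let ?e = "Ln (1 - cnj l / z) - Ln (1 - l / z)"
  have "(z - cnj l) / (z - l) = (1 - cnj l / z) / (1 - l / z)"
    using assms(2) by (simp add: divide_simps)
  also have "\<dots> = exp ?e"
    using L(2)[OF u(1)] L(2)[OF u(2)] by (simp add: exp_diff)
  finally have 1: "(z - cnj l) / (z - l) = exp ?e" .
  have "2 * \<i> * of_real (Im l) = l - cnj l" by (simp add: complex_eq_iff)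
  then have "?e - 2 * \<i> * of_real (Im l) / z = (Ln (1 - cnj l / z) + cnj l / z) - (Ln (1 - l / z) + l / z)"
    by (simp add: diff_divide_distrib)
  also have "norm \<dots> \<le> 2 * (norm l)\<^sup>2 / (norm z)\<^sup>2 + 2 * (norm l)\<^sup>2 / (norm z)\<^sup>2"
    by (rule order_trans[OF norm_triangle_ineq4 add_mono]) (intro L(1) u)+
  finally show ?thesis using that[OF 1] by simp
qed

text \<open>The weights come from the region \<open>|z| \<ge> 1/2\<close>, where the factor
  remainders are at most \<open>16 |l|^2\<close> each and the error in the linear term is at most 4
  times the deviation of the sum of imaginary parts from 2.\<close>

definition blaschke_gap :: "(nat \<Rightarrow> complex) \<Rightarrow> nat \<Rightarrow> real" where
  "blaschke_gap lam N = 16 * (\<Sum>l\<in>{1..N}. (norm (lam l))\<^sup>2) + 4 * \<bar>(\<Sum>l\<in>{1..N}. Im (lam l)) - 2\<bar>"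

lemma blaschke_gap_nonneg: "blaschke_gap lam N \<ge> 0"
  unfolding blaschke_gap_def by (intro add_nonneg_nonneg mult_nonneg_nonneg sum_nonneg) auto

text \<open>The exponent is a sum of logarithms of single factors, all close to 1, so no branch for
  the whole product has to be chosen.\<close>

lemma blaschke_exp:
  assumes z: "norm z \<ge> 1 / 2" and small: "\<And>l. l \<in> {1..N} \<Longrightarrow> norm (lam l) \<le> 1 / 4"
  obtains \<eta> where "blaschke lam N z = exp \<eta>" "norm (\<eta> - 4 * \<i> / z) \<le> blaschke_gap lam N"
proof -
  have z0: "z \<noteq> 0" using z by auto
  have "\<exists>\<eta>. (z - cnj (lam l)) / (z - lam l) = exp \<eta> \<and>
    norm (\<eta> - 2 * \<i> * of_real (Im (lam l)) / z) \<le> 4 * (norm (lam l))\<^sup>2 / (norm z)\<^sup>2" if "l \<in> {1..N}" for l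
    by (rule blaschke_factor_exp[of "lam l" z]) (use small[OF that] z z0 in auto)
  then obtain \<eta> where \<eta>: "\<And>l. l \<in> {1..N} \<Longrightarrow> (z - cnj (lam l)) / (z - lam l) = exp (\<eta> l)"
    "\<And>l. l \<in> {1..N} \<Longrightarrow> norm (\<eta> l - 2 * \<i> * of_real (Im (lam l)) / z) \<le> 4 * (norm (lam l))\<^sup>2 / (norm z)\<^sup>2"
    by metis
  define s where "s = (\<Sum>l\<in>{1..N}. Im (lam l))"
  have "blaschke lam N z = exp (\<Sum>l\<in>{1..N}. \<eta> l)"
    unfolding blaschke_def by (simp add: exp_sum \<eta>(1))
  moreover have "norm ((\<Sum>l\<in>{1..N}. \<eta> l) - 4 * \<i> / z) \<le> blaschke_gap lam N"
  proof -
    have "(\<Sum>l\<in>{1..N}. \<eta> l) - 4 * \<i> / z =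
      (\<Sum>l\<in>{1..N}. \<eta> l - 2 * \<i> * of_real (Im (lam l)) / z) + 2 * \<i> * of_real (s - 2) / z"
      by (simp add: s_def sum_subtractf sum_distrib_left sum_divide_distrib[symmetric] algebra_simps diff_divide_distrib)
    also have "norm \<dots> \<le> (\<Sum>l\<in>{1..N}. 16 * (norm (lam l))\<^sup>2) + 4 * \<bar>s - 2\<bar>"
    proof (rule order_trans[OF norm_triangle_ineq add_mono])
      have i: "1 / norm z \<le> 2" using z z0 by (simp add: field_simps)
      show "norm (\<Sum>l\<in>{1..N}. \<eta> l - 2 * \<i> * of_real (Im (lam l)) / z) \<le> (\<Sum>l\<in>{1..N}. 16 * (norm (lam l))\<^sup>2)"
      proof (rule sum_norm_le)
        fix l assume l: "l \<in> {1..N}"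
        have "(1 / norm z)\<^sup>2 \<le> 2\<^sup>2" by (rule power_mono[OF i]) simp
        then have "4 * (norm (lam l))\<^sup>2 * (1 / norm z)\<^sup>2 \<le> 4 * (norm (lam l))\<^sup>2 * 4"
          by (intro mult_left_mono) auto
        with \<eta>(2)[OF l] show "norm (\<eta> l - 2 * \<i> * of_real (Im (lam l)) / z) \<le> 16 * (norm (lam l))\<^sup>2"
          by (simp add: power_divide)
      qed
      have "norm (2 * \<i> * of_real (s - 2) / z) = 2 * \<bar>s - 2\<bar> * (1 / norm z)"
        by (simp add: norm_mult norm_divide del: of_real_diff)
      also have "\<dots> \<le> 2 * \<bar>s - 2\<bar> * 2" by (intro mult_left_mono i) auto
      finally show "norm (2 * \<i> * of_real (s - 2) / z) \<le> 4 * \<bar>s - 2\<bar>" by simp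
    qed
    finally show ?thesis by (simp add: blaschke_gap_def s_def sum_distrib_left)
  qed
  ultimately show ?thesis by (rule that)
qed

text \<open>For \<open>|z| \<ge> 1/2\<close> the limiting exponent has modulus at most 8 and the
  actual one at most \<open>8 + D\<close>; negating both treats the inverse in the same way. Both
  versions occur in the comparison of the two problems.\<close>

lemma blaschke_close:
  assumes z: "norm z \<ge> 1 / 2" and small: "\<And>l. l \<in> {1..N} \<Longrightarrow> norm (lam l) \<le> 1 / 4"
    and gap: "blaschke_gap lam N \<le> D"
  shows "norm (blaschke lam N z) \<le> exp (8 + D)"
    "norm (blaschke lam N z - exp (4 * \<i> / z)) \<le> exp (8 + D) * blaschke_gap lam N"
    "norm (inverse (blaschke lam N z) - exp (- (4 * \<i> / z))) \<le> exp (8 + D) * blaschke_gap lam N"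
proof -
  obtain \<eta> where \<eta>: "blaschke lam N z = exp \<eta>" "norm (\<eta> - 4 * \<i> / z) \<le> blaschke_gap lam N"
    by (rule blaschke_exp[OF z, of N lam]) (use small in auto)
  have D: "D \<ge> 0" using gap blaschke_gap_nonneg[of lam N] by linarith
  have "z \<noteq> 0" using z by auto
  then have 4: "norm (4 * \<i> / z) \<le> 8" using z by (simp add: norm_divide field_simps)
  have e: "norm \<eta> \<le> 8 + D"
    using 4 \<eta>(2) gap norm_triangle_ineq[of "\<eta> - 4 * \<i> / z" "4 * \<i> / z"] by simp
  show "norm (blaschke lam N z) \<le> exp (8 + D)"
    using norm_exp[of \<eta>] e unfolding \<eta>(1) by (meson exp_le_cancel_iff order_trans)
  have "norm (exp \<eta> - exp (4 * \<i> / z)) \<le> exp (8 + D) * norm (\<eta> - 4 * \<i> / z)"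
    by (rule norm_exp_diff_le) (use e 4 D in linarith)+
  also have "\<dots> \<le> exp (8 + D) * blaschke_gap lam N" by (intro mult_left_mono \<eta>) simp
  finally show "norm (blaschke lam N z - exp (4 * \<i> / z)) \<le> exp (8 + D) * blaschke_gap lam N"
    by (simp add: \<eta>(1))
  have "norm (exp (- \<eta>) - exp (- (4 * \<i> / z))) \<le> exp (8 + D) * norm (- \<eta> - (- (4 * \<i> / z)))"
    by (rule norm_exp_diff_le; unfold norm_minus_cancel) (use e 4 D in linarith)+
  also have "norm (- \<eta> - (- (4 * \<i> / z))) = norm (\<eta> - 4 * \<i> / z)"
    by (simp add: norm_minus_commute)
  also have "exp (8 + D) * norm (\<eta> - 4 * \<i> / z) \<le> exp (8 + D) * blaschke_gap lam N"
    by (intro mult_left_mono \<eta>) simp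
  finally show "norm (inverse (blaschke lam N z) - exp (- (4 * \<i> / z))) \<le> exp (8 + D) * blaschke_gap lam N"
    by (simp add: \<eta>(1) exp_minus)
qed

section \<open>Inversion, normal families and uniform bounds\<close>

lemma holomorphic_inversion:
  assumes h: "h holomorphic_on {z. norm z > 1 / r}" and r: "r > 0" and lim: "(h \<longlongrightarrow> L) at_infinity"
  shows "(\<lambda>w. if w = 0 then L else h (inverse w)) holomorphic_on ball 0 r"
proof (rule no_isolated_singularity'[of "{0}"])
  let ?k = "\<lambda>w. if w = 0 then L else h (inverse w)"
  have "((\<lambda>w. h (inverse w)) \<longlongrightarrow> L) (at 0)"
    using lim by (simp add: lim_at_infinity_0 o_def)
  then have "(?k \<longlongrightarrow> L) (at 0)"
    by (rule Lim_transform_eventually) (auto simp: eventually_at_filter)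
  then show "(?k \<longlongrightarrow> ?k w) (at w within ball 0 r)" if "w \<in> {0}" for w
    using that by (auto intro: tendsto_within_subset)
  show "?k holomorphic_on ball 0 r - {0}"
  proof (rule holomorphic_transform)
    show "(\<lambda>w. h (inverse w)) holomorphic_on ball 0 r - {0}"
    proof (intro holomorphic_on_compose_gen[OF _ h, unfolded o_def] holomorphic_intros)
      show "inverse ` (ball 0 r - {0}) \<subseteq> {z::complex. 1 / r < norm z}"
      proof clarsimp
        fix w :: complex assume "norm w < r" "w \<noteq> 0"
        then show "1 / r < norm (inverse w)" using r by (simp add: norm_inverse norm_divide field_simps)
      qed
    qed auto
  qed auto
qed auto

lemma montel_ball:
  fixes F :: "nat \<Rightarrow> complex \<Rightarrow> complex"
  assumes "\<And>n. F n holomorphic_on ball 0 r" "\<And>n z. z \<in> ball 0 r \<Longrightarrow> norm (F n z) \<le> C"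
  obtains g s where "g holomorphic_on ball 0 r" "strict_mono (s :: nat \<Rightarrow> nat)"
    "\<And>z. z \<in> ball 0 r \<Longrightarrow> (\<lambda>n. F (s n) z) \<longlonglongrightarrow> g z"
proof -
  have bounded: "\<exists>B. \<forall>h\<in>range F. \<forall>z\<in>K. norm (h z) \<le> B" if "K \<subseteq> ball 0 r" for K
    using assms(2) that by blast
  show ?thesis
  proof (rule Montel[of "ball 0 r" "range F" F])
    show "h holomorphic_on ball 0 r" if "h \<in> range F" for h using assms(1) that by blast
  qed (use bounded that in auto)
qed

lemma montel_ball_4:
  fixes F1 F2 F3 F4 :: "nat \<Rightarrow> complex \<Rightarrow> complex"
  assumes "\<And>n. F1 n holomorphic_on ball 0 r" "\<And>n z. z \<in> ball 0 r \<Longrightarrow> norm (F1 n z) \<le> C"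
    and "\<And>n. F2 n holomorphic_on ball 0 r" "\<And>n z. z \<in> ball 0 r \<Longrightarrow> norm (F2 n z) \<le> C"
    and "\<And>n. F3 n holomorphic_on ball 0 r" "\<And>n z. z \<in> ball 0 r \<Longrightarrow> norm (F3 n z) \<le> C"
    and "\<And>n. F4 n holomorphic_on ball 0 r" "\<And>n z. z \<in> ball 0 r \<Longrightarrow> norm (F4 n z) \<le> C"
  obtains g1 g2 g3 g4 s where "strict_mono (s :: nat \<Rightarrow> nat)"
    "g1 holomorphic_on ball 0 r" "g2 holomorphic_on ball 0 r"
    "g3 holomorphic_on ball 0 r" "g4 holomorphic_on ball 0 r"
    "\<And>z. z \<in> ball 0 r \<Longrightarrow> (\<lambda>n. F1 (s n) z) \<longlonglongrightarrow> g1 z"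
    "\<And>z. z \<in> ball 0 r \<Longrightarrow> (\<lambda>n. F2 (s n) z) \<longlonglongrightarrow> g2 z"
    "\<And>z. z \<in> ball 0 r \<Longrightarrow> (\<lambda>n. F3 (s n) z) \<longlonglongrightarrow> g3 z"
    "\<And>z. z \<in> ball 0 r \<Longrightarrow> (\<lambda>n. F4 (s n) z) \<longlonglongrightarrow> g4 z"
proof -
  obtain g1 s1 where 1: "g1 holomorphic_on ball 0 r" "strict_mono s1"
    "\<And>z. z \<in> ball 0 r \<Longrightarrow> (\<lambda>n. F1 (s1 n) z) \<longlonglongrightarrow> g1 z"
    by (rule montel_ball[of F1 r C]) (use assms in auto)
  obtain g2 s2 where 2: "g2 holomorphic_on ball 0 r" "strict_mono s2"
    "\<And>z. z \<in> ball 0 r \<Longrightarrow> (\<lambda>n. F2 (s1 (s2 n)) z) \<longlonglongrightarrow> g2 z"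
    by (rule montel_ball[of "\<lambda>n. F2 (s1 n)" r C]) (use assms in auto)
  obtain g3 s3 where 3: "g3 holomorphic_on ball 0 r" "strict_mono s3"
    "\<And>z. z \<in> ball 0 r \<Longrightarrow> (\<lambda>n. F3 (s1 (s2 (s3 n))) z) \<longlonglongrightarrow> g3 z"
    by (rule montel_ball[of "\<lambda>n. F3 (s1 (s2 n))" r C]) (use assms in auto)
  obtain g4 s4 where 4: "g4 holomorphic_on ball 0 r" "strict_mono s4"
    "\<And>z. z \<in> ball 0 r \<Longrightarrow> (\<lambda>n. F4 (s1 (s2 (s3 (s4 n)))) z) \<longlonglongrightarrow> g4 z"
    by (rule montel_ball[of "\<lambda>n. F4 (s1 (s2 (s3 n)))" r C]) (use assms in auto)
  show ?thesis
  proof (rule that[of "\<lambda>n. s1 (s2 (s3 (s4 n)))" g1 g2 g3 g4])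
    show "strict_mono (\<lambda>n. s1 (s2 (s3 (s4 n))))"
      using 1(2) 2(2) 3(2) 4(2) by (simp add: strict_mono_def)
    fix z :: complex assume z: "z \<in> ball 0 r"
    have m: "strict_mono (\<lambda>n. s2 (s3 (s4 n)))" "strict_mono (\<lambda>n. s3 (s4 n))"
      using 2(2) 3(2) 4(2) by (simp_all add: strict_mono_def)
    show "(\<lambda>n. F1 (s1 (s2 (s3 (s4 n)))) z) \<longlonglongrightarrow> g1 z"
      using LIMSEQ_subseq_LIMSEQ[OF 1(3)[OF z] m(1)] by (simp add: o_def)
    show "(\<lambda>n. F2 (s1 (s2 (s3 (s4 n)))) z) \<longlonglongrightarrow> g2 z"
      using LIMSEQ_subseq_LIMSEQ[OF 2(3)[OF z] m(2)] by (simp add: o_def)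
    show "(\<lambda>n. F3 (s1 (s2 (s3 (s4 n)))) z) \<longlonglongrightarrow> g3 z"
      using LIMSEQ_subseq_LIMSEQ[OF 3(3)[OF z] 4(2)] by (simp add: o_def)
  qed (use 1 2 3 4 in auto)
qed

context soliton
begin

text \<open>The a priori bound behind both compactness and stability: the solution is controlled by
  \<open>B\<close> alone, and \<open>B\<close> by \<open>D\<close>. The radii \<open>1/2\<close> and
  \<open>1/4\<close> keep \<open>z\<close> away from all poles.\<close>

lemma al_be_bounds:
  assumes z: "norm z \<ge> 1 / 2" and small: "\<And>l. l \<in> {1..N} \<Longrightarrow> norm (lam l) \<le> 1 / 4"
    and gap: "blaschke_gap lam N \<le> D"
  shows "z \<notin> P" "norm (al z) \<le> exp (8 + D)" "norm (be z) \<le> exp (8 + D)"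
    "norm (star al z) \<le> exp (8 + D)" "norm (star be z) \<le> exp (8 + D)"
proof -
  show zP: "z \<notin> P" using z small by (fastforce simp: P_def poles_def)
  have D: "D \<ge> 0" using gap blaschke_gap_nonneg[of lam N] by linarith
  then have 1: "1 \<le> exp (8 + D)" by simp
  have *: "norm (al u) \<le> exp (8 + D) \<and> norm (be u) \<le> exp (8 + D)" if u: "norm u \<ge> 1 / 2" "u \<notin> P" for u
  proof -
    have "max 1 (norm (B u)) \<le> exp (8 + D)"
      using blaschke_close(1)[OF u(1) small gap] 1 by simp
    moreover have "u \<notin> poles N" using u by (simp add: P_def)
    ultimately show ?thesis using al_be_norm_le[of u] order_trans by blast
  qed
  show "norm (al z) \<le> exp (8 + D)" "norm (be z) \<le> exp (8 + D)" using *[OF z zP] by auto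
  show "norm (star al z) \<le> exp (8 + D)" "norm (star be z) \<le> exp (8 + D)"
    using *[of "cnj z"] z zP cnj_P by (auto simp: star_def)
qed

end

section \<open>The limiting Riemann-Hilbert problem\<close>

text \<open>The outer pair and the inner pair overlap in an annulus around the unit circle, so
  boundary values on the circle are ordinary values. Here \<open>f\<close> and \<open>g\<close> are
  given on a disc, and the relation to the outer pair stays off 0, where
  \<open>exp (4 i / z)\<close> has an essential singularity. \<open>b\<close> plays the role of
  \<open>be_coef\<close>.\<close>

locale limit_solution =
  fixes E al be f g :: "complex \<Rightarrow> complex" and a b :: complex
  assumes E_hol: "E holomorphic_on UNIV"
    and E_star: "\<And>z. star E z * E z = 1"
    and al_hol: "al holomorphic_on {z. norm z > 1 / 2}"
    and be_hol: "be holomorphic_on {z. norm z > 1 / 2}"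
    and f_hol: "f holomorphic_on ball 0 2"
    and g_hol: "g holomorphic_on ball 0 2"
    and al_asymp: "((\<lambda>z. z * (al z - 1)) \<longlongrightarrow> a) at_infinity"
    and be_asymp: "((\<lambda>z. z * be z) \<longlongrightarrow> b) at_infinity"
    and f_eq: "\<And>z. 1 / 2 < norm z \<Longrightarrow> norm z < 2 \<Longrightarrow>
      f z = al z / E z + exp (4 * \<i> / z) * E z * star be z"
    and g_eq: "\<And>z. 1 / 2 < norm z \<Longrightarrow> norm z < 2 \<Longrightarrow>
      g z = be z / E z - exp (4 * \<i> / z) * E z * star al z"

text \<open>Any sequence of Blaschke products tending to \<open>exp (4 \<i> / z)\<close> would do here; the
  real parts \<open>2 l / n\<^sup>2\<close> only serve to make the poles distinct.\<close>

definition model_poles :: "nat \<Rightarrow> nat \<Rightarrow> complex" where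
  "model_poles n l = Complex (2 * real l / (real n)\<^sup>2) (2 / real n)"

lemma model_poles_inj: "inj_on (model_poles n) {1..n}"
  by (auto simp: inj_on_def model_poles_def)

lemma model_poles_norm: "l \<in> {1..n} \<Longrightarrow> norm (model_poles n l) \<le> 4 / real n"
proof -
  assume l: "l \<in> {1..n}"
  have "norm (model_poles n l) \<le> \<bar>2 * real l / (real n)\<^sup>2\<bar> + \<bar>2 / real n\<bar>"
    unfolding model_poles_def using cmod_le[of "Complex (2 * real l / (real n)\<^sup>2) (2 / real n)"] by simp
  also have "\<dots> = (2 * (real l / real n) + 2) / real n"
    by (simp add: power2_eq_square add_divide_distrib)
  also have "\<dots> \<le> (2 * 1 + 2) / real n"
    using l by (intro divide_right_mono add_mono mult_left_mono) auto
  finally show ?thesis by simp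
qed

text \<open>The imaginary parts add up to exactly 2, so only the quadratic part is left:
  \<open>16 * n * (4 / n)^2\<close>.\<close>

lemma model_poles_gap:
  assumes "n > 0"
  shows "blaschke_gap (model_poles n) n \<le> 256 / real n"
proof -
  have "(\<Sum>l\<in>{1..n}. (norm (model_poles n l))\<^sup>2) \<le> (\<Sum>l\<in>{1..n}. (4 / real n)\<^sup>2)"
    by (intro sum_mono power_mono model_poles_norm) auto
  also have "\<dots> = 16 / real n" using assms by (simp add: power2_eq_square)
  finally show ?thesis using assms by (simp add: blaschke_gap_def model_poles_def)
qed

lemma inversion_holomorphic:
  assumes A: "A holomorphic_on ball 0 2"
  shows "(\<lambda>z. A (inverse z)) holomorphic_on {z. norm z > 1 / 2}"
    and "((\<lambda>z. z * (A (inverse z) - A 0)) \<longlongrightarrow> deriv A 0) at_infinity"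
proof -
  show "(\<lambda>z. A (inverse z)) holomorphic_on {z. norm z > 1 / 2}"
  proof (intro holomorphic_on_compose_gen[OF _ A, unfolded o_def] holomorphic_intros)
    show "inverse ` {z. 1 / 2 < norm z} \<subseteq> ball (0::complex) 2"
    proof clarsimp
      fix z :: complex assume "1 < norm z * 2"
      then show "norm (inverse z) < 2"
        using less_imp_inverse_less[of "1/2" "norm z"] by (simp add: norm_inverse)
    qed
  qed auto
  have "(A has_field_derivative deriv A 0) (at 0)"
    by (rule holomorphic_derivI[OF A]) auto
  then have "((\<lambda>w. inverse w * (A (inverse (inverse w)) - A 0)) \<longlongrightarrow> deriv A 0) (at 0)"
    by (simp add: has_field_derivative_iff divide_inverse mult.commute)
  then show "((\<lambda>z. z * (A (inverse z) - A 0)) \<longlongrightarrow> deriv A 0) at_infinity"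
    by (rule tendsto_at_infinity_inverse)
qed

lemma bounded_on_sphere:
  assumes "continuous_on (sphere 0 r) h"
  obtains C where "C \<ge> 1" "\<And>z::complex. norm z = r \<Longrightarrow> norm (h z :: complex) \<le> C"
proof -
  have "compact (h ` sphere 0 r)" using assms by (intro compact_continuous_image) auto
  then obtain C where "\<And>x. x \<in> h ` sphere 0 r \<Longrightarrow> norm x \<le> C"
    using compact_imp_bounded[of "h ` sphere 0 r"] by (auto simp: bounded_iff)
  then show ?thesis by (intro that[of "max 1 C"]) (auto simp: le_max_iff_disj)
qed

lemma limit_solution_exists:
  assumes E_hol: "E holomorphic_on UNIV" and E_star: "\<And>z. star E z * E z = 1"
  obtains al be f g a b where "limit_solution E al be f g a b"
proof -
  \<comment> \<open>The shift by 16 makes \<open>4 / m\<close> at most \<open>1/4\<close> and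
    \<open>256 / m\<close> at most 16 from the first index on.\<close>
  define m lam where "m n = n + 16" and "lam n = model_poles (m n)" for n
  have m: "m n \<ge> 16" for n by (simp add: m_def)
  interpret S: soliton E "lam n" "m n" for n
    by unfold_locales (use E_hol E_star model_poles_inj m in \<open>auto simp: lam_def model_poles_def m_def\<close>)
  have small: "norm (lam n l) \<le> 1 / 4" if "l \<in> {1..m n}" for n l
  proof -
    have "4 / real (m n) \<le> 4 / 16" by (rule divide_left_mono) (use m[of n] in auto)
    then show ?thesis using model_poles_norm[OF that] by (simp add: lam_def)
  qed
  have gap: "blaschke_gap (lam n) (m n) \<le> 256 / real (m n)" for n
    unfolding lam_def by (rule model_poles_gap) (simp add: m_def)
  have gap16: "blaschke_gap (lam n) (m n) \<le> 16" for n
  proof -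
    have "256 / real (m n) \<le> 256 / 16" by (rule divide_left_mono) (use m[of n] in auto)
    then show ?thesis using gap[of n] by linarith
  qed
  have "(\<lambda>n. 256 / real (m n)) \<longlonglongrightarrow> 0" unfolding m_def by real_asymp
  then have gap_lim: "(\<lambda>n. blaschke_gap (lam n) (m n)) \<longlonglongrightarrow> 0"
    by (rule Lim_null_comparison[rotated]) (use gap blaschke_gap_nonneg in \<open>auto intro!: always_eventually\<close>)
  have Blim: "(\<lambda>n. blaschke (lam n) (m n) z) \<longlonglongrightarrow> exp (4 * \<i> / z)" if "norm z \<ge> 1 / 2" for z
  proof (rule LIM_zero_cancel, rule Lim_null_comparison)
    show "\<forall>\<^sub>F n in sequentially. norm (blaschke (lam n) (m n) z - exp (4 * \<i> / z))
        \<le> exp (8 + 16) * blaschke_gap (lam n) (m n)"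
      using blaschke_close(2)[OF that small gap16] by (auto intro!: always_eventually)
    show "(\<lambda>n. exp (8 + 16) * blaschke_gap (lam n) (m n)) \<longlonglongrightarrow> 0"
      by (intro tendsto_mult_right_zero gap_lim)
  qed
  define K :: real where "K = exp (8 + 16)"
  have K: "K \<ge> 1" by (simp add: K_def)
  note bd = S.al_be_bounds[OF _ small gap16, folded K_def]
  have sub: "{z. norm z > 1 / 2} \<subseteq> - S.poles n (m n)" for n
    using bd(1) by (fastforce simp: S.P_def)
  have hol: "S.al n holomorphic_on {z. norm z > 1 / 2}" "S.be n holomorphic_on {z. norm z > 1 / 2}" for n
    using S.al_be_holomorphic[of n] holomorphic_on_subset[OF _ sub] by auto
  \<comment> \<open>The exterior region is moved to a disc around 0 for Montel's theorem. The value
    at 0 is the normalization at infinity.\<close>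
  define F1 F2 where "F1 n w = (if w = 0 then 1 else S.al n (inverse w))"
    and "F2 n w = (if w = 0 then 0 else S.be n (inverse w))" for n w
  have F12: "F1 n holomorphic_on ball 0 2" "F2 n holomorphic_on ball 0 2" for n
    unfolding F1_def F2_def using holomorphic_inversion[of _ 2] hol S.al_lim S.be_lim by auto
  have inv: "norm (inverse w) \<ge> 1 / 2" if "w \<in> ball 0 2" "w \<noteq> 0" for w :: complex
    using that le_imp_inverse_le[of "norm w" 2] by (simp add: norm_inverse)
  have F12b: "norm (F1 n w) \<le> K" "norm (F2 n w) \<le> K" if "w \<in> ball 0 2" for n w
    using bd(2,3)[OF inv[OF that]] K by (auto simp: F1_def F2_def)
  have "\<exists>f g. f holomorphic_on UNIV \<and> g holomorphic_on UNIV \<and>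
    (\<forall>z. z \<notin> S.P n \<longrightarrow> f z = S.al n z / E z + blaschke (lam n) (m n) z * E z * star (S.be n) z) \<and>
    (\<forall>z. z \<notin> S.P n \<longrightarrow> g z = S.be n z / E z - blaschke (lam n) (m n) z * E z * star (S.al n) z)" for n
    using S.entire_pair[of n] by metis
  then obtain F3 F4 where F34: "\<And>n. F3 n holomorphic_on UNIV" "\<And>n. F4 n holomorphic_on UNIV"
    "\<And>n z. z \<notin> S.P n \<Longrightarrow> F3 n z = S.al n z / E z + blaschke (lam n) (m n) z * E z * star (S.be n) z"
    "\<And>n z. z \<notin> S.P n \<Longrightarrow> F4 n z = S.be n z / E z - blaschke (lam n) (m n) z * E z * star (S.al n) z"
    by metis
  have Ec: "continuous_on A E" for A
    using holomorphic_on_imp_continuous_on[OF E_hol] continuous_on_subset by blast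
  obtain C1 where C1: "C1 \<ge> 1" "\<And>z. norm z = 2 \<Longrightarrow> norm (E z) \<le> C1"
    by (rule bounded_on_sphere[of 2 E, OF Ec]) blast
  obtain C2 where C2: "C2 \<ge> 1" "\<And>z. norm z = 2 \<Longrightarrow> norm (inverse (E z)) \<le> C2"
    by (rule bounded_on_sphere[of 2 "\<lambda>z. inverse (E z)"]) (auto intro!: continuous_intros Ec)
  define C where "C = K * C2 + K * C1 * K"
  have "1 * 1 \<le> K * C2" using K C2 by (intro mult_mono) auto
  moreover have "K * 1 \<le> K * C2" using K C2 by (intro mult_left_mono) auto
  moreover have "K * C1 * K \<ge> 0" using K C1 by simp
  ultimately have KC: "K \<le> C" unfolding C_def by linarith
  \<comment> \<open>On \<open>|z| = 2\<close> the formula through the outer functions bounds the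
    entire pair uniformly; the maximum principle carries this bound inwards, past the poles that the
    formula itself cannot cross.\<close>
  have sph: "norm (F3 n z) \<le> C \<and> norm (F4 n z) \<le> C" if z: "norm z = 2" for n z
  proof -
    have z': "norm z \<ge> 1 / 2" using z by simp
    have zP: "z \<notin> S.P n" using bd(1)[OF z'] by simp
    have Bb: "norm (blaschke (lam n) (m n) z) \<le> K"
      unfolding K_def by (rule blaschke_close(1)[OF z' small gap16])
    have t: "norm (x / E z) \<le> K * C2" "norm (blaschke (lam n) (m n) z * E z * x) \<le> K * C1 * K"
      if "norm x \<le> K" for x
    proof -
      have "norm x * norm (inverse (E z)) \<le> K * C2"
        by (intro mult_mono that C2 z) (use K in auto)
      then show "norm (x / E z) \<le> K * C2" by (simp add: divide_inverse norm_mult)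
      show "norm (blaschke (lam n) (m n) z * E z * x) \<le> K * C1 * K"
        unfolding norm_mult by (intro mult_mono that C1 z Bb) (use K C1 in auto)
    qed
    show ?thesis unfolding F34(3,4)[OF zP] C_def
      using norm_triangle_le[OF add_mono[OF t(1) t(2)]] norm_triangle_le_diff[OF add_mono[OF t(1) t(2)]]
        bd(2-5)[OF z', of n] by blast
  qed
  have F34b: "norm (F3 n z) \<le> C" "norm (F4 n z) \<le> C" if "z \<in> ball 0 2" for n z
  proof -
    have "norm (h z) \<le> C" if "h holomorphic_on UNIV" "\<And>z. norm z = 2 \<Longrightarrow> norm (h z) \<le> C" for h
    proof (rule maximum_modulus_frontier[of h "cball 0 2"])
      show "continuous_on (closure (cball 0 2)) h"
        using holomorphic_on_imp_continuous_on[OF that(1)] continuous_on_subset by blast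
    qed (use that \<open>z \<in> ball 0 2\<close> in \<open>auto intro: holomorphic_on_subset\<close>)
    then show "norm (F3 n z) \<le> C" "norm (F4 n z) \<le> C" using F34(1,2) sph by blast+
  qed
  obtain A Bt f g s where lims: "strict_mono (s :: nat \<Rightarrow> nat)"
    "A holomorphic_on ball 0 2" "Bt holomorphic_on ball 0 2"
    "f holomorphic_on ball 0 2" "g holomorphic_on ball 0 2"
    "\<And>z. z \<in> ball 0 2 \<Longrightarrow> (\<lambda>n. F1 (s n) z) \<longlonglongrightarrow> A z"
    "\<And>z. z \<in> ball 0 2 \<Longrightarrow> (\<lambda>n. F2 (s n) z) \<longlonglongrightarrow> Bt z"
    "\<And>z. z \<in> ball 0 2 \<Longrightarrow> (\<lambda>n. F3 (s n) z) \<longlonglongrightarrow> f z"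
    "\<And>z. z \<in> ball 0 2 \<Longrightarrow> (\<lambda>n. F4 (s n) z) \<longlonglongrightarrow> g z"
  proof (rule montel_ball_4[of F1 2 C F2 F3 F4])
    show "F3 n holomorphic_on ball 0 2" "F4 n holomorphic_on ball 0 2" for n
      using F34(1,2)[of n] by (auto intro: holomorphic_on_subset)
  qed (use F12 F12b F34b KC order_trans in \<open>(blast | fast)+\<close>)
  \<comment> \<open>The values at 0 do not depend on \<open>n\<close>, so the normalization survives
    the limit; the derivatives at 0 become the \<open>1/z\<close> coefficients.\<close>
  have A0: "A 0 = 1" "Bt 0 = 0"
    using lims(6,7)[of 0] LIMSEQ_unique[OF _ tendsto_const] by (auto simp: F1_def F2_def)
  define al be where "al z = A (inverse z)" and "be z = Bt (inverse z)" for z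
  have lim_al: "(\<lambda>n. S.al (s n) z) \<longlonglongrightarrow> al z" "(\<lambda>n. S.be (s n) z) \<longlonglongrightarrow> be z"
    if "1 / 2 < norm z" for z
  proof -
    have "norm (inverse z) < 2" "z \<noteq> 0"
      using less_imp_inverse_less[OF that] that by (auto simp: norm_inverse)
    then show "(\<lambda>n. S.al (s n) z) \<longlonglongrightarrow> al z" "(\<lambda>n. S.be (s n) z) \<longlonglongrightarrow> be z"
      using lims(6,7)[of "inverse z"] by (auto simp: F1_def F2_def al_def be_def)
  qed
  have lim_star: "(\<lambda>n. star (S.al (s n)) z) \<longlonglongrightarrow> star al z" "(\<lambda>n. star (S.be (s n)) z) \<longlonglongrightarrow> star be z"
    if "1 / 2 < norm z" for z
    using lim_al[of "cnj z"] that unfolding star_def by (auto intro!: tendsto_cnj)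
  have lim_B: "(\<lambda>n. blaschke (lam (s n)) (m (s n)) z) \<longlonglongrightarrow> exp (4 * \<i> / z)" if "1 / 2 < norm z" for z
    using LIMSEQ_subseq_LIMSEQ[OF Blim lims(1)] that by (simp add: o_def)
  have Enz: "E z \<noteq> 0" for z using E_star[of z] by auto
  have "limit_solution E al be f g (deriv A 0) (deriv Bt 0)"
  proof
    show "al holomorphic_on {z. norm z > 1 / 2}" "be holomorphic_on {z. norm z > 1 / 2}"
      unfolding al_def be_def by (intro inversion_holomorphic lims)+
    show "((\<lambda>z. z * (al z - 1)) \<longlongrightarrow> deriv A 0) at_infinity" "((\<lambda>z. z * be z) \<longlongrightarrow> deriv Bt 0) at_infinity"
      using inversion_holomorphic(2)[OF lims(2)] inversion_holomorphic(2)[OF lims(3)]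
      by (simp_all add: A0 al_def be_def)
    fix z :: complex assume z: "1 / 2 < norm z" "norm z < 2"
    have zP: "z \<notin> S.P n" for n using bd(1) z by simp
    have "(\<lambda>n. F3 (s n) z) \<longlonglongrightarrow> al z / E z + exp (4 * \<i> / z) * E z * star be z"
      unfolding F34(3)[OF zP] by (intro tendsto_intros lim_al lim_star lim_B z Enz)
    then show "f z = al z / E z + exp (4 * \<i> / z) * E z * star be z"
      using lims(8)[of z] z LIMSEQ_unique by simp
    have "(\<lambda>n. F4 (s n) z) \<longlonglongrightarrow> be z / E z - exp (4 * \<i> / z) * E z * star al z"
      unfolding F34(4)[OF zP] by (intro tendsto_intros lim_al lim_star lim_B z Enz)
    then show "g z = be z / E z - exp (4 * \<i> / z) * E z * star al z"
      using lims(9)[of z] z LIMSEQ_unique by simp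
  qed (use assms lims in auto)
  then show ?thesis by (rule that)
qed

text \<open>This fills in boundary values: it makes a solution that is only known off the circle
  continuous on the closed disc or the closed exterior, as the maximum principle requires.\<close>

lemma continuous_on_glue:
  fixes F G :: "complex \<Rightarrow> complex"
  assumes F: "continuous_on U F" "open U" and G: "continuous_on S G" "closed S" "U \<inter> S = {}"
    and lim: "\<And>z. z \<in> S \<Longrightarrow> (F \<longlongrightarrow> G z) (at z within U)"
  shows "continuous_on (U \<union> S) (\<lambda>z. if z \<in> S then G z else F z)"
proof -
  let ?H = "\<lambda>z. if z \<in> S then G z else F z"
  have "(?H \<longlongrightarrow> ?H z) (at z within U \<union> S)" if "z \<in> U \<union> S" for z
  proof (cases "z \<in> S")
    case True
    have "(?H \<longlongrightarrow> G z) (at z within U)"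
      using lim[OF True] by (rule Lim_transform_eventually)
        (use G(3) in \<open>auto simp: eventually_at_filter intro!: always_eventually\<close>)
    moreover have "(G \<longlongrightarrow> G z) (at z within S)" using G(1) True by (auto simp: continuous_on_def)
    then have "(?H \<longlongrightarrow> G z) (at z within S)"
      by (rule Lim_transform_eventually) (auto simp: eventually_at_filter)
    ultimately show ?thesis using True by (simp add: Lim_Un)
  next
    case False
    with that have z: "z \<in> U" by simp
    then have "(F \<longlongrightarrow> F z) (at z)"
      using F(1)[unfolded continuous_on_eq_continuous_at[OF F(2)]] by (simp add: isCont_def)
    moreover have "\<forall>\<^sub>F w in at z. F w = ?H w"
      using eventually_at_in_open'[OF F(2) z] by eventually_elim (use G(3) in auto)
    ultimately have "(?H \<longlongrightarrow> F z) (at z)" by (rule Lim_transform_eventually)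
    from tendsto_within_subset[OF this subset_UNIV, of "U \<union> S"] show ?thesis using False by simp
  qed
  then show ?thesis by (simp add: continuous_on_def)
qed

lemma ball_un_sphere: "ball (0::complex) 1 \<union> sphere 0 1 = cball 0 1"
  and ext_un_sphere: "(- cball (0::complex) 1) \<union> sphere 0 1 = {z. norm z \<ge> 1}"
  by auto

context limit_solution
begin

lemma E_nz [simp]: "E z \<noteq> 0"
  using E_star[of z] by auto

lemma star_E: "star E z = inverse (E z)"
  using E_star[of z] by (simp add: field_simps)

lemma E_hol_on: "E holomorphic_on S"
  using E_hol by (rule holomorphic_on_subset) simp

lemma E_cont_on: "continuous_on S E"
  using E_hol_on by (rule holomorphic_on_imp_continuous_on)

lemma cnj_annulus: "cnj ` {z. norm z > r} = {z. norm z > r}"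
  by (auto simp: in_image_cnj_iff)

lemma open_ext: "open {z::complex. norm z > r}"
  by (intro open_Collect_less continuous_intros)

lemma star_hol:
  "star al holomorphic_on {z. norm z > 1 / 2}" "star be holomorphic_on {z. norm z > 1 / 2}"
  "star f holomorphic_on ball 0 2" "star g holomorphic_on ball 0 2"
  by (rule holomorphic_on_star,
      use al_hol be_hol f_hol g_hol in \<open>simp_all only: cnj_annulus open_ext cnj_image_ball0 open_ball\<close>)+

lemma star_g_eq:
  assumes "1 / 2 < norm z" "norm z < 2"
  shows "star g z = star be z * E z - exp (- (4 * \<i> / z)) * inverse (E z) * al z"
proof -
  have "star g z = cnj (be (cnj z) / E (cnj z) - exp (4 * \<i> / cnj z) * E (cnj z) * star al (cnj z))"
    using g_eq[of "cnj z"] assms by (simp add: star_def)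
  also have "\<dots> = star be z / star E z - exp (- (4 * \<i> / z)) * star E z * al z"
    by (simp add: star_def exp_cnj)
  finally show ?thesis by (simp add: star_E divide_inverse)
qed

lemma star_f_eq:
  assumes "1 / 2 < norm z" "norm z < 2"
  shows "star f z = star al z * E z + exp (- (4 * \<i> / z)) * inverse (E z) * be z"
proof -
  have "star f z = cnj (al (cnj z) / E (cnj z) + exp (4 * \<i> / cnj z) * E (cnj z) * star be (cnj z))"
    using f_eq[of "cnj z"] assms by (simp add: star_def)
  also have "\<dots> = star al z / star E z + exp (- (4 * \<i> / z)) * star E z * be z"
    by (simp add: star_def exp_cnj)
  finally show ?thesis by (simp add: star_E divide_inverse)
qed

lemma al_lim: "(al \<longlongrightarrow> 1) at_infinity"
  using al_asymp by (rule tendsto_of_scaled)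

lemma star_be_asymp: "((\<lambda>z. z * star be z) \<longlongrightarrow> cnj b) at_infinity"
  using tendsto_star_infinity[OF be_asymp] by (simp add: star_def[abs_def])

lemma star_al_asymp: "((\<lambda>z. z * (star al z - 1)) \<longlongrightarrow> cnj a) at_infinity"
  using tendsto_star_infinity[OF al_asymp] by (simp add: star_def[abs_def])

text \<open>The first rows of the soliton matrix and of the limit are compared through the product
  with the inverse of the latter: the jump of its \<open>(1,2)\<close> entry across the unit circle is
  linear in the differences of the Blaschke product and its inverse from their limits. The
  solution itself enters only through the uniform bound \<open>al_be_bounds\<close>.\<close>

lemma stability:
  obtains C where "C > 0"
    "\<And>lam N. soliton E lam N \<Longrightarrow> (\<And>l. l \<in> {1..N} \<Longrightarrow> norm (lam l) \<le> 1 / 4) \<Longrightarrow> blaschke_gap lam N \<le> 1 \<Longrightarrow>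
       norm (soliton.be_coef E lam N - b) \<le> C * blaschke_gap lam N"
proof -
  have circ: "sphere (0::complex) 1 \<subseteq> {z. norm z > 1 / 2}" by auto
  obtain C1 where C1: "C1 \<ge> 1" "\<And>z. norm z = 1 \<Longrightarrow> norm ((E z)\<^sup>2) \<le> C1"
    by (rule bounded_on_sphere[of 1 "\<lambda>z. (E z)\<^sup>2"]) (auto intro!: continuous_intros E_cont_on)
  obtain C2 where C2: "C2 \<ge> 1" "\<And>z. norm z = 1 \<Longrightarrow> norm (inverse ((E z)\<^sup>2)) \<le> C2"
    by (rule bounded_on_sphere[of 1 "\<lambda>z. inverse ((E z)\<^sup>2)"]) (auto intro!: continuous_intros E_cont_on)
  obtain C3 where C3: "C3 \<ge> 1" "\<And>z. norm z = 1 \<Longrightarrow> norm (al z) \<le> C3"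
    by (rule bounded_on_sphere[of 1 al, OF holomorphic_on_imp_continuous_on[OF holomorphic_on_subset[OF al_hol circ]]]) blast
  obtain C4 where C4: "C4 \<ge> 1" "\<And>z. norm z = 1 \<Longrightarrow> norm (star be z) \<le> C4"
    by (rule bounded_on_sphere[of 1 "star be", OF holomorphic_on_imp_continuous_on[OF holomorphic_on_subset[OF star_hol(2) circ]]]) blast
  define K :: real where "K = exp (8 + 1)"
  have K: "K \<ge> 1" by (simp add: K_def)
  define Q R where "Q = max C3 C4" and "R = K + C1 + C2"
  have Q: "Q \<ge> 1" using C3 by (auto simp: Q_def)
  have R: "R \<ge> 1" using C1 C2 K by (simp add: R_def)
  \<comment> \<open>The inner 2 is half of four jump terms, the outer one comes from the circle
    estimate. \<open>K\<close> bounds the soliton entries and also multiplies the gap in the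
    estimate for \<open>B\<close>, \<open>Q\<close> bounds the limit entries, and \<open>R\<close>
    bounds the remaining factors.\<close>
  define C where "C = 2 * (2 * (K * Q * K * R))"
  have "C > 0" using K Q R by (simp add: C_def)
  moreover have "norm (soliton.be_coef E lam N - b) \<le> C * blaschke_gap lam N"
    if sol: "soliton E lam N" and small: "\<And>l. l \<in> {1..N} \<Longrightarrow> norm (lam l) \<le> 1 / 4"
      and gap: "blaschke_gap lam N \<le> 1" for lam N
  proof -
    interpret S: soliton E lam N by (rule sol)
    define G where "G = blaschke_gap lam N"
    have G: "G \<ge> 0" by (simp add: G_def blaschke_gap_nonneg)
    obtain F1 F2 where F: "F1 holomorphic_on UNIV" "F2 holomorphic_on UNIV"
      "\<And>z. F1 z * star F1 z + F2 z * star F2 z = 2"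
      "\<And>z. z \<notin> S.P \<Longrightarrow> F1 z = S.al z / E z + S.B z * E z * star S.be z"
      "\<And>z. z \<notin> S.P \<Longrightarrow> F2 z = S.be z / E z - S.B z * E z * star S.al z"
      using S.entire_pair by blast
    note bd = S.al_be_bounds[OF _ small gap, folded K_def]
    have sF2: "star F2 z = star S.be z * E z - inverse (S.B z) * inverse (E z) * S.al z" if "z \<notin> S.P" for z
    proof -
      have "star F2 z = cnj (S.be (cnj z) / E (cnj z) - S.B (cnj z) * E (cnj z) * star S.al (cnj z))"
        using F(5)[of "cnj z"] that S.cnj_P[of z] by (simp add: star_def)
      also have "\<dots> = star S.be z / star E z - star S.B z * star E z * S.al z" by (simp add: star_def)
      finally show ?thesis by (simp add: star_E S.star_B divide_inverse)
    qed
    have ext: "{z. norm z > 1 / 2} \<subseteq> - S.P" using bd(1) by auto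
    \<comment> \<open>The \<open>(1,2)\<close> entry of the comparison matrix outside the circle;
      \<open>h\<close> is its counterpart inside. If the Blaschke product were equal to
      \<open>exp (4 i / z)\<close>, the two would agree on the circle, by the same cancellation as
      in the uniqueness proof for rows.\<close>
    define p where "p z = S.al z * star be z - star S.be z * al z" for z
    define h where "h z = (F1 z * star g z - star F2 z * f z) / 2" for z
    have p: "p holomorphic_on {z. norm z > 1 / 2}" unfolding p_def
      by (intro holomorphic_intros star_hol al_hol holomorphic_on_subset[OF _ ext] S.holomorphic_P)
    have h: "h holomorphic_on ball 0 2" unfolding h_def
      by (intro holomorphic_intros star_hol f_hol holomorphic_on_subset[OF F(1)]
          holomorphic_on_subset[OF holomorphic_on_star_UNIV[OF F(2)]]) auto
    have gap_circle: "norm (p z - h z) \<le> 2 * (K * Q * K * R) * G" if z: "norm z = 1" for z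
    proof -
      have z': "norm z \<ge> 1 / 2" "1 / 2 < norm z" "norm z < 2" using z by auto
      have zP: "z \<notin> S.P" by (rule bd(1)[OF z'(1)])
      define B0 where "B0 = exp (4 * \<i> / z)"
      have iB0: "exp (- (4 * \<i> / z)) = inverse B0" by (simp add: B0_def exp_minus)
      have nz: "S.B z \<noteq> 0" "B0 \<noteq> 0" using S.blaschke_nz[OF zP] by (auto simp: B0_def)
      note cl = blaschke_close[OF z'(1) small gap, folded K_def B0_def, folded G_def, unfolded iB0]
      have n4: "norm (4 * \<i> / z) \<le> 8 + 1" using z by (simp add: norm_divide)
      have B0: "norm B0 \<le> K" "norm (inverse B0) \<le> K"
        unfolding B0_def K_def exp_minus[symmetric]
        using norm_exp[of "4 * \<i> / z"] norm_exp[of "- (4 * \<i> / z)"] n4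
        by (auto intro: order_trans simp del: norm_exp_eq_Re)
      have t: "norm (x * y * d * q) \<le> K * Q * (K * G) * R"
        if "norm x \<le> K" "norm y \<le> Q" "norm d \<le> K * G" "norm q \<le> R" for x y d q :: complex
        unfolding norm_mult
        by (intro mult_mono that mult_nonneg_nonneg) (use K Q R G in auto)
      have r: "norm B0 \<le> R" "norm (inverse B0) \<le> R" "norm ((E z)\<^sup>2) \<le> R" "norm (inverse ((E z)\<^sup>2)) \<le> R"
        using B0 C1(2)[OF z] C2(2)[OF z] C1(1) C2(1) K by (auto simp: R_def)
      have q: "norm (al z) \<le> Q" "norm (star be z) \<le> Q"
        using C3(2)[OF z] C4(2)[OF z] by (auto simp: Q_def)
      have d: "norm (S.B z - B0) \<le> K * G" "norm (B0 - S.B z) \<le> K * G"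
        "norm (inverse (S.B z) - inverse B0) \<le> K * G"
        using cl(2,3) by (simp_all add: norm_minus_commute)
      \<comment> \<open>All terms of the jump that do not contain a difference of the two
        \<open>B\<close> or of their inverses cancel.\<close>
      let ?t1 = "S.al z * star be z * (inverse (S.B z) - inverse B0) * B0"
      let ?t2 = "star S.be z * al z * (B0 - S.B z) * inverse B0"
      let ?t3 = "S.al z * al z * (inverse (S.B z) - inverse B0) * inverse ((E z)\<^sup>2)"
      let ?t4 = "star S.be z * star be z * (S.B z - B0) * (E z)\<^sup>2"
      have "h z - p z = (?t1 + ?t2 + ?t3 + ?t4) / 2"
        unfolding h_def p_def F(4)[OF zP] sF2[OF zP] star_g_eq[OF z'(2,3)] f_eq[OF z'(2,3)]
          B0_def[symmetric] iB0
        using nz by (simp add: field_simps power2_eq_square)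
      also have "norm \<dots> \<le> (K * Q * (K * G) * R + K * Q * (K * G) * R + K * Q * (K * G) * R + K * Q * (K * G) * R) / 2"
        unfolding norm_divide
      proof (simp only: norm_numeral, rule divide_right_mono)
        show "norm (?t1 + ?t2 + ?t3 + ?t4) \<le> K * Q * (K * G) * R + K * Q * (K * G) * R + K * Q * (K * G) * R + K * Q * (K * G) * R"
          by (intro norm_triangle_le add_mono t bd r q d z' order_refl)
      qed simp
      finally show ?thesis by (simp add: norm_minus_commute algebra_simps)
    qed
    have "((\<lambda>z. S.al z * (z * star be z) - (z * star S.be z) * al z) \<longlongrightarrow> 1 * cnj b - cnj S.be_coef * 1) at_infinity"
      by (intro tendsto_intros S.al_lim star_be_asymp al_lim)
        (use tendsto_star_infinity[OF S.be_asymp] in \<open>simp add: star_def[abs_def]\<close>)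
    then have plim: "((\<lambda>z. z * p z) \<longlongrightarrow> cnj (b - S.be_coef)) at_infinity"
      by (simp add: p_def algebra_simps)
    have "norm (cnj (b - S.be_coef)) \<le> 2 * (2 * (K * Q * K * R) * G)"
    proof (rule outer_inner_gap[OF _ _ plim _ _ gap_circle])
      show "p holomorphic_on {z. 1 < norm z}" by (rule holomorphic_on_subset[OF p]) auto
      show "continuous_on {z. 1 \<le> norm z} p"
        by (rule holomorphic_on_imp_continuous_on, rule holomorphic_on_subset[OF p]) auto
      show "h holomorphic_on ball 0 1" by (rule holomorphic_on_subset[OF h]) auto
      show "continuous_on (cball 0 1) h"
        by (rule holomorphic_on_imp_continuous_on, rule holomorphic_on_subset[OF h]) auto
    qed
    then show ?thesis
      by (simp only: complex_mod_cnj norm_minus_commute[of b] C_def G_def mult.assoc)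
  qed
  ultimately show ?thesis using that by blast
qed

end

section \<open>The matrix solution behind Psi_III and its uniqueness\<close>

locale limit_solution_III = limit_solution "phase_exp X T" al be f g a b
  for X T :: real and al be f g a b
begin

abbreviation E :: "complex \<Rightarrow> complex" where "E \<equiv> phase_exp X T"

definition W :: "complex \<Rightarrow> complex" where "W z = exp (\<i> * phase_III X T z)"

lemma W_nz: "W z \<noteq> 0" by (simp add: W_def)

text \<open>The summand \<open>2 / Z\<close> of the phase, doubled by squaring, is what becomes the
  limit of the Blaschke products.\<close>

lemma W_sq: "(W z)\<^sup>2 = (E z)\<^sup>2 * exp (4 * \<i> / z)"
  by (simp add: W_def phase_exp_def phase_III_def theta_def power2_eq_square divide_inverse
      algebra_simps flip: exp_add)

lemma jump_matrix:
  "exp_sigma3 (- \<i> * phase_III X T z) ** Q_III ** exp_sigma3 (\<i> * phase_III X T z) =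
    mat2 (1 / sqrt 2) (1 / (sqrt 2 * (W z)\<^sup>2)) (- ((W z)\<^sup>2 / sqrt 2)) (1 / sqrt 2)"
proof -
  have e: "exp (\<i> * phase_III X T z) = W z" "exp (- (\<i> * phase_III X T z)) = inverse (W z)"
    by (simp_all add: W_def exp_minus)
  show ?thesis
    by (rule mat2_eqI; simp add: matmul2_nth exp_sigma3_def Q_III_def e)
      (simp_all add: W_nz field_simps power2_eq_square)
qed

text \<open>The jump relation solved for the inner side: its first column is the outer combination
  \<open>(m1 - W^2 m2) / sqrt 2\<close>, and taking out \<open>E\<close> leaves the pair
  \<open>(f, g)\<close>. The second column comes from the reflected pair.\<close>

definition inner_sol :: "complex \<Rightarrow> complex^2^2" where
  "inner_sol z = mat2 (f z * E z / sqrt 2) (- star g z / (E z * sqrt 2))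
     (g z * E z / sqrt 2) (star f z / (E z * sqrt 2))"

definition outer_sol :: "complex \<Rightarrow> complex^2^2" where
  "outer_sol z = mat2 (al z) (- star be z) (be z) (star al z)"

definition sol_III :: "complex \<Rightarrow> complex^2^2" where
  "sol_III z = (if norm z < 1 then inner_sol z else outer_sol z)"

lemma inner_hol: "(\<lambda>z. inner_sol z $ i $ j) holomorphic_on ball 0 2"
proof -
  have "(\<lambda>z. inner_sol z $ 1 $ 1) holomorphic_on ball 0 2"
    "(\<lambda>z. inner_sol z $ 1 $ 2) holomorphic_on ball 0 2"
    "(\<lambda>z. inner_sol z $ 2 $ 1) holomorphic_on ball 0 2"
    "(\<lambda>z. inner_sol z $ 2 $ 2) holomorphic_on ball 0 2"
    unfolding inner_sol_def mat2_nth
    by (intro holomorphic_intros f_hol g_hol star_hol E_hol_on; simp)+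
  then show ?thesis using exhaust_2[of i] exhaust_2[of j] by auto
qed

lemma outer_hol: "(\<lambda>z. outer_sol z $ i $ j) holomorphic_on {z. norm z > 1 / 2}"
proof -
  have "(\<lambda>z. outer_sol z $ 1 $ 1) holomorphic_on {z. norm z > 1 / 2}"
    "(\<lambda>z. outer_sol z $ 1 $ 2) holomorphic_on {z. norm z > 1 / 2}"
    "(\<lambda>z. outer_sol z $ 2 $ 1) holomorphic_on {z. norm z > 1 / 2}"
    "(\<lambda>z. outer_sol z $ 2 $ 2) holomorphic_on {z. norm z > 1 / 2}"
    unfolding outer_sol_def mat2_nth
    by (intro holomorphic_intros al_hol be_hol star_hol)+
  then show ?thesis using exhaust_2[of i] exhaust_2[of j] by auto
qed

lemma continuous_on_mat:
  fixes F :: "complex \<Rightarrow> complex^2^2"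
  assumes "\<And>i j. (\<lambda>z. F z $ i $ j) holomorphic_on U" "S \<subseteq> U"
  shows "continuous_on S F"
  unfolding continuous_on_def
proof (intro ballI tendsto_mat)
  fix z i j assume "z \<in> S"
  then show "((\<lambda>z. F z $ i $ j) \<longlongrightarrow> F z $ i $ j) (at z within S)"
    using holomorphic_on_imp_continuous_on[OF holomorphic_on_subset[OF assms]]
    by (auto simp: continuous_on_def)
qed

lemma eventually_outer: "\<forall>\<^sub>F z in at_infinity. outer_sol z = sol_III z"
  unfolding eventually_at_infinity by (intro exI[of _ 1]) (auto simp: sol_III_def)

lemma sol_III_rhp: "rhp_III X T sol_III"
  unfolding rhp_III_def
proof (intro conjI exI ballI)
  have U: "{Z::complex. norm Z \<noteq> 1} = ball 0 1 \<union> {Z. norm Z > 1}" by auto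
  show "mat_holomorphic_on sol_III {Z. norm Z \<noteq> 1}"
    unfolding mat_holomorphic_on_def U
  proof (intro allI holomorphic_on_Un)
    fix i j :: 2
    have "(\<lambda>z. inner_sol z $ i $ j) holomorphic_on ball 0 1"
      by (rule holomorphic_on_subset[OF inner_hol]) auto
    then show "(\<lambda>z. sol_III z $ i $ j) holomorphic_on ball 0 1"
      by (rule holomorphic_transform) (auto simp: sol_III_def)
    have "(\<lambda>z. outer_sol z $ i $ j) holomorphic_on {z. norm z > 1}"
      by (rule holomorphic_on_subset[OF outer_hol]) auto
    then show "(\<lambda>z. sol_III z $ i $ j) holomorphic_on {z. norm z > 1}"
      by (rule holomorphic_transform) (auto simp: sol_III_def)
  qed (auto simp: open_ext)
  show "normalized_at_infinity sol_III"
  proof (rule normalized_at_infinityI)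
    fix i j :: 2
    have "((\<lambda>z. z * (- star be z)) \<longlongrightarrow> - cnj b) at_infinity"
      using tendsto_minus[OF star_be_asymp] by simp
    then have "\<exists>L. ((\<lambda>z. z * (outer_sol z $ i $ j - mat 1 $ i $ j)) \<longlongrightarrow> L) at_infinity"
      using exhaust_2[of i] exhaust_2[of j] al_asymp be_asymp star_al_asymp by (auto simp: outer_sol_def)
    then obtain L where "((\<lambda>z. z * (outer_sol z $ i $ j - mat 1 $ i $ j)) \<longlongrightarrow> L) at_infinity" ..
    then have "((\<lambda>z. z * (sol_III z $ i $ j - mat 1 $ i $ j)) \<longlongrightarrow> L) at_infinity"
      by (rule Lim_transform_eventually) (use eventually_outer in \<open>eventually_elim, simp\<close>)
    then show "\<exists>L. ((\<lambda>z. z * (sol_III z $ i $ j - mat 1 $ i $ j)) \<longlongrightarrow> L) at_infinity" ..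
  qed
  have ci: "continuous_on (ball 0 2) inner_sol" by (rule continuous_on_mat[OF inner_hol]) simp
  have co: "continuous_on {z. norm z > 1 / 2} outer_sol" by (rule continuous_on_mat[OF outer_hol]) simp
  show "continuous_on (sphere 0 1) inner_sol" by (rule continuous_on_subset[OF ci]) auto
  show "continuous_on (sphere 0 1) outer_sol" by (rule continuous_on_subset[OF co]) auto
  fix Z :: complex assume "Z \<in> sphere 0 1"
  then have Z: "norm Z = 1" by simp
  \<comment> \<open>Both branches continue analytically across the circle, so one-sided limits are
    plain evaluations.\<close>
  have "(inner_sol \<longlongrightarrow> inner_sol Z) (at Z)"
    using ci Z by (simp add: continuous_on_eq_continuous_at isCont_def)
  then show "(sol_III \<longlongrightarrow> inner_sol Z) (at Z within ball 0 1)"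
    by (rule Lim_transform_eventually[OF tendsto_within_subset])
      (auto simp: eventually_at_filter sol_III_def)
  have "(outer_sol \<longlongrightarrow> outer_sol Z) (at Z)"
    using co[unfolded continuous_on_eq_continuous_at[OF open_ext]] Z by (simp add: isCont_def)
  then show "(sol_III \<longlongrightarrow> outer_sol Z) (at Z within - cball 0 1)"
    by (rule Lim_transform_eventually[OF tendsto_within_subset])
      (auto simp: eventually_at_filter sol_III_def)
  have Z': "1 / 2 < norm Z" "norm Z < 2" using Z by auto
  define B0 where "B0 = exp (4 * \<i> / Z)"
  have iB0: "exp (- (4 * \<i> / Z)) = inverse B0" and B0: "B0 \<noteq> 0" by (simp_all add: B0_def exp_minus)
  have s2: "complex_of_real (sqrt 2) \<noteq> 0" by simp
  have "inner_sol Z = outer_sol Z ** (exp_sigma3 (- \<i> * phase_III X T Z) ** Q_III ** exp_sigma3 (\<i> * phase_III X T Z))"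
    unfolding jump_matrix W_sq B0_def[symmetric] inner_sol_def outer_sol_def
      f_eq[OF Z'] g_eq[OF Z'] star_g_eq[OF Z'] star_f_eq[OF Z'] iB0 B0_def[symmetric]
    by (rule mat2_eqI) (use B0 s2 in \<open>simp_all add: matmul2_nth field_simps power2_eq_square\<close>)
  then show "inner_sol Z = outer_sol Z ** exp_sigma3 (- \<i> * phase_III X T Z) ** Q_III ** exp_sigma3 (\<i> * phase_III X T Z)"
    by (simp add: matrix_mul_assoc)
qed

lemma sol_III_12: "((\<lambda>z. z * sol_III z $ 1 $ 2) \<longlongrightarrow> - cnj b) at_infinity"
proof (rule Lim_transform_eventually)
  show "((\<lambda>z. z * outer_sol z $ 1 $ 2) \<longlongrightarrow> - cnj b) at_infinity"
    using tendsto_minus[OF star_be_asymp] by (simp add: outer_sol_def)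
qed (use eventually_outer in \<open>eventually_elim, simp\<close>)

text \<open>The comparison of the soliton case with Liouville's theorem replaced by the circle
  estimate with gap 0: the outer and the inner \<open>(1,2)\<close> entry of \<open>R\<close> times
  the inverse of the constructed solution agree on the circle.\<close>

lemma rhp_III_unique:
  fixes R :: "complex \<Rightarrow> complex^2^2"
  assumes R: "rhp_III X T R" and q: "((\<lambda>z. z * R z $ 1 $ 2) \<longlongrightarrow> q) at_infinity"
  shows "q = - cnj b"
proof -
  from R obtain Rp Rm where hol: "mat_holomorphic_on R {Z. norm Z \<noteq> 1}"
    and norm: "normalized_at_infinity R"
    and c: "continuous_on (sphere 0 1) Rp" "continuous_on (sphere 0 1) Rm"
    and lim: "\<And>Z. Z \<in> sphere 0 1 \<Longrightarrow> (R \<longlongrightarrow> Rp Z) (at Z within ball 0 1)"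
      "\<And>Z. Z \<in> sphere 0 1 \<Longrightarrow> (R \<longlongrightarrow> Rm Z) (at Z within - cball 0 1)"
    and jump: "\<And>Z. Z \<in> sphere 0 1 \<Longrightarrow> Rp Z = Rm Z ** exp_sigma3 (- \<i> * phase_III X T Z) ** Q_III ** exp_sigma3 (\<i> * phase_III X T Z)"
    unfolding rhp_III_def by blast
  \<comment> \<open>First-row entries with the boundary values filled in, from inside for
    \<open>u\<close> and from outside for \<open>v\<close>.\<close>
  define u v where "u j z = (if z \<in> sphere 0 1 then Rp z $ 1 $ j else R z $ 1 $ j)"
    and "v j z = (if z \<in> sphere 0 1 then Rm z $ 1 $ j else R z $ 1 $ j)" for j z
  have Rhol: "(\<lambda>z. R z $ 1 $ j) holomorphic_on S" if "S \<subseteq> {Z. norm Z \<noteq> 1}" for j S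
    using hol holomorphic_on_subset[OF _ that] by (auto simp: mat_holomorphic_on_def)
  have u: "u j holomorphic_on ball 0 1" "continuous_on (cball 0 1) (u j)" for j
  proof -
    have r: "(\<lambda>z. R z $ 1 $ j) holomorphic_on ball 0 1" by (rule Rhol) auto
    then show "u j holomorphic_on ball 0 1"
      by (rule holomorphic_transform) (auto simp: u_def)
    show "continuous_on (cball 0 1) (u j)"
      unfolding ball_un_sphere[symmetric] u_def
      by (rule continuous_on_glue) (use holomorphic_on_imp_continuous_on[OF r] in
          \<open>auto intro!: tendsto_mat_entry lim continuous_intros c\<close>)
  qed
  have v: "v j holomorphic_on {z. norm z > 1}" "continuous_on {z. norm z \<ge> 1} (v j)" for j
  proof -
    have e: "{z::complex. norm z > 1} = - cball 0 1" by auto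
    have r: "(\<lambda>z. R z $ 1 $ j) holomorphic_on - cball 0 1" by (rule Rhol) auto
    then show "v j holomorphic_on {z. norm z > 1}"
      unfolding e by (rule holomorphic_transform) (auto simp: v_def)
    show "continuous_on {z. norm z \<ge> 1} (v j)"
      unfolding ext_un_sphere[symmetric] v_def
      by (rule continuous_on_glue) (use holomorphic_on_imp_continuous_on[OF r] in
          \<open>auto intro!: tendsto_mat_entry lim continuous_intros c open_Compl\<close>)
  qed
  \<comment> \<open>The first row times the second column of the adjugate of the outer solution, and
    in \<open>h\<close> of the inner one.\<close>
  define p where "p z = v 1 z * star be z + v 2 z * al z" for z
  define h where "h z = (u 1 z * star g z * inverse (E z) + u 2 z * E z * f z) / sqrt 2" for z
  have p: "p holomorphic_on {z. norm z > 1}" "continuous_on {z. norm z \<ge> 1} p"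
    unfolding p_def
    by (intro holomorphic_intros continuous_intros v
        holomorphic_on_subset[OF al_hol] holomorphic_on_subset[OF star_hol(2)]
        holomorphic_on_imp_continuous_on[OF holomorphic_on_subset[OF al_hol]]
        holomorphic_on_imp_continuous_on[OF holomorphic_on_subset[OF star_hol(2)]]; auto)+
  have h: "h holomorphic_on ball 0 1" "continuous_on (cball 0 1) h"
    unfolding h_def
    by (intro holomorphic_intros continuous_intros u E_hol_on E_cont_on
        holomorphic_on_subset[OF f_hol] holomorphic_on_subset[OF star_hol(4)]
        holomorphic_on_imp_continuous_on[OF holomorphic_on_subset[OF f_hol]]
        holomorphic_on_imp_continuous_on[OF holomorphic_on_subset[OF star_hol(4)]]; auto)+
  have eq: "p z = h z" if z: "norm z = 1" for z
  proof -
    have z': "z \<in> sphere 0 1" "1 / 2 < norm z" "norm z < 2" using z by auto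
    define B0 where "B0 = exp (4 * \<i> / z)"
    have iB0: "exp (- (4 * \<i> / z)) = inverse B0" and B0: "B0 \<noteq> 0" by (simp_all add: B0_def exp_minus)
    have "Rp z = Rm z ** (exp_sigma3 (- \<i> * phase_III X T z) ** Q_III ** exp_sigma3 (\<i> * phase_III X T z))"
      using jump[OF z'(1)] by (simp add: matrix_mul_assoc)
    then have j: "u 1 z = (v 1 z - v 2 z * ((E z)\<^sup>2 * B0)) / sqrt 2"
      "u 2 z = (v 1 z / ((E z)\<^sup>2 * B0) + v 2 z) / sqrt 2"
      unfolding jump_matrix W_sq B0_def[symmetric] using z
      by (simp_all add: u_def v_def matmul2_nth diff_divide_distrib add_divide_distrib mult.commute)
    have s2: "complex_of_real (sqrt 2) * complex_of_real (sqrt 2) = 2"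
      by (simp flip: of_real_mult)
    have "h z = ((v 1 z - v 2 z * ((E z)\<^sup>2 * B0)) * star g z * inverse (E z)
        + (v 1 z / ((E z)\<^sup>2 * B0) + v 2 z) * E z * f z) / (complex_of_real (sqrt 2) * complex_of_real (sqrt 2))"
      unfolding h_def j by (simp add: add_divide_distrib distrib_right mult.assoc)
    also have "\<dots> = p z"
      unfolding s2 p_def star_g_eq[OF z'(2,3)] f_eq[OF z'(2,3)] iB0 B0_def[symmetric]
      using B0 by (simp add: field_simps power2_eq_square)
    finally show ?thesis ..
  qed
  have R11: "((\<lambda>z. R z $ 1 $ 1) \<longlongrightarrow> 1) at_infinity"
    using normalized_at_infinity_entry[OF norm, of 1 1] by simp
  have ev: "\<forall>\<^sub>F z in at_infinity. z \<notin> sphere (0::complex) 1"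
    unfolding eventually_at_infinity by (intro exI[of _ 2]) auto
  have "((\<lambda>z. R z $ 1 $ 1 * (z * star be z) + (z * R z $ 1 $ 2) * al z) \<longlongrightarrow> 1 * cnj b + q * 1) at_infinity"
    by (intro tendsto_intros R11 star_be_asymp q al_lim)
  then have "((\<lambda>z. z * p z) \<longlongrightarrow> 1 * cnj b + q * 1) at_infinity"
    by (rule Lim_transform_eventually) (use ev in \<open>eventually_elim, simp add: p_def v_def algebra_simps\<close>)
  then have "norm (1 * cnj b + q * 1) \<le> 2 * 0"
    by (rule outer_inner_gap[OF p _ h]) (simp add: eq)
  then have "cnj b + q = 0" by simp
  then show ?thesis by (rule minus_unique[symmetric])
qed

lemma Psi_III_eq: "Psi_III X T = - 2 * \<i> * cnj b"
  unfolding Psi_III_def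
proof (rule the_equality)
  show "\<exists>R. rhp_III X T R \<and> ((\<lambda>Z. 2 * \<i> * (Z * R Z $ 1 $ 2)) \<longlongrightarrow> - 2 * \<i> * cnj b) at_infinity"
    using tendsto_mult_left[OF sol_III_12, of "2 * \<i>"] sol_III_rhp by auto
  fix p assume "\<exists>R. rhp_III X T R \<and> ((\<lambda>Z. 2 * \<i> * (Z * R Z $ 1 $ 2)) \<longlongrightarrow> p) at_infinity"
  then obtain R :: "complex \<Rightarrow> complex^2^2" where M: "rhp_III X T R"
    "((\<lambda>z. 2 * \<i> * (z * R z $ 1 $ 2)) \<longlongrightarrow> p) at_infinity" by blast
  from tendsto_mult_left[OF M(2), of "1 / (2 * \<i>)"]
  have "((\<lambda>z. z * R z $ 1 $ 2) \<longlongrightarrow> p / (2 * \<i>)) at_infinity" by simp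
  from rhp_III_unique[OF M(1) this] show "p = - 2 * \<i> * cnj b" by (simp add: field_simps)
qed

end

text \<open>\<open>k\<close> is the spectral scale: \<open>z = k Z\<close>.\<close>

lemma psi_NIII_near_Psi_III:
  obtains C where "C > 0"
    "\<And>lam N k. k > 0 \<Longrightarrow> inj_on lam {1..N} \<Longrightarrow> (\<And>n. n \<in> {1..N} \<Longrightarrow> Im (lam n) > 0) \<Longrightarrow>
      (\<And>n. n \<in> {1..N} \<Longrightarrow> norm (lam n) \<le> k / 4) \<Longrightarrow> blaschke_gap (\<lambda>n. of_real (1 / k) * lam n) N \<le> 1 \<Longrightarrow>
      norm (of_real (1 / k) * psi_NIII N lam (X / k) (T / k\<^sup>2) - Psi_III X T)
        \<le> C * blaschke_gap (\<lambda>n. of_real (1 / k) * lam n) N"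
proof -
  have hol: "phase_exp X T holomorphic_on UNIV"
    unfolding phase_exp_def theta_def by (intro holomorphic_intros)
  obtain al be f g a b where "limit_solution (phase_exp X T) al be f g a b"
    using limit_solution_exists[OF hol star_phase_exp] .
  then interpret limit_solution_III X T al be f g a b by (simp add: limit_solution_III_def)
  obtain C where C: "C > 0"
    "\<And>lam N. soliton (phase_exp X T) lam N \<Longrightarrow> (\<And>l. l \<in> {1..N} \<Longrightarrow> norm (lam l) \<le> 1 / 4) \<Longrightarrow> blaschke_gap lam N \<le> 1 \<Longrightarrow>
       norm (soliton.be_coef (phase_exp X T) lam N - b) \<le> C * blaschke_gap lam N"
    using stability by blast
  have "norm (of_real (1 / k) * psi_NIII N lam (X / k) (T / k\<^sup>2) - Psi_III X T)
        \<le> 2 * C * blaschke_gap (\<lambda>n. of_real (1 / k) * lam n) N"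
    if k: "k > 0" and lam: "inj_on lam {1..N}" "\<And>n. n \<in> {1..N} \<Longrightarrow> Im (lam n) > 0"
      "\<And>n. n \<in> {1..N} \<Longrightarrow> norm (lam n) \<le> k / 4" and gap: "blaschke_gap (\<lambda>n. of_real (1 / k) * lam n) N \<le> 1"
    for lam N k
  proof -
    define lam' where "lam' n = of_real (1 / k) * lam n" for n
    have lam_eq: "lam = (\<lambda>n. of_real k * lam' n)" using k by (simp add: lam'_def)
    interpret S: nls_soliton "X / k" "T / k\<^sup>2" lam N using lam by unfold_locales
    have E: "(\<lambda>z. phase_exp (X / k) (T / k\<^sup>2) (of_real k * z)) = phase_exp X T"
      using k by (simp add: phase_exp_def theta_def fun_eq_iff power2_eq_square mult.assoc)
    interpret S': soliton "phase_exp X T" lam' N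
    proof
      show "inj_on lam' {1..N}"
      proof (rule inj_onI)
        fix m n assume mn: "m \<in> {1..N}" "n \<in> {1..N}" "lam' m = lam' n"
        then have "lam m = lam n" using k by (simp add: lam'_def)
        then show "m = n" using inj_onD[OF lam(1) _ mn(1,2)] by blast
      qed
      show "Im (lam' n) > 0" if "n \<in> {1..N}" for n
        using lam(2)[OF that] k by (simp add: lam'_def)
    qed (use hol star_phase_exp in auto)
    \<comment> \<open>The Darboux vectors are unchanged by the dilation, and the amplitude is linear
      in the poles once the vectors are fixed.\<close>
    have "S.be_coef = of_real k * S'.be_coef"
    proof -
      have "dvec (phase_exp (X / k) (T / k\<^sup>2)) lam j = dvec (phase_exp X T) lam' j" for j
        unfolding lam_eq using dvec_scale[of k "phase_exp (X / k) (T / k\<^sup>2)" lam' j] k E by simp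
      moreover have "lam j = of_real k * lam' j" for j by (simp add: lam_eq)
      ultimately show ?thesis
        unfolding S.be_coef_def S'.be_coef_def sum_distrib_left
        by (intro sum.cong) (simp_all add: algebra_simps)
    qed
    then have "of_real (1 / k) * psi_NIII N lam (X / k) (T / k\<^sup>2) - Psi_III X T = - 2 * \<i> * cnj (S'.be_coef - b)"
      using k by (simp add: S.psi_NIII_eq Psi_III_eq algebra_simps)
    then have "norm (of_real (1 / k) * psi_NIII N lam (X / k) (T / k\<^sup>2) - Psi_III X T) = 2 * norm (S'.be_coef - b)"
      by (simp only: norm_mult complex_mod_cnj) simp
    moreover have "norm (S'.be_coef - b) \<le> C * blaschke_gap lam' N"
    proof (rule C(2)[OF S'.soliton_axioms])
      show "norm (lam' l) \<le> 1 / 4" if "l \<in> {1..N}" for l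
        using lam(3)[OF that] k by (simp add: lam'_def norm_mult norm_divide field_simps)
      show "blaschke_gap lam' N \<le> 1" using gap by (simp add: lam'_def[abs_def])
    qed
    ultimately show ?thesis by (simp add: lam'_def[abs_def])
  qed
  then show ?thesis using that[of "2 * C"] C(1) by simp
qed

text \<open>An expectation needs a bound without smallness assumptions. A gap of at most 1 already
  forces every rescaled pole into \<open>|z| \<le> 1/4\<close>, since one square is at most the
  whole sum. For a larger gap the amplitude bound suffices, because the rescaled sum of imaginary
  parts differs from 2 by at most a quarter of the gap.\<close>

lemma psi_NIII_error_le_gap:
  obtains C where "C > 0"
    "\<And>lam N k. k > 0 \<Longrightarrow> inj_on lam {1..N} \<Longrightarrow> (\<And>n. n \<in> {1..N} \<Longrightarrow> Im (lam n) > 0) \<Longrightarrow>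
      norm (of_real (1 / k) * psi_NIII N lam (X / k) (T / k\<^sup>2) - Psi_III X T)
        \<le> C * blaschke_gap (\<lambda>n. of_real (1 / k) * lam n) N"
proof -
  obtain C where C: "C > 0"
    "\<And>lam N k. k > 0 \<Longrightarrow> inj_on lam {1..N} \<Longrightarrow> (\<And>n. n \<in> {1..N} \<Longrightarrow> Im (lam n) > 0) \<Longrightarrow>
      (\<And>n. n \<in> {1..N} \<Longrightarrow> norm (lam n) \<le> k / 4) \<Longrightarrow> blaschke_gap (\<lambda>n. of_real (1 / k) * lam n) N \<le> 1 \<Longrightarrow>
      norm (of_real (1 / k) * psi_NIII N lam (X / k) (T / k\<^sup>2) - Psi_III X T)
        \<le> C * blaschke_gap (\<lambda>n. of_real (1 / k) * lam n) N"
    using psi_NIII_near_Psi_III[of X T] by blast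
  \<comment> \<open>In the large-gap case the error is at most
    \<open>4 + G + norm (Psi_III X T)\<close>, and \<open>G > 1\<close> allows the constants to be
    multiplied by \<open>G\<close>; thus \<open>5 = 4 + 1\<close>.\<close>
  define C' where "C' = C + 5 + norm (Psi_III X T)"
  have "C' > 0" using C(1) by (simp add: C'_def add_pos_nonneg)
  moreover have "norm (of_real (1 / k) * psi_NIII N lam (X / k) (T / k\<^sup>2) - Psi_III X T)
        \<le> C' * blaschke_gap (\<lambda>n. of_real (1 / k) * lam n) N"
    if k: "k > 0" and lam: "inj_on lam {1..N}" "\<And>n. n \<in> {1..N} \<Longrightarrow> Im (lam n) > 0" for lam N k
  proof -
    define G where "G = blaschke_gap (\<lambda>n. of_real (1 / k) * lam n) N"
    define Q where "Q = (\<Sum>n\<in>{1..N}. (norm (of_real (1 / k) * lam n))\<^sup>2)"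
    define S where "S = (\<Sum>n\<in>{1..N}. Im (of_real (1 / k) * lam n))"
    have Q: "Q \<ge> 0" by (simp add: Q_def sum_nonneg)
    have G: "G = 16 * Q + 4 * \<bar>S - 2\<bar>" by (simp add: G_def blaschke_gap_def Q_def S_def)
    show ?thesis
    proof (cases "G \<le> 1")
      case True
      have "16 * Q \<le> G" unfolding G by simp
      with True have Q1: "Q \<le> 1 / 16" by simp
      have "norm (lam n) \<le> k / 4" if n: "n \<in> {1..N}" for n
      proof -
        have "(norm (of_real (1 / k) * lam n))\<^sup>2 \<le> Q"
          unfolding Q_def by (rule member_le_sum[OF n]) auto
        also have "\<dots> \<le> (1 / 4)\<^sup>2" using Q1 by (simp add: power2_eq_square)
        finally have "norm (of_real (1 / k) * lam n) \<le> 1 / 4" by (rule power2_le_imp_le) simp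
        then show ?thesis using k by (simp add: norm_mult norm_divide field_simps)
      qed
      then have "norm (of_real (1 / k) * psi_NIII N lam (X / k) (T / k\<^sup>2) - Psi_III X T) \<le> C * G"
        using C(2)[OF k lam] True by (simp add: G_def)
      also have "\<dots> \<le> C' * G" using Q G by (intro mult_right_mono) (auto simp: C'_def)
      finally show ?thesis by (simp add: G_def)
    next
      case False
      interpret nls_soliton "X / k" "T / k\<^sup>2" lam N using lam by unfold_locales
      have "norm (of_real (1 / k) * psi_NIII N lam (X / k) (T / k\<^sup>2) - Psi_III X T)
        \<le> (1 / k) * norm (psi_NIII N lam (X / k) (T / k\<^sup>2)) + norm (Psi_III X T)"
        using k norm_triangle_ineq4[of "of_real (1 / k) * psi_NIII N lam (X / k) (T / k\<^sup>2)" "Psi_III X T"]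
        by (simp add: norm_mult norm_divide)
      also have "\<dots> \<le> (1 / k) * (2 * (\<Sum>n\<in>{1..N}. Im (lam n))) + norm (Psi_III X T)"
        using k by (intro add_right_mono mult_left_mono norm_psi_NIII_le) auto
      also have "(1 / k) * (2 * (\<Sum>n\<in>{1..N}. Im (lam n))) = 2 * S"
        by (simp add: S_def sum_divide_distrib[symmetric])
      also have "2 * S \<le> 4 + 4 * \<bar>S - 2\<bar>" by (simp add: abs_if)
      also have "4 + 4 * \<bar>S - 2\<bar> \<le> 4 + G" unfolding G using Q by simp
      also have "4 + G + norm (Psi_III X T) \<le> (5 + norm (Psi_III X T)) * G"
        using False mult_left_mono[of 1 G "norm (Psi_III X T)"] by (simp add: distrib_right)
      also have "\<dots> \<le> C' * G" using Q G C(1) by (intro mult_right_mono) (auto simp: C'_def)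
      finally show ?thesis by (simp add: G_def)
    qed
  qed
  ultimately show ?thesis by (rule that)
qed

section \<open>Random data\<close>

text \<open>A discrete layer-cake argument: the odd numbers \<open>2 n + 1\<close> with
  \<open>n < k\<close> sum to \<open>k^2\<close>, so with \<open>k\<close> the ceiling of
  \<open>|x|\<close> the square is dominated by a series of tail indicators, and the tails decay
  geometrically.\<close>

lemma sub_exponential_square_integrable:
  assumes D: "real_distribution D" "sub_exponential_law D"
  shows "integrable D (\<lambda>x. x\<^sup>2)"
proof -
  interpret real_distribution D by (rule D)
  obtain K where K: "K > 0" "\<And>t. t \<ge> 0 \<Longrightarrow> measure D {x \<in> space D. \<bar>x\<bar> > t} \<le> 2 * exp (- t / K)"
    using D(2) by (auto simp: sub_exponential_def)
  define r where "r = exp (- 1 / K)"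
  have r: "0 \<le> r" "r < 1" using K by (simp_all add: r_def)
  have er: "exp (- (real n / K)) = r ^ n" for n
    by (simp add: r_def exp_of_nat_mult[symmetric])
  let ?A = "\<lambda>n::nat. {x. \<bar>x\<bar> > real n}"
  have pw: "ennreal (x\<^sup>2) \<le> (\<Sum>n. ennreal (real (2 * n + 1)) * indicator (?A n) x)" for x :: real
  proof -
    define k where "k = nat \<lceil>\<bar>x\<bar>\<rceil>"
    have xk: "\<bar>x\<bar> \<le> real k" unfolding k_def by linarith
    have kx: "n < k \<Longrightarrow> real n < \<bar>x\<bar>" for n unfolding k_def by linarith
    have "x\<^sup>2 \<le> (real k)\<^sup>2" using xk by (metis abs_ge_zero power2_abs power_mono)
    also have "(real k)\<^sup>2 = (\<Sum>n<k. real (2 * n + 1))"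
      by (induction k) (auto simp: power2_eq_square algebra_simps)
    finally have "ennreal (x\<^sup>2) \<le> ennreal (\<Sum>n<k. real (2 * n + 1))" by (rule ennreal_leI)
    also have "\<dots> = (\<Sum>n<k. ennreal (real (2 * n + 1)))" by (rule sum_ennreal[symmetric]) simp
    also have "\<dots> = (\<Sum>n<k. ennreal (real (2 * n + 1)) * indicator (?A n) x)"
      by (rule sum.cong) (use kx in auto)
    also have "\<dots> \<le> (\<Sum>n. ennreal (real (2 * n + 1)) * indicator (?A n) x)"
      by (rule sum_le_suminf) auto
    finally show ?thesis .
  qed
  have "(\<integral>\<^sup>+x. ennreal (norm (x\<^sup>2)) \<partial>D) \<le> (\<integral>\<^sup>+x. (\<Sum>n. ennreal (real (2 * n + 1)) * indicator (?A n) x) \<partial>D)"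
    using pw by (intro nn_integral_mono) simp
  also have "\<dots> = (\<Sum>n. \<integral>\<^sup>+x. ennreal (real (2 * n + 1)) * indicator (?A n) x \<partial>D)"
    by (rule nn_integral_suminf) auto
  also have "\<dots> = (\<Sum>n. ennreal (real (2 * n + 1)) * emeasure D (?A n))"
    by (subst nn_integral_cmult_indicator) auto
  also have "\<dots> \<le> (\<Sum>n. ennreal (4 * (of_nat (Suc n) * r ^ n)))"
  proof (rule suminf_le)
    fix n
    have "emeasure D (?A n) \<le> ennreal (2 * r ^ n)"
      using K(2)[of "real n"] by (simp add: emeasure_eq_measure er ennreal_leI)
    then have "ennreal (real (2 * n + 1)) * emeasure D (?A n) \<le> ennreal (real (2 * n + 1)) * ennreal (2 * r ^ n)"
      by (rule mult_left_mono) simp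
    also have "\<dots> = ennreal (real (2 * n + 1) * (2 * r ^ n))" by (simp add: ennreal_mult' r)
    also have "\<dots> \<le> ennreal (4 * (of_nat (Suc n) * r ^ n))"
    proof (rule ennreal_leI)
      \<comment> \<open>Rounding \<open>2 n + 1\<close> up to \<open>2 (n + 1)\<close> produces the
        differentiated geometric series.\<close>
      have "real (2 * n + 1) * (2 * r ^ n) \<le> (2 * real (Suc n)) * (2 * r ^ n)"
        by (rule mult_right_mono) (use r in auto)
      then show "real (2 * n + 1) * (2 * r ^ n) \<le> 4 * (of_nat (Suc n) * r ^ n)" by (simp add: algebra_simps)
    qed
    finally show "ennreal (real (2 * n + 1)) * emeasure D (?A n) \<le> ennreal (4 * (of_nat (Suc n) * r ^ n))" .
  qed auto
  also have "\<dots> < top"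
  proof -
    have "summable (\<lambda>n. 4 * (of_nat (Suc n) * r ^ n))"
      using geometric_deriv_sums[of r] r by (intro summable_mult) (auto simp: sums_iff)
    then have "(\<Sum>n. ennreal (4 * (of_nat (Suc n) * r ^ n))) \<noteq> top"
      by (rule ennreal_suminf_neq_top) (use r in auto)
    then show ?thesis by (simp add: less_top)
  qed
  finally show ?thesis by (intro integrableI_bounded) auto
qed

lemma (in finite_measure) integrable_of_square:
  fixes f :: "'a \<Rightarrow> real"
  assumes "integrable M (\<lambda>x. (f x)\<^sup>2)" "f \<in> borel_measurable M"
  shows "integrable M f"
proof (rule Bochner_Integration.integrable_bound)
  show "integrable M (\<lambda>x. 1 + (f x)\<^sup>2)" using assms by auto
  have "\<bar>y\<bar> \<le> 1 + y\<^sup>2" for y :: real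
  proof -
    have "0 \<le> (\<bar>y\<bar> - 1)\<^sup>2" by simp
    then show ?thesis by (simp add: power2_diff)
  qed
  then show "AE x in M. norm (f x) \<le> norm (1 + (f x)\<^sup>2)" by (auto intro!: always_eventually)
qed (fact assms)

lemma (in prob_space) centered_sum_second_moment:
  fixes Y :: "nat \<Rightarrow> 'a \<Rightarrow> real" and V :: real
  assumes sq: "\<And>i. i \<in> I \<Longrightarrow> integrable M (\<lambda>x. (Y i x)\<^sup>2)" "\<And>i. i \<in> I \<Longrightarrow> expectation (\<lambda>x. (Y i x)\<^sup>2) = V"
    and orth: "\<And>i j. i \<in> I \<Longrightarrow> j \<in> I \<Longrightarrow> i \<noteq> j \<Longrightarrow> integrable M (\<lambda>x. Y i x * Y j x)"
      "\<And>i j. i \<in> I \<Longrightarrow> j \<in> I \<Longrightarrow> i \<noteq> j \<Longrightarrow> expectation (\<lambda>x. Y i x * Y j x) = 0"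
    and fin: "finite I"
  shows "integrable M (\<lambda>x. (\<Sum>i\<in>I. Y i x)\<^sup>2)" "expectation (\<lambda>x. (\<Sum>i\<in>I. Y i x)\<^sup>2) = card I * V"
proof -
  have eq: "(\<Sum>i\<in>I. Y i x)\<^sup>2 = (\<Sum>i\<in>I. \<Sum>j\<in>I. Y i x * Y j x)" for x
    by (simp add: power2_eq_square sum_product)
  have int: "integrable M (\<lambda>x. Y i x * Y j x)" if "i \<in> I" "j \<in> I" for i j
    using sq(1)[of i] orth(1)[of i j] that by (cases "i = j") (auto simp: power2_eq_square)
  show "integrable M (\<lambda>x. (\<Sum>i\<in>I. Y i x)\<^sup>2)" unfolding eq by (intro Bochner_Integration.integrable_sum int)
  have "expectation (\<lambda>x. (\<Sum>i\<in>I. Y i x)\<^sup>2) = (\<Sum>i\<in>I. \<Sum>j\<in>I. expectation (\<lambda>x. Y i x * Y j x))"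
    unfolding eq using int by (simp add: Bochner_Integration.integral_sum Bochner_Integration.integrable_sum)
  also have "\<dots> = (\<Sum>i\<in>I. \<Sum>j\<in>I. if i = j then V else 0)"
    using sq(2) orth(2) by (intro sum.cong) (auto simp: power2_eq_square)
  also have "\<dots> = card I * V" using fin by simp
  finally show "expectation (\<lambda>x. (\<Sum>i\<in>I. Y i x)\<^sup>2) = card I * V" .
qed

lemma borel_measurable_cnj:
  assumes "f \<in> borel_measurable M"
  shows "(\<lambda>x. cnj (f x)) \<in> borel_measurable M"
  by (rule borel_measurable_continuous_on[OF _ assms]) (intro continuous_intros)

text \<open>The spectral point and the initial vector are random too, because each Darboux vector
  evaluates the previous dressing at the next random pole; hence the generalization in the
  induction.\<close>

lemma dress_measurable:
  fixes lam :: "'a \<Rightarrow> nat \<Rightarrow> complex"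
  assumes E: "continuous_on UNIV E"
    and lam: "\<And>n. n \<ge> 1 \<Longrightarrow> (\<lambda>\<omega>. lam \<omega> n) \<in> borel_measurable M"
    and "z \<in> borel_measurable M" "p \<in> borel_measurable M" "q \<in> borel_measurable M"
  shows "(\<lambda>\<omega>. fst (dress E (lam \<omega>) k (z \<omega>) (p \<omega>, q \<omega>))) \<in> borel_measurable M \<and>
    (\<lambda>\<omega>. snd (dress E (lam \<omega>) k (z \<omega>) (p \<omega>, q \<omega>))) \<in> borel_measurable M"
  using assms(3-)
proof (induction k arbitrary: z p q)
  case (Suc k)
  have l: "(\<lambda>\<omega>. lam \<omega> (Suc k)) \<in> borel_measurable M" by (rule lam) simp
  have El: "(\<lambda>\<omega>. E (lam \<omega> (Suc k))) \<in> borel_measurable M"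
    by (rule borel_measurable_continuous_on[OF E l])
  define w1 w2 where "w1 \<omega> = fst (dvec E (lam \<omega>) k)" and "w2 \<omega> = snd (dvec E (lam \<omega>) k)" for \<omega>
  have w: "w1 \<in> borel_measurable M" "w2 \<in> borel_measurable M"
    unfolding w1_def w2_def dvec_def
    using Suc.IH[OF l, of "\<lambda>\<omega>. inverse (E (lam \<omega> (Suc k)))" "\<lambda>\<omega>. - E (lam \<omega> (Suc k))"] El
    by auto
  define d1 d2 where "d1 \<omega> = fst (dress E (lam \<omega>) k (z \<omega>) (p \<omega>, q \<omega>))"
    and "d2 \<omega> = snd (dress E (lam \<omega>) k (z \<omega>) (p \<omega>, q \<omega>))" for \<omega>
  have d: "d1 \<in> borel_measurable M" "d2 \<in> borel_measurable M"
    unfolding d1_def d2_def using Suc.IH[OF Suc.prems] by auto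
  note m = l w d Suc.prems borel_measurable_cnj[OF l] borel_measurable_cnj[OF w(1)] borel_measurable_cnj[OF w(2)]
  show ?case
    unfolding dress_Suc darboux_def norm_sq_prod wedge_def perp_def fst_conv snd_conv
      w1_def[symmetric] w2_def[symmetric] d1_def[symmetric] d2_def[symmetric]
    by (intro conjI borel_measurable_add borel_measurable_times borel_measurable_divide
        borel_measurable_diff borel_measurable_uminus m)
qed auto

text \<open>A definite description gives no measurability by itself. On the measurable set of
  admissible data the amplitude is an explicit expression in the Darboux vectors, and elsewhere the
  soliton has its default value 0.\<close>

lemma psi_NIII_measurable:
  fixes lam :: "'a \<Rightarrow> nat \<Rightarrow> complex"
  assumes lam: "\<And>n. n \<ge> 1 \<Longrightarrow> (\<lambda>\<omega>. lam \<omega> n) \<in> borel_measurable M"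
  shows "(\<lambda>\<omega>. psi_NIII N (lam \<omega>) x t) \<in> borel_measurable M"
proof -
  have E: "continuous_on UNIV (phase_exp x t)"
    unfolding phase_exp_def theta_def by (intro continuous_intros)
  define good where "good \<omega> \<longleftrightarrow> (\<forall>i\<in>{1..N}. \<forall>j\<in>{1..N}. i \<noteq> j \<longrightarrow> lam \<omega> i - lam \<omega> j \<noteq> 0) \<and> (\<forall>i\<in>{1..N}. 0 < Im (lam \<omega> i))" for \<omega>
  have good_iff: "good \<omega> \<longleftrightarrow> inj_on (lam \<omega>) {1..N} \<and> (\<forall>n\<in>{1..N}. Im (lam \<omega> n) > 0)" for \<omega>
  proof -
    have "(\<forall>i\<in>A. \<forall>j\<in>A. i \<noteq> j \<longrightarrow> h i - h j \<noteq> 0) \<longleftrightarrow> inj_on h A" for A and h :: "nat \<Rightarrow> complex"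
      unfolding inj_on_def by auto
    then show ?thesis unfolding good_def by simp
  qed
  define w1 w2 where "w1 j \<omega> = fst (dvec (phase_exp x t) (lam \<omega>) j)"
    and "w2 j \<omega> = snd (dvec (phase_exp x t) (lam \<omega>) j)" for j \<omega>
  define F where "F \<omega> = (\<Sum>j<N. (lam \<omega> (Suc j) - cnj (lam \<omega> (Suc j))) *
     (- w2 j \<omega> * cnj (w1 j \<omega>) / (w1 j \<omega> * cnj (w1 j \<omega>) + w2 j \<omega> * cnj (w2 j \<omega>))))" for \<omega>
  have eq: "psi_NIII N (lam \<omega>) x t = (if good \<omega> then - 2 * \<i> * cnj (F \<omega>) else 0)" for \<omega>
  proof (cases "good \<omega>")
    case True
    then interpret nls_soliton x t "lam \<omega>" N
      unfolding good_iff by unfold_locales auto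
    have "be_coef = F \<omega>" unfolding be_coef_def F_def norm_sq_prod w1_def w2_def by simp
    then show ?thesis using True by (simp add: psi_NIII_eq)
  next
    case False
    then have "\<not> scattering_data N (lam \<omega>) (coeff_III N (lam \<omega>))"
      by (auto simp: scattering_data_def good_iff)
    then show ?thesis using False by (simp add: psi_NIII_def nsoliton_def)
  qed
  have l: "(\<lambda>\<omega>. lam \<omega> (Suc j)) \<in> borel_measurable M" for j by (rule lam) simp
  have w: "w1 j \<in> borel_measurable M" "w2 j \<in> borel_measurable M" for j
    unfolding w1_def w2_def dvec_def
    using dress_measurable[OF E lam l, where p = "\<lambda>\<omega>. inverse (phase_exp x t (lam \<omega> (Suc j)))"
        and q = "\<lambda>\<omega>. - phase_exp x t (lam \<omega> (Suc j))" and k = j]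
      borel_measurable_continuous_on[OF E l[of j]] by auto
  have F: "F \<in> borel_measurable M" unfolding F_def
    by (intro borel_measurable_sum borel_measurable_add borel_measurable_times borel_measurable_divide
        borel_measurable_diff borel_measurable_uminus borel_measurable_cnj w l)
  have "Measurable.pred M good" unfolding good_def
  proof (intro pred_intros_finite pred_intros_logic)
    fix i j assume ij: "i \<in> {1..N}" "j \<in> {1..N}"
    have "(\<lambda>\<omega>. lam \<omega> i - lam \<omega> j) \<in> borel_measurable M"
      using ij by (intro borel_measurable_diff lam) auto
    then show "Measurable.pred M (\<lambda>\<omega>. lam \<omega> i - lam \<omega> j = 0)" by measurable
  next
    fix i assume "i \<in> {1..N}"
    then have "(\<lambda>\<omega>. Im (lam \<omega> i)) \<in> borel_measurable M"
      by (intro borel_measurable_continuous_on[OF _ lam] continuous_intros) auto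
    then show "Measurable.pred M (\<lambda>\<omega>. 0 < Im (lam \<omega> i))" by measurable
  qed auto
  then show ?thesis unfolding eq
    by (intro measurable_If borel_measurable_times borel_measurable_cnj F) (auto simp: pred_def)
qed

text \<open>Young's inequality with a free weight. It replaces a first moment by a second one, and
  \<open>s = sqrt N\<close> later balances the two summands.\<close>

lemma abs_le_weighted_square:
  fixes y s :: real
  assumes "s > 0"
  shows "\<bar>y\<bar> \<le> (y\<^sup>2 / s + s) / 2"
proof -
  have "0 \<le> (\<bar>y\<bar> - s)\<^sup>2" by simp
  then have "2 * \<bar>y\<bar> * s \<le> y\<^sup>2 + s\<^sup>2" by (simp add: power2_diff)
  then show ?thesis using assms by (simp add: field_simps power2_eq_square)
qed

section \<open>Expectation of the error over the random spectral data\<close>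

theorem theorem2p4:
  fixes D1 D2 :: "real measure" and mu_D1 v_D2 :: real
    and M :: "'a measure" and mu v :: "nat \<Rightarrow> 'a \<Rightarrow> real"
    and lam :: "'a \<Rightarrow> nat \<Rightarrow> complex"
    and K :: "(real \<times> real) set"
  assumes D1: "real_distribution D1" "sub_exponential_law D1" "AE x in D1. x > 0"
    and mu_D1: "mu_D1 = (\<integral>x. x \<partial>D1)"
    and D2: "real_distribution D2" "sub_exponential_law D2"
    and v_D2: "v_D2 = (\<integral>x. x \<partial>D2)"
    and M: "prob_space M"
    and law_mu: "\<And>n. n \<ge> 1 \<Longrightarrow> distr M borel (mu n) = D1"
    and law_v: "\<And>n. n \<ge> 1 \<Longrightarrow> distr M borel (v n) = D2"
    and indep: "prob_space.indep_vars M (\<lambda>_. borel) (case_sum mu v) ({1..} <+> {1..})"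
    and lam: "\<And>\<omega> n. lam \<omega> n = Complex (v n \<omega>) (mu n \<omega>)"
    and distinct: "AE \<omega> in M. inj_on (lam \<omega>) {1..}"
    and K: "compact K"
  shows "(\<forall>(X, T)\<in>K. \<exists>N0>0. \<exists>C>0. \<exists>\<epsilon>>0. \<forall>N::nat. N > N0 \<longrightarrow>
            (let err = (\<lambda>\<omega>. norm (of_real (2 / (real N * mu_D1)) *
                         psi_NIII N (lam \<omega>) (2 * X / (real N * mu_D1))
                                           (4 * T / ((real N)\<^sup>2 * mu_D1\<^sup>2))
                         - Psi_III X T))
             in integrable M err \<and> (\<integral>\<omega>. err \<omega> \<partial>M) \<le> C * real N powr (- \<epsilon>)))
       \<and> (AE \<omega> in M. \<forall>N\<ge>1.
            norm (psi_NIII N (lam \<omega>) 0 0) = 2 * (\<Sum>j\<in>{1..N}. mu j \<omega>) \<and>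
            extremal_soliton N (lam \<omega>) (coeff_III N (lam \<omega>)))"
proof -
  interpret prob_space M by (rule M)
  interpret D1: real_distribution D1 by (rule D1)
  define m where "m = mu_D1"
  have rv: "mu n \<in> borel_measurable M" "v n \<in> borel_measurable M" if "n \<ge> 1" for n
  proof -
    have "\<forall>i\<in>{1..} <+> {1..}. random_variable borel (case_sum mu v i)"
      using indep unfolding indep_vars_def2 by blast
    from this[rule_format, of "Inl n"] this[rule_format, of "Inr n"] that
    show "mu n \<in> borel_measurable M" "v n \<in> borel_measurable M" by auto
  qed
  have sq: "integrable D1 (\<lambda>x. x\<^sup>2)" "integrable D2 (\<lambda>x. x\<^sup>2)"
    using sub_exponential_square_integrable D1 D2 by auto
  have int1: "integrable D1 (\<lambda>x. x)" by (rule D1.integrable_of_square[OF sq(1)]) simp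
  have AE_pos: "AE \<omega> in M. mu n \<omega> > 0" if "n \<ge> 1" for n
  proof -
    have "AE x in distr M borel (mu n). 0 < x" unfolding law_mu[OF that] by (rule D1(3))
    then show ?thesis by (subst (asm) AE_distr_iff) (use rv[OF that] in auto)
  qed
  \<comment> \<open>A nonnegative function with integral 0 vanishes almost everywhere, against the
    positivity of the law.\<close>
  have m: "m > 0"
  proof -
    have nn: "AE x in D1. 0 \<le> x" using D1(3) by eventually_elim simp
    have "m \<ge> 0" unfolding m_def mu_D1 by (rule integral_nonneg_AE[OF nn])
    moreover have "m \<noteq> 0"
    proof
      assume "m = 0"
      then have "AE x in D1. x = 0"
        using integral_nonneg_eq_0_iff_AE[OF int1 nn] by (simp add: m_def mu_D1)
      with D1(3) have "AE x in D1. False" by eventually_elim simp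
      then show False by simp
    qed
    ultimately show ?thesis by simp
  qed
  \<comment> \<open>The common value of \<open>E |lam n|^2\<close>.\<close>
  define q where "q = (\<integral>x. x\<^sup>2 \<partial>D1) + (\<integral>x. x\<^sup>2 \<partial>D2)"
  have q0: "q \<ge> 0" by (simp add: q_def)
  have mom2: "integrable M (\<lambda>\<omega>. (mu n \<omega>)\<^sup>2)" "integrable M (\<lambda>\<omega>. (v n \<omega>)\<^sup>2)"
    "expectation (\<lambda>\<omega>. (v n \<omega>)\<^sup>2 + (mu n \<omega>)\<^sup>2) = q" if n: "n \<ge> 1" for n
  proof -
    show i: "integrable M (\<lambda>\<omega>. (mu n \<omega>)\<^sup>2)" "integrable M (\<lambda>\<omega>. (v n \<omega>)\<^sup>2)"
      using integrable_distr_eq[OF rv(1)[OF n], of "\<lambda>x. x\<^sup>2"] integrable_distr_eq[OF rv(2)[OF n], of "\<lambda>x. x\<^sup>2"]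
        sq law_mu[OF n] law_v[OF n] by auto
    have "expectation (\<lambda>\<omega>. (mu n \<omega>)\<^sup>2) = (\<integral>x. x\<^sup>2 \<partial>D1)"
      unfolding law_mu[OF n, symmetric] by (rule integral_distr[symmetric]) (use rv[OF n] in auto)
    moreover have "expectation (\<lambda>\<omega>. (v n \<omega>)\<^sup>2) = (\<integral>x. x\<^sup>2 \<partial>D2)"
      unfolding law_v[OF n, symmetric] by (rule integral_distr[symmetric]) (use rv[OF n] in auto)
    ultimately show "expectation (\<lambda>\<omega>. (v n \<omega>)\<^sup>2 + (mu n \<omega>)\<^sup>2) = q"
      using i by (simp add: q_def)
  qed
  define Y where "Y n \<omega> = mu n \<omega> - m" for n \<omega>
  define V where "V = (\<integral>x. (x - m)\<^sup>2 \<partial>D1)"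
  have V0: "V \<ge> 0" by (simp add: V_def)
  have int_mu: "integrable M (mu n)" if "n \<ge> 1" for n
    using integrable_of_square[OF mom2(1) rv(1)] that by blast
  have Y: "integrable M (Y n)" "expectation (Y n) = 0"
    "integrable M (\<lambda>\<omega>. (Y n \<omega>)\<^sup>2)" "expectation (\<lambda>\<omega>. (Y n \<omega>)\<^sup>2) = V" if n: "n \<ge> 1" for n
  proof -
    show "integrable M (Y n)" unfolding Y_def using int_mu[OF n] by simp
    have "expectation (mu n) = m"
      unfolding m_def mu_D1 law_mu[OF n, symmetric] by (rule integral_distr[symmetric]) (use rv[OF n] in auto)
    then show "expectation (Y n) = 0" unfolding Y_def using int_mu[OF n] by (simp add: prob_space)
    show "integrable M (\<lambda>\<omega>. (Y n \<omega>)\<^sup>2)"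
      unfolding Y_def power2_diff using mom2(1)[OF n] int_mu[OF n] by simp
    show "expectation (\<lambda>\<omega>. (Y n \<omega>)\<^sup>2) = V"
      unfolding V_def Y_def law_mu[OF n, symmetric] by (rule integral_distr[symmetric]) (use rv[OF n] in auto)
  qed
  have orth: "integrable M (\<lambda>\<omega>. Y i \<omega> * Y j \<omega>)" "expectation (\<lambda>\<omega>. Y i \<omega> * Y j \<omega>) = 0"
    if ij: "i \<ge> 1" "j \<ge> 1" "i \<noteq> j" for i j
  proof -
    let ?I = "{Inl i, Inl j} :: (nat + nat) set"
    have "indep_vars (\<lambda>_. borel) (case_sum mu v) ?I"
      by (rule indep_vars_subset[OF indep]) (use ij in auto)
    then have "indep_vars (\<lambda>_. borel) (\<lambda>k \<omega>. case_sum mu v k \<omega> - m) ?I"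
      by (rule indep_vars_compose2) simp
    then have ind: "indep_vars (\<lambda>_. borel) (case_sum Y Y) ?I"
      by (rule indep_vars_cong[THEN iffD1, rotated -1]) (auto simp: Y_def)
    have int: "integrable M (case_sum Y Y k)" if "k \<in> ?I" for k
      using that Y(1) ij by auto
    show "integrable M (\<lambda>\<omega>. Y i \<omega> * Y j \<omega>)"
      using indep_vars_integrable[OF _ ind int] ij by simp
    show "expectation (\<lambda>\<omega>. Y i \<omega> * Y j \<omega>) = 0"
      using indep_vars_lebesgue_integral[OF _ ind int] ij Y(2) by simp
  qed
  \<comment> \<open>A single null set for all \<open>N\<close>, as the extremality claim quantifies
    over \<open>N\<close> inside the almost sure statement.\<close>
  have good: "AE \<omega> in M. inj_on (lam \<omega>) {1..} \<and> (\<forall>n\<ge>1. Im (lam \<omega> n) > 0)"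
  proof -
    have "AE \<omega> in M. \<forall>n. n \<ge> 1 \<longrightarrow> mu n \<omega> > 0"
      using AE_pos by (subst AE_all_countable) auto
    with distinct show ?thesis by eventually_elim (simp add: lam)
  qed
  have lam_meas: "(\<lambda>\<omega>. lam \<omega> n) \<in> borel_measurable M" if "n \<ge> 1" for n
    unfolding lam Complex_eq using rv[OF that] by measurable
  have "\<exists>N0>0. \<exists>C>0. \<exists>\<epsilon>>0. \<forall>N::nat. N > N0 \<longrightarrow>
            (let err = (\<lambda>\<omega>. norm (of_real (2 / (real N * mu_D1)) *
                         psi_NIII N (lam \<omega>) (2 * X / (real N * mu_D1))
                                           (4 * T / ((real N)\<^sup>2 * mu_D1\<^sup>2))
                         - Psi_III X T))
             in integrable M err \<and> (\<integral>\<omega>. err \<omega> \<partial>M) \<le> C * real N powr (- \<epsilon>))" for X T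
  proof -
    obtain C where C: "C > 0"
      "\<And>lam N k. k > 0 \<Longrightarrow> inj_on lam {1..N} \<Longrightarrow> (\<And>n. n \<in> {1..N} \<Longrightarrow> Im (lam n) > 0) \<Longrightarrow>
        norm (of_real (1 / k) * psi_NIII N lam (X / k) (T / k\<^sup>2) - Psi_III X T)
          \<le> C * blaschke_gap (\<lambda>n. of_real (1 / k) * lam n) N"
      using psi_NIII_error_le_gap[of X T] by blast
    define C' where "C' = C * (64 * q / m\<^sup>2 + 4 * (V + 1) / m)"
    have C': "C' > 0" unfolding C'_def using C(1) q0 V0 m
      by (intro mult_pos_pos add_nonneg_pos) auto
    have "integrable M err \<and> expectation err \<le> C' * real N powr (- (1 / 2))"
      if N: "N > 1" and err: "err = (\<lambda>\<omega>. norm (of_real (2 / (real N * m)) *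
                         psi_NIII N (lam \<omega>) (2 * X / (real N * m)) (4 * T / ((real N)\<^sup>2 * m\<^sup>2))
                         - Psi_III X T))" for N err
    proof -
      \<comment> \<open>With this \<open>k\<close> the rescaled imaginary parts have expected sum 2,
        the value at which the linear part of the gap vanishes.\<close>
      define k s where "k = real N * m / 2" and "s = sqrt (real N)"
      have k: "k > 0" and s: "s > 0" "s * s = real N" "s \<ge> 1" using N m by (simp_all add: k_def s_def)
      have k_simps: "1 / k = 2 / (real N * m)" "X / k = 2 * X / (real N * m)"
        "T / k\<^sup>2 = 4 * T / ((real N)\<^sup>2 * m\<^sup>2)"
        by (simp_all add: k_def power_divide power_mult_distrib)
      \<comment> \<open>An integrable majorant of the gap: \<open>64 = 16 * 4\<close> with the 4
        from \<open>1 / k^2\<close>, and \<open>4 / (N m)\<close> is \<open>4 * (2 / (N m))\<close>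
        times the \<open>1/2\<close> of the weighted square.\<close>
      define H where "H \<omega> = 64 / ((real N)\<^sup>2 * m\<^sup>2) * (\<Sum>n\<in>{1..N}. (v n \<omega>)\<^sup>2 + (mu n \<omega>)\<^sup>2)
         + 4 / (real N * m) * ((\<Sum>n\<in>{1..N}. Y n \<omega>)\<^sup>2 / s + s)" for \<omega>
      have half: "8 / x * (y / 2) = 4 / x * y" for x y :: real
        by (cases "x = 0") (simp_all add: field_simps)
      have gap_le: "blaschke_gap (\<lambda>n. of_real (1 / k) * lam \<omega> n) N \<le> H \<omega>" for \<omega>
      proof -
        have "(norm (of_real (1 / k) * lam \<omega> n))\<^sup>2 = 4 / ((real N)\<^sup>2 * m\<^sup>2) * ((v n \<omega>)\<^sup>2 + (mu n \<omega>)\<^sup>2)" for n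
          unfolding norm_mult norm_of_real power_mult_distrib power2_abs k_simps
          by (simp add: cmod_power2 lam power_divide power_mult_distrib)
        then have 1: "16 * (\<Sum>n\<in>{1..N}. (norm (of_real (1 / k) * lam \<omega> n))\<^sup>2)
            = 64 / ((real N)\<^sup>2 * m\<^sup>2) * (\<Sum>n\<in>{1..N}. (v n \<omega>)\<^sup>2 + (mu n \<omega>)\<^sup>2)"
          by (simp only: sum_distrib_left[symmetric])
        have "(\<Sum>n\<in>{1..N}. Im (of_real (1 / k) * lam \<omega> n)) - 2 = 2 / (real N * m) * (\<Sum>n\<in>{1..N}. Y n \<omega>)"
          unfolding k_simps using N m
          by (simp add: lam Y_def sum_subtractf right_diff_distrib sum_distrib_left)
        then have "4 * \<bar>(\<Sum>n\<in>{1..N}. Im (of_real (1 / k) * lam \<omega> n)) - 2\<bar>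
            = 8 / (real N * m) * \<bar>\<Sum>n\<in>{1..N}. Y n \<omega>\<bar>"
          using N m by (simp add: abs_mult)
        also have "\<dots> \<le> 8 / (real N * m) * (((\<Sum>n\<in>{1..N}. Y n \<omega>)\<^sup>2 / s + s) / 2)"
          by (rule mult_left_mono[OF abs_le_weighted_square[OF s(1)]]) (use m in simp)
        also have "\<dots> = 4 / (real N * m) * ((\<Sum>n\<in>{1..N}. Y n \<omega>)\<^sup>2 / s + s)" by (rule half)
        finally show ?thesis unfolding blaschke_gap_def 1 H_def by (rule add_left_mono)
      qed
      have AE_err: "AE \<omega> in M. norm (err \<omega>) \<le> C * H \<omega>"
        using good
      proof eventually_elim
        case (elim \<omega>)
        have "err \<omega> \<le> C * blaschke_gap (\<lambda>n. of_real (1 / k) * lam \<omega> n) N"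
          unfolding err k_simps[symmetric]
          by (rule C(2)[OF k]) (use elim in \<open>auto intro: inj_on_subset\<close>)
        also have "\<dots> \<le> C * H \<omega>" using C(1) gap_le by (intro mult_left_mono) auto
        finally show ?case by (simp add: err)
      qed
      have sum_sq: "integrable M (\<lambda>\<omega>. (\<Sum>n\<in>{1..N}. Y n \<omega>)\<^sup>2)"
        "expectation (\<lambda>\<omega>. (\<Sum>n\<in>{1..N}. Y n \<omega>)\<^sup>2) = real N * V"
        using centered_sum_second_moment[of "{1..N}" Y V] Y(3,4) orth by auto
      have sum_q: "integrable M (\<lambda>\<omega>. \<Sum>n\<in>{1..N}. (v n \<omega>)\<^sup>2 + (mu n \<omega>)\<^sup>2)"
        "expectation (\<lambda>\<omega>. \<Sum>n\<in>{1..N}. (v n \<omega>)\<^sup>2 + (mu n \<omega>)\<^sup>2) = real N * q"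
      proof -
        have i: "integrable M (\<lambda>\<omega>. (v n \<omega>)\<^sup>2 + (mu n \<omega>)\<^sup>2)" if "n \<in> {1..N}" for n
          using mom2(1,2)[of n] that by simp
        then show "integrable M (\<lambda>\<omega>. \<Sum>n\<in>{1..N}. (v n \<omega>)\<^sup>2 + (mu n \<omega>)\<^sup>2)"
          by (rule Bochner_Integration.integrable_sum)
        show "expectation (\<lambda>\<omega>. \<Sum>n\<in>{1..N}. (v n \<omega>)\<^sup>2 + (mu n \<omega>)\<^sup>2) = real N * q"
          by (subst Bochner_Integration.integral_sum[OF i]) (use mom2(3) in auto)
      qed
      have H: "integrable M H" unfolding H_def using sum_sq(1) sum_q(1) by auto
      have "expectation H = 64 / ((real N)\<^sup>2 * m\<^sup>2) * (real N * q) + 4 / (real N * m) * (real N * V / s + s)"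
        unfolding H_def using sum_sq sum_q by (simp add: prob_space)
      \<comment> \<open>With \<open>N = s * s\<close> the centered second moment contributes
        \<open>V s\<close> and the weight contributes \<open>s\<close>, both of the same order; the
        quadratic term is one power of \<open>s\<close> smaller and is simply enlarged
        afterwards.\<close>
      also have "\<dots> = 64 * q / m\<^sup>2 / (s * s) + 4 * (V + 1) / m / s"
        using s(1) m unfolding s(2)[symmetric] by (simp add: field_simps power2_eq_square)
      also have "\<dots> \<le> 64 * q / m\<^sup>2 / s + 4 * (V + 1) / m / s"
      proof -
        have "s * 1 \<le> s * s" using s by (intro mult_left_mono) auto
        then have "64 * q / m\<^sup>2 / (s * s) \<le> 64 * q / m\<^sup>2 / s"
          using s q0 by (intro divide_left_mono) auto
        then show ?thesis by simp
      qed
      also have "\<dots> = (64 * q / m\<^sup>2 + 4 * (V + 1) / m) * real N powr (- (1 / 2))"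
      proof -
        have "real N powr (- (1 / 2)) = 1 / s"
          unfolding s_def powr_minus using powr_half_sqrt[of "real N"] by (simp add: inverse_eq_divide)
        then show ?thesis by (simp only: add_divide_distrib times_divide_eq_right mult_1_right)
      qed
      finally have EH: "expectation H \<le> (64 * q / m\<^sup>2 + 4 * (V + 1) / m) * real N powr (- (1 / 2))" .
      have meas: "err \<in> borel_measurable M"
        unfolding err
        by (intro measurable_compose[OF _ borel_measurable_norm] borel_measurable_diff borel_measurable_times
            psi_NIII_measurable lam_meas borel_measurable_const)
      have int: "integrable M err"
        by (rule Bochner_Integration.integrable_bound[OF integrable_mult_right[OF H, of C] meas])
          (use AE_err in eventually_elim, auto)
      have "expectation err \<le> expectation (\<lambda>\<omega>. C * H \<omega>)"
        by (rule integral_mono_AE[OF int integrable_mult_right[OF H]])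
          (use AE_err in eventually_elim, simp add: err)
      also have "\<dots> \<le> C' * real N powr (- (1 / 2))"
        using EH C(1) by (simp add: C'_def mult.assoc)
      finally show ?thesis using int by blast
    qed
    then show ?thesis
      unfolding Let_def m_def
      by (intro exI[of _ 1] exI[of _ C'] exI[of _ "1/2"] conjI allI impI) (use C' in \<open>auto\<close>)
  qed
  moreover have "AE \<omega> in M. \<forall>N\<ge>1.
            norm (psi_NIII N (lam \<omega>) 0 0) = 2 * (\<Sum>j\<in>{1..N}. mu j \<omega>) \<and>
            extremal_soliton N (lam \<omega>) (coeff_III N (lam \<omega>))"
    using good
  proof eventually_elim
    case (elim \<omega>)
    have inj: "inj_on (lam \<omega>) {1..N}" for N
      using elim by (auto intro: inj_on_subset)
    have pos: "Im (lam \<omega> n) > 0" if "n \<in> {1..N}" for n N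
      using elim that by auto
    show ?case
    proof (intro allI impI conjI)
      fix N
      show "norm (psi_NIII N (lam \<omega>) 0 0) = 2 * (\<Sum>j\<in>{1..N}. mu j \<omega>)"
      proof -
        have "norm (psi_NIII N (lam \<omega>) 0 0) = 2 * (\<Sum>j\<in>{1..N}. Im (lam \<omega> j))"
          by (rule norm_psi_NIII_0(1)[OF inj pos])
        then show ?thesis by (simp add: lam)
      qed
      show "extremal_soliton N (lam \<omega>) (coeff_III N (lam \<omega>))"
        by (rule norm_psi_NIII_0(2)[OF inj pos])
    qed
  qed
  ultimately show ?thesis by auto
qed

end
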